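(* (i) $\mathcal H^{s(\lambda)}(A_\lambda)=0$ for $\mathcal L_2$-a.e. $\lambda\in\mathcal M\cap B_{1/\sqrt2}(0)$. (ii) $\mathcal P^{s(\lambda)}(A_\lambda)<\infty$ for all $\lambda\in\mathbb D$, and $\mathcal P^{s(\lambda)}(A_\lambda)>0$ for $\mathcal L_2$-a.e. $\lambda\in\mathcal M\cap B_{1/\sqrt2}(0)$; moreover for any $0<r<R<1/\sqrt2$, $$\dim_H\{\lambda\in\mathcal M:\ r<|\lambda|<R,\ \mathcal P^{s(\lambda)}(A_\lambda)=0\}\le\frac{\log 2}{-\log R}<2.$$ (iii) For $\mathcal L_2$-a.e. $\lambda\in\mathcal M\cap B_{1/\sqrt2}(0)$ the measure $\nu_\lambda$ is equivalent (mutually absolutely continuous) to $\mathcal P^{s(\lambda)}|_{A_\lambda}$.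
   Context: $\mathbb D$ is the open unit disc, $B_r(0)$ the open disc of radius $r$ about $0$, $\mathcal L_2$ area measure. $A_\lambda=\{\sum_{n\ge0}a_n\lambda^n:a_n\in\{-1,1\}\}$; $\mathcal M=\{\lambda\in\mathbb D:\ \exists (a_k)_{k\ge1},\ a_k\in\{-1,0,1\},\ 1+\sum_{k\ge1}a_k\lambda^k=0\}$. $s(\lambda)=\frac{\log2}{-\log|\lambda|}$. $\mathcal H^s$ and $\mathcal P^s$ denote $s$-dimensional Hausdorff and packing measure; $\dim_H$ is Hausdorff dimension. $\nu_\lambda$ is the distribution of $\sum_{n\ge0}\pm\lambda^n$ with independent signs, each $\pm$ with probability $1/2$. *)

theory Defs
  imports "HOL-Probability.Probability"
begin

definition A_set :: "complex \<Rightarrow> complex set" where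
  "A_set l = {z. \<exists>a::nat \<Rightarrow> real. (\<forall>n. a n \<in> {-1, 1}) \<and> z = (\<Sum>n. complex_of_real (a n) * l ^ n)}"

text \<open>The set M: lambda in the unit disc which are zeros of a power series
  1 + sum_{k>=1} a_k lambda^k with a_k in {-1,0,1}.  Here a k stands for a_{k+1}.\<close>
definition M_set :: "complex set" where
  "M_set = {l. norm l < 1 \<and> (\<exists>a::nat \<Rightarrow> int. (\<forall>k. a k \<in> {-1, 0, 1}) \<and>
             1 + (\<Sum>k. of_int (a k) * l ^ Suc k) = 0)}"

definition s_dim :: "complex \<Rightarrow> real" where
  "s_dim l = ln 2 / (- ln (norm l))"

definition diam_pow :: "'a::metric_space set \<Rightarrow> real \<Rightarrow> ennreal" where
  "diam_pow U s = (if U = {} then 0 else if s = 0 then 1 else ennreal (diameter U powr s))"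

definition hausdorff_pre :: "real \<Rightarrow> real \<Rightarrow> 'a::metric_space set \<Rightarrow> ennreal" where
  "hausdorff_pre s \<delta> E =
     (INF U \<in> {U :: nat \<Rightarrow> 'a set. E \<subseteq> (\<Union>i. U i) \<and> (\<forall>i. bounded (U i) \<and> diameter (U i) \<le> \<delta>)}.
        (\<Sum>i. diam_pow (U i) s))"

definition hausdorff_measure :: "real \<Rightarrow> 'a::metric_space set \<Rightarrow> ennreal" where
  "hausdorff_measure s E = (SUP \<delta> \<in> {0<..}. hausdorff_pre s \<delta> E)"

definition packing_pre :: "real \<Rightarrow> 'a::metric_space set \<Rightarrow> ennreal" where
  "packing_pre s E =
     (INF \<delta> \<in> {0<..}.
        SUP p \<in> {(I :: nat set, c :: nat \<Rightarrow> 'a, r :: nat \<Rightarrow> real).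
                   (\<forall>i\<in>I. c i \<in> E \<and> 0 < r i \<and> 2 * r i \<le> \<delta>) \<and>
                   (\<forall>i\<in>I. \<forall>j\<in>I. i \<noteq> j \<longrightarrow> cball (c i) (r i) \<inter> cball (c j) (r j) = {})}.
          (case p of (I, c, r) \<Rightarrow> (\<Sum>i. if i \<in> I then ennreal ((2 * r i) powr s) else 0)))"

definition packing_measure :: "real \<Rightarrow> 'a::metric_space set \<Rightarrow> ennreal" where
  "packing_measure s E =
     (INF Es \<in> {Es :: nat \<Rightarrow> 'a set. E \<subseteq> (\<Union>i. Es i)}. (\<Sum>i. packing_pre s (Es i)))"

definition hausdorff_dim :: "'a::metric_space set \<Rightarrow> real" where
  "hausdorff_dim E = Inf {s. 0 \<le> s \<and> hausdorff_measure s E = 0}"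

definition sign_space :: "(nat \<Rightarrow> real) measure" where
  "sign_space = PiM UNIV (\<lambda>_. measure_pmf (pmf_of_set {-1, 1}))"

definition nu :: "complex \<Rightarrow> complex measure" where
  "nu l = distr sign_space borel (\<lambda>\<omega>. \<Sum>n. complex_of_real (\<omega> n) * l ^ n)"

end

theory Submission
  imports Defs "HOL-Complex_Analysis.Complex_Analysis"
begin


text \<open>
  A power series with coefficients in \<open>[-1, 1]\<close> and constant term \<open>1\<close> cannot have two nearby
  non-real zeros of modulus below \<open>1 / sqrt 2\<close>: together with their conjugates these would be four
  zeros, and dividing by the corresponding Blaschke product contradicts the bound on the
  \<open>\<ell>\<^sup>2\<close> norm of the coefficients. Subtracting a small real cubic interpolant makes this
  quantitative and yields transversality: \<open>|\<lambda>\<^sub>1 - \<lambda>\<^sub>2| \<le> C (|f \<lambda>\<^sub>1| + |f \<lambda>\<^sub>2|)\<close>, locally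
  uniformly in \<open>f\<close>.

  Packing measure. Let \<open>D\<^sub>n\<close> count the pairs of words of length \<open>n\<close> whose sums differ by at most
  \<open>8 |\<lambda>| ^ n\<close>. Then \<open>D\<^sub>n / 2 ^ n\<close> increases exactly by the pairs with different first letters,
  and by transversality the parameters with more than \<open>(2 \<rho>) ^ n\<close> such pairs are covered by
  \<open>(2 / \<rho>) ^ n\<close> balls of radius \<open>O(R ^ n)\<close>. So \<open>D\<^sub>n / 2 ^ n\<close> is bounded off a set of
  vanishing \<open>t\<close>-dimensional Hausdorff measure whenever \<open>2 R ^ t < 1\<close>. When it is bounded, Fatou's
  lemma gives a finite lower \<open>s(\<lambda>)\<close>-density of \<open>\<nu>\<close> almost everywhere, and the \<open>5 r\<close>-covering
  lemma gives positive packing measure on sets of positive \<open>\<nu>\<close>-measure. In the other direction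
  \<open>\<nu>\<close> is bounded below on balls by \<open>r ^ s(\<lambda>)\<close>.

  Hausdorff measure. If for every \<open>\<epsilon>\<close> there are two words of some length \<open>n\<close> whose sums differ by
  less than \<open>\<epsilon> |\<lambda>| ^ n\<close>, then arbitrarily many cylinders of equal level nearly coincide, and the
  Hausdorff content vanishes. Parameters in \<open>M\<close> for which this fails form a porous set.
\<close>

subsection \<open>Transversality\<close>

text \<open>Everything about packing measure rests on \<open>2 * R powr t < 1\<close>. For
  \<open>t = 2\<close> this says \<open>R < 1 / sqrt 2\<close>, and in general
  \<open>t > ln 2 / (- ln R)\<close>, so one family of covers yields both the almost everywhere
  statements and the dimension bound. Transversality degenerates at the real axis, where a zero and
  its conjugate merge and four zeros become two. Real parameters are therefore set aside: they are
  Lebesgue null, and their dimension 1 stays below the claimed bound because \<open>M_set\<close>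
  keeps out of the disc of radius 1/2. Fatou's lemma controls only a lower limit, hence the mass of
  balls at infinitely many scales and not at all small ones. This suits packing measure, where each
  centre may choose its own radius. Hausdorff measure would need every scale, and in fact vanishes.
  Porosity is used for the Hausdorff part because a parameter in \<open>M_set\<close> is close to a
  zero of each truncation of its series; near such a zero two words nearly coincide, which is
  exactly what a separated parameter forbids.\<close>

lemma summable_geometric_bound:
  fixes c :: "nat \<Rightarrow> complex"
  assumes c: "\<And>k. norm (c k) \<le> B * r ^ k" and r: "0 \<le> r" "r \<le> 1" and v: "norm v < 1"
  shows "summable (\<lambda>k. c k * v ^ k)"
proof (rule summable_comparison_test')
  have "norm (c 0) \<le> B" using c[of 0] by simp
  then have B: "0 \<le> B" using norm_ge_zero[of "c 0"] by linarith
  show "summable (\<lambda>k. B * norm v ^ k)" using v by (intro summable_mult summable_geometric) auto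
  fix k :: nat
  have "r ^ k \<le> 1" using r by (simp add: power_le_one)
  then have "norm (c k) \<le> B" using c[of k] B mult_left_mono[of "r ^ k" 1 B] by auto
  then show "norm (c k * v ^ k) \<le> B * norm v ^ k"
    by (simp add: norm_mult norm_power mult_right_mono)
qed

text \<open>Dividing out a Blaschke factor preserves the \<open>\<ell>\<^sup>2\<close> norm of the coefficients: with
  \<open>f = (z - w) q\<close> and \<open>g = (1 - cnj w z) q\<close> the difference of the squared moduli of the
  coefficients telescopes.\<close>
lemma blaschke_step:
  fixes c :: "nat \<Rightarrow> complex" and w :: complex
  assumes c: "\<And>k. norm (c k) \<le> B * r ^ k" and r: "0 < r" "r < 1" and w: "norm w < 1"
    and zero: "(\<Sum>k. c k * w ^ k) = 0"
  shows "\<exists>d B'. (\<forall>k. norm (d k) \<le> B' * r ^ k) \<and>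
     (\<Sum>k. (norm (d k))\<^sup>2) = (\<Sum>k. (norm (c k))\<^sup>2) \<and>
     norm (c 0) = norm w * norm (d 0) \<and>
     (\<forall>v. norm v < 1 \<longrightarrow> v \<noteq> w \<longrightarrow> (\<Sum>k. c k * v ^ k) = 0 \<longrightarrow> (\<Sum>k. d k * v ^ k) = 0)"
proof -
  have "norm (c 0) \<le> B" using c[of 0] by simp
  then have B: "0 \<le> B" using norm_ge_zero[of "c 0"] by linarith
  \<comment> \<open>Synthetic division by \<open>z - w\<close>: \<open>q\<close> collects the
    coefficients of the quotient. The zero at \<open>w\<close> enters only through
    \<open>c0\<close>, where it makes the remainder vanish.\<close>
  define q where "q n = (\<Sum>j. c (Suc n + j) * w ^ j)" for n
  have bd: "norm (c (n + j)) \<le> (B * r ^ n) * r ^ j" for n j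
    using c[of "n + j"] by (simp add: power_add mult.assoc)
  have sm: "summable (\<lambda>j. c (n + j) * w ^ j)" for n
    using summable_geometric_bound[OF bd[of n]] r w by auto
  have split: "(\<Sum>j. c (n + j) * w ^ j) = c n + w * q n" for n
  proof -
    have "(\<Sum>j. c (n + j) * w ^ j) = c n + (\<Sum>j. w * (c (Suc n + j) * w ^ j))"
      using suminf_split_head[OF sm[of n]] by (simp add: algebra_simps)
    also have "\<dots> = c n + w * q n"
      unfolding q_def by (subst suminf_mult[OF sm]) auto
    finally show ?thesis .
  qed
  have c0: "c 0 = - w * q 0"
    using split[of 0] zero by (simp add: eq_neg_iff_add_eq_0)
  have cS: "c (Suc k) = q k - w * q (Suc k)" for k
    using split[of "Suc k"] unfolding q_def[of k] by simp
  define Q where "Q = B * r / (1 - norm w)"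
  have Q: "0 \<le> Q" using B r w by (simp add: Q_def)
  have qb: "norm (q n) \<le> Q * r ^ n" for n
  proof -
    have sg: "summable (\<lambda>j. (B * r ^ Suc n) * norm w ^ j)"
      using w by (intro summable_mult summable_geometric) auto
    have "norm (q n) \<le> (\<Sum>j. (B * r ^ Suc n) * norm w ^ j)"
      unfolding q_def
    proof (rule norm_suminf_le[OF _ sg])
      fix j
      have "r ^ j \<le> 1" using r by (simp add: power_le_one)
      then have "(B * r ^ Suc n) * r ^ j \<le> B * r ^ Suc n * 1"
        using B r by (intro mult_left_mono) auto
      then have "norm (c (Suc n + j)) \<le> B * r ^ Suc n" using bd[of "Suc n" j] by linarith
      then show "norm (c (Suc n + j) * w ^ j) \<le> B * r ^ Suc n * norm w ^ j"
        by (simp add: norm_mult norm_power mult_right_mono)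
    qed
    also have "\<dots> = Q * r ^ n"
      using w by (simp add: suminf_mult suminf_geometric summable_geometric Q_def divide_inverse)
    finally show ?thesis .
  qed
  define d where "d k = (case k of 0 \<Rightarrow> q 0 | Suc j \<Rightarrow> q (Suc j) - cnj w * q j)" for k
  have d0: "d 0 = q 0" and dS: "d (Suc k) = q (Suc k) - cnj w * q k" for k by (auto simp: d_def)
  define B' where "B' = Q + Q / r"
  have db: "norm (d k) \<le> B' * r ^ k" for k
  proof (cases k)
    case 0
    then show ?thesis using qb[of 0] Q r by (simp add: d0 B'_def add_increasing2)
  next
    case (Suc j)
    have "norm (d k) \<le> norm (q (Suc j)) + norm w * norm (q j)"
      unfolding Suc dS using norm_triangle_ineq4[of "q (Suc j)" "cnj w * q j"] by (simp add: norm_mult)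
    also have "\<dots> \<le> Q * r ^ Suc j + 1 * (Q * r ^ j)"
      using w qb[of "Suc j"] qb[of j] by (intro add_mono mult_mono) auto
    also have "\<dots> = B' * r ^ k" using r by (simp add: Suc B'_def field_simps)
    finally show ?thesis .
  qed
  \<comment> \<open>The telescoped sum leaves one boundary term, which the geometric decay of
    \<open>q\<close> sends to 0. This is why the decay \<open>B * r ^ k\<close> is a hypothesis and
    is established again for \<open>d\<close>, so that the division can be repeated.\<close>
  have partial: "(\<Sum>k\<le>N. (norm (d k))\<^sup>2) = (\<Sum>k\<le>N. (norm (c k))\<^sup>2) + (1 - (norm w)\<^sup>2) * (norm (q N))\<^sup>2" for N
  proof (induction N)
    case 0
    show ?case by (simp add: d0 c0 norm_mult power_mult_distrib algebra_simps)
  next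
    case (Suc N)
    have "(norm (d (Suc N)))\<^sup>2 - (norm (c (Suc N)))\<^sup>2
        = (1 - (norm w)\<^sup>2) * ((norm (q (Suc N)))\<^sup>2 - (norm (q N))\<^sup>2)"
      unfolding dS cS cmod_power2 by (simp add: power2_eq_square algebra_simps)
    with Suc show ?case by (simp add: algebra_simps)
  qed
  have sqs: "summable (\<lambda>k. (norm (x k))\<^sup>2)" if "\<And>k. norm (x k) \<le> K * r ^ k" for x :: "nat \<Rightarrow> complex" and K
  proof (rule summable_comparison_test')
    show "summable (\<lambda>k. K\<^sup>2 * (r\<^sup>2) ^ k)"
      using r by (intro summable_mult summable_geometric) (simp add: power_less_one_iff)
    fix k
    show "norm ((norm (x k))\<^sup>2) \<le> K\<^sup>2 * (r\<^sup>2) ^ k"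
      using power_mono[OF that[of k], of 2] by (simp add: power_mult_distrib power_mult[symmetric] mult.commute)
  qed
  have "(\<lambda>N. (norm (q N))) \<longlonglongrightarrow> 0"
    by (rule tendsto_0_le[where K=Q and f="\<lambda>n. r ^ n"])
       (use r qb LIMSEQ_realpow_zero[of r] in \<open>auto simp: mult.commute\<close>)
  then have "(\<lambda>N. (\<Sum>k\<le>N. (norm (c k))\<^sup>2) + (1 - (norm w)\<^sup>2) * (norm (q N))\<^sup>2)
      \<longlonglongrightarrow> (\<Sum>k. (norm (c k))\<^sup>2) + (1 - (norm w)\<^sup>2) * 0\<^sup>2"
    by (intro tendsto_intros summable_LIMSEQ' sqs[OF c])
  moreover have "(\<lambda>N. (\<Sum>k\<le>N. (norm (d k))\<^sup>2)) \<longlonglongrightarrow> (\<Sum>k. (norm (d k))\<^sup>2)"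
    by (intro summable_LIMSEQ' sqs[OF db])
  ultimately have eq: "(\<Sum>k. (norm (d k))\<^sup>2) = (\<Sum>k. (norm (c k))\<^sup>2)"
    unfolding partial using LIMSEQ_unique by fastforce
  have zeros: "(\<Sum>k. d k * v ^ k) = 0"
    if v: "norm v < 1" "v \<noteq> w" and z: "(\<Sum>k. c k * v ^ k) = 0" for v
  proof -
    define S where "S = (\<Sum>k. q k * v ^ k)"
    have sq: "summable (\<lambda>k. q k * v ^ k)"
      using summable_geometric_bound[OF qb] r v by auto
    have sqS: "summable (\<lambda>k. q (Suc k) * v ^ Suc k)"
      using sq by (subst summable_Suc_iff[of "\<lambda>k. q k * v ^ k"])
    have SS: "(\<Sum>k. q (Suc k) * v ^ Suc k) = S - q 0"
      unfolding S_def using suminf_split_head[OF sq] by simp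
    have "(\<Sum>k. c k * v ^ k) = (\<Sum>k. c (Suc k) * v ^ Suc k) + c 0"
      using suminf_split_head[OF summable_geometric_bound[OF c _ _ v(1)]] r by simp
    also have "(\<Sum>k. c (Suc k) * v ^ Suc k) = (\<Sum>k. v * (q k * v ^ k) - w * (q (Suc k) * v ^ Suc k))"
      by (simp add: cS algebra_simps)
    also have "\<dots> = v * S - w * (S - q 0)"
      by (subst suminf_diff[symmetric]) (use sq sqS SS in \<open>auto simp: S_def suminf_mult intro!: summable_mult\<close>)
    finally have "(v - w) * S = 0" using z c0 by (simp add: left_diff_distrib right_diff_distrib)
    then have S0: "S = 0" using v by simp
    have "(\<Sum>k. d k * v ^ k) = (\<Sum>k. d (Suc k) * v ^ Suc k) + d 0"
      using suminf_split_head[OF summable_geometric_bound[OF db _ _ v(1)]] r by simp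
    also have "(\<Sum>k. d (Suc k) * v ^ Suc k) = (\<Sum>k. q (Suc k) * v ^ Suc k - (cnj w * v) * (q k * v ^ k))"
      by (simp add: dS algebra_simps)
    also have "\<dots> = (S - q 0) - (cnj w * v) * S"
      by (subst suminf_diff[symmetric]) (use sq sqS SS in \<open>auto simp: S_def suminf_mult intro!: summable_mult\<close>)
    finally show ?thesis using S0 d0 by simp
  qed
  show ?thesis
    using db eq zeros by (intro exI[of _ d] exI[of _ B']) (auto simp: c0 d0 norm_mult)
qed

text \<open>Each division by a Blaschke factor splits \<open>norm w\<close> off the constant term
  and keeps the square sum. After four divisions the remaining constant term is at most the root of
  that square sum.\<close>

lemma four_zeros_bound:
  fixes c :: "nat \<Rightarrow> complex"
  assumes c: "\<And>k. norm (c k) \<le> B * r ^ k" and r: "0 < r" "r < 1"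
    and W: "distinct [w1, w2, w3, w4]" "norm w1 < 1" "norm w2 < 1" "norm w3 < 1" "norm w4 < 1"
    and Z: "(\<Sum>k. c k * w1 ^ k) = 0" "(\<Sum>k. c k * w2 ^ k) = 0" "(\<Sum>k. c k * w3 ^ k) = 0" "(\<Sum>k. c k * w4 ^ k) = 0"
  shows "norm (c 0) \<le> norm w1 * norm w2 * norm w3 * norm w4 * sqrt (\<Sum>k. (norm (c k))\<^sup>2)"
proof -
  obtain d1 B1 where d1: "\<forall>k. norm (d1 k) \<le> B1 * r ^ k"
     "(\<Sum>k. (norm (d1 k))\<^sup>2) = (\<Sum>k. (norm (c k))\<^sup>2)" "norm (c 0) = norm w1 * norm (d1 0)"
     "\<forall>v. norm v < 1 \<longrightarrow> v \<noteq> w1 \<longrightarrow> (\<Sum>k. c k * v ^ k) = 0 \<longrightarrow> (\<Sum>k. d1 k * v ^ k) = 0"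
    using blaschke_step[OF c r W(2) Z(1)] by blast
  have z1: "(\<Sum>k. d1 k * w2 ^ k) = 0" "(\<Sum>k. d1 k * w3 ^ k) = 0" "(\<Sum>k. d1 k * w4 ^ k) = 0"
    using W Z d1(4) by auto
  obtain d2 B2 where d2: "\<forall>k. norm (d2 k) \<le> B2 * r ^ k"
     "(\<Sum>k. (norm (d2 k))\<^sup>2) = (\<Sum>k. (norm (d1 k))\<^sup>2)" "norm (d1 0) = norm w2 * norm (d2 0)"
     "\<forall>v. norm v < 1 \<longrightarrow> v \<noteq> w2 \<longrightarrow> (\<Sum>k. d1 k * v ^ k) = 0 \<longrightarrow> (\<Sum>k. d2 k * v ^ k) = 0"
    using blaschke_step[OF d1(1)[rule_format] r W(3) z1(1)] by blast
  have z2: "(\<Sum>k. d2 k * w3 ^ k) = 0" "(\<Sum>k. d2 k * w4 ^ k) = 0"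
    using W z1 d2(4) by auto
  obtain d3 B3 where d3: "\<forall>k. norm (d3 k) \<le> B3 * r ^ k"
     "(\<Sum>k. (norm (d3 k))\<^sup>2) = (\<Sum>k. (norm (d2 k))\<^sup>2)" "norm (d2 0) = norm w3 * norm (d3 0)"
     "\<forall>v. norm v < 1 \<longrightarrow> v \<noteq> w3 \<longrightarrow> (\<Sum>k. d2 k * v ^ k) = 0 \<longrightarrow> (\<Sum>k. d3 k * v ^ k) = 0"
    using blaschke_step[OF d2(1)[rule_format] r W(4) z2(1)] by blast
  have z3: "(\<Sum>k. d3 k * w4 ^ k) = 0"
    using W z2 d3(4) by auto
  obtain d4 :: "nat \<Rightarrow> complex" and B4 where d4: "\<forall>k. norm (d4 k) \<le> B4 * r ^ k"
     "(\<Sum>k. (norm (d4 k))\<^sup>2) = (\<Sum>k. (norm (d3 k))\<^sup>2)" "norm (d3 0) = norm w4 * norm (d4 0)"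
    using blaschke_step[OF d3(1)[rule_format] r W(5) z3] by blast
  have r2: "r\<^sup>2 < 1" using r by (simp add: power_less_one_iff)
  have "summable (\<lambda>k. (norm (d4 k))\<^sup>2)"
  proof (rule summable_comparison_test')
    show "summable (\<lambda>k. B4\<^sup>2 * (r\<^sup>2) ^ k)" using r2 by (intro summable_mult summable_geometric) auto
    fix k
    show "norm ((norm (d4 k))\<^sup>2) \<le> B4\<^sup>2 * (r\<^sup>2) ^ k"
      using power_mono[OF d4(1)[rule_format, of k], of 2] by (simp add: power_mult_distrib power_mult[symmetric] mult.commute)
  qed
  then have "(\<Sum>k<1. (norm (d4 k))\<^sup>2) \<le> (\<Sum>k. (norm (d4 k))\<^sup>2)"
    by (rule sum_le_suminf) auto
  then have "norm (d4 0) \<le> sqrt (\<Sum>k. (norm (c k))\<^sup>2)"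
    by (intro real_le_rsqrt) (simp add: d4(2) d3(2) d2(2) d1(2))
  then show ?thesis
    unfolding d1(3) d2(3) d3(3) d4(3) by (simp add: mult.assoc mult_left_mono)
qed


section \<open>Power series with real coefficients and their nearby zeros\<close>

definition pseries :: "(nat \<Rightarrow> real) \<Rightarrow> complex \<Rightarrow> complex" where
  "pseries a z = (\<Sum>k. complex_of_real (a k) * z ^ k)"

lemma summable_pseries:
  assumes "\<And>k. \<bar>a k\<bar> \<le> B" "norm z < 1"
  shows "summable (\<lambda>k. complex_of_real (a k) * z ^ k)"
  using assms by (intro summable_geometric_bound[of _ B 1]) auto

lemma pseries_cnj:
  assumes "\<And>k. \<bar>a k\<bar> \<le> B" "norm z < 1"
  shows "pseries a (cnj z) = cnj (pseries a z)"
proof -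
  have "(\<lambda>k. cnj (complex_of_real (a k) * z ^ k)) sums cnj (pseries a z)"
    unfolding pseries_def by (subst sums_cnj) (rule summable_sums[OF summable_pseries[OF assms]])
  then show ?thesis unfolding pseries_def by (simp add: sums_iff)
qed

text \<open>\<open>1\<close> and \<open>z\<close> form a real basis of the plane as long as
  \<open>z\<close> is nonreal. The bounds record the factor \<open>1 / y\<close> that is lost as
  \<open>z\<close> approaches the real axis.\<close>

lemma real_linear_interpolation:
  fixes z A :: complex
  assumes y: "0 < y" "y \<le> \<bar>Im z\<bar>"
  obtains u v :: real where "of_real u + of_real v * z = A" "\<bar>v\<bar> \<le> norm A / y" "\<bar>u\<bar> \<le> norm A + norm A / y * norm z"
proof
  define v where "v = Im A / Im z"
  define u where "u = Re A - v * Re z"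
  show "of_real u + of_real v * z = A"
    using y by (simp add: complex_eq_iff u_def v_def)
  show v: "\<bar>v\<bar> \<le> norm A / y"
    using y abs_Im_le_cmod[of A] by (auto simp: v_def abs_divide intro!: frac_le)
  have "\<bar>u\<bar> \<le> \<bar>Re A\<bar> + \<bar>v\<bar> * \<bar>Re z\<bar>" unfolding u_def by (simp add: abs_mult[symmetric])
  also have "\<dots> \<le> norm A + norm A / y * norm z"
    using v abs_Re_le_cmod[of A] abs_Re_le_cmod[of z] y by (intro add_mono mult_mono) auto
  finally show "\<bar>u\<bar> \<le> norm A + norm A / y * norm z" .
qed

text \<open>Newton interpolation with real coefficients: the cubic
  \<open>(u + v z) + (s + t z) (z - l1) (z - cnj l1)\<close> matches the series at \<open>l1\<close>
  and \<open>l2\<close>, hence also at their conjugates. If the values are small compared with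
  \<open>norm (l1 - l2)\<close>, its coefficients are at most \<open>1 / 20\<close>. Subtracting it
  leaves a series with four zeros and constant term close to 1, against
  \<open>four_zeros_bound\<close>.\<close>

lemma pseries_separation:
  fixes l1 l2 :: complex
  assumes y: "0 < y" "y \<le> 1" and Iy: "y \<le> \<bar>Im l1\<bar>" "y \<le> \<bar>Im l2\<bar>" "0 < Im l1 * Im l2"
    and l: "norm l1 < 1 / sqrt 2" "norm l2 < 1 / sqrt 2"
    and a: "a 0 = 1" "\<And>k. \<bar>a k\<bar> \<le> 1"
  shows "norm (l1 - l2) \<le> (600 / y ^ 3) * (norm (pseries a l1) + norm (pseries a l2))"
proof (rule ccontr)
  \<comment> \<open>Three factors \<open>1 / y\<close> accumulate: in \<open>u\<close>,
    \<open>v\<close>, in the bound for \<open>norm (l2 - cnj l1)\<close>, and in \<open>s\<close>,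
    \<open>t\<close>. The 600 then leaves each coefficient of the cubic at most
    \<open>1 / 20\<close>.\<close>
  define \<kappa> where "\<kappa> = y ^ 3 / 600"
  have k0: "0 < \<kappa>" using y by (simp add: \<kappa>_def)
  assume "\<not> ?thesis"
  then have small: "norm (pseries a l1) + norm (pseries a l2) < \<kappa> * norm (l1 - l2)"
    using y unfolding \<kappa>_def by (simp add: field_simps)
  have ne: "l1 \<noteq> l2" using small norm_ge_zero[of "pseries a l1"] norm_ge_zero[of "pseries a l2"] by auto
  have sq2: "1 / sqrt 2 < 1" by simp
  have l': "norm l1 < 1" "norm l2 < 1" using l sq2 by linarith+
  have "norm (l1 - l2) \<le> 2" using norm_triangle_ineq4[of l1 l2] l' by linarith
  then have k2: "\<kappa> * norm (l1 - l2) \<le> \<kappa> * 2" using k0 by (intro mult_left_mono) auto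
  define A1 where "A1 = pseries a l1"
  define A2 where "A2 = pseries a l2"
  have A1: "norm A1 \<le> 2 * \<kappa>" using small k2 norm_ge_zero[of "pseries a l2"] unfolding A1_def by linarith
  have A12: "norm (A2 - A1) \<le> \<kappa> * norm (l2 - l1)"
    using small norm_triangle_ineq4[of A2 A1] by (simp add: A1_def A2_def norm_minus_commute)
  obtain u v where uv: "of_real u + of_real v * l1 = A1" "\<bar>v\<bar> \<le> norm A1 / y"
      and u: "\<bar>u\<bar> \<le> norm A1 + norm A1 / y * norm l1"
    by (rule real_linear_interpolation[OF y(1) Iy(1), of A1])
  have v: "\<bar>v\<bar> \<le> 2 * \<kappa> / y" using uv(2) divide_right_mono[OF A1, of y] y by linarith
  have kY: "\<kappa> \<le> \<kappa> / y" using y k0 by (simp add: field_simps)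
  have "norm A1 / y * norm l1 \<le> (2 * \<kappa> / y) * 1"
    using A1 y l' k0 by (intro mult_mono divide_right_mono) auto
  then have u: "\<bar>u\<bar> \<le> 4 * (\<kappa> / y)" using u A1 kY by simp
  \<comment> \<open>The value that \<open>s + t z\<close> has to take at \<open>l2\<close>. Dividing
    by \<open>l2 - l1\<close> is harmless: the numerator equals
    \<open>(A2 - A1) - v (l2 - l1)\<close>, and the negated claim bounds \<open>A2 - A1\<close> by a
    multiple of the same distance.\<close>
  define Z where "Z = (A2 - of_real u - of_real v * l2) / ((l2 - l1) * (l2 - cnj l1))"
  \<comment> \<open>Imaginary parts of equal sign keep \<open>l2\<close> away from
    \<open>cnj l1\<close>.\<close>
  have lc: "y \<le> norm (l2 - cnj l1)"
  proof -
    have "y \<le> \<bar>Im l2 + Im l1\<bar>" using Iy by (auto simp: zero_less_mult_iff)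
    also have "\<dots> \<le> norm (l2 - cnj l1)" using abs_Im_le_cmod[of "l2 - cnj l1"] by simp
    finally show ?thesis .
  qed
  have "norm (A2 - of_real u - of_real v * l2) = norm ((A2 - A1) - of_real v * (l2 - l1))"
    by (rule arg_cong[where f=norm]) (simp add: uv(1)[symmetric] algebra_simps)
  also have "\<dots> \<le> \<kappa> * norm (l2 - l1) + (2 * \<kappa> / y) * norm (l2 - l1)"
    using norm_triangle_ineq4[of "A2 - A1" "of_real v * (l2 - l1)"] A12 mult_right_mono[OF v, of "norm (l2 - l1)"]
    by (simp add: norm_mult)
  also have "\<dots> \<le> (3 * (\<kappa> / y)) * norm (l2 - l1)"
    using mult_right_mono[OF kY, of "norm (l2 - l1)"] by (simp add: distrib_right[symmetric] mult_right_mono kY)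
  finally have "norm Z \<le> (3 * (\<kappa> / y)) * norm (l2 - l1) / (norm (l2 - l1) * norm (l2 - cnj l1))"
    unfolding Z_def norm_divide norm_mult by (rule divide_right_mono) auto
  also have "\<dots> = 3 * (\<kappa> / y) / norm (l2 - cnj l1)" using ne by simp
  also have "\<dots> \<le> 3 * (\<kappa> / y) / y" using lc y k0 by (intro divide_left_mono mult_pos_pos) auto
  finally have Z: "norm Z \<le> 3 * (\<kappa> / y\<^sup>2)" by (simp add: power2_eq_square)
  obtain s t where st: "of_real s + of_real t * l2 = Z" "\<bar>t\<bar> \<le> norm Z / y"
      and s: "\<bar>s\<bar> \<le> norm Z + norm Z / y * norm l2"
    by (rule real_linear_interpolation[OF y(1) Iy(2), of Z])
  have ZY: "norm Z / y \<le> 3 * (\<kappa> / y ^ 3)"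
    using divide_right_mono[OF Z, of y] y by (simp add: power2_eq_square power3_eq_cube)
  have t: "\<bar>t\<bar> \<le> 3 * (\<kappa> / y ^ 3)" using st(2) ZY by linarith
  have "norm Z \<le> norm Z / y" using y by (simp add: pos_le_divide_eq mult_left_le)
  moreover have "norm Z / y * norm l2 \<le> norm Z / y * 1" using l' y by (intro mult_left_mono) auto
  ultimately have s: "\<bar>s\<bar> \<le> 6 * (\<kappa> / y ^ 3)" using s ZY by linarith
  have y3: "\<kappa> / y \<le> \<kappa> / y ^ 3"
    using y k0 power_decreasing[of 1 3 y] by (intro divide_left_mono) auto
  have kap: "\<kappa> / y ^ 3 = 1 / 600" using y by (simp add: \<kappa>_def)
  have bnds: "\<bar>u\<bar> \<le> 4 / 600" "\<bar>v\<bar> \<le> 2 / 600" "\<bar>s\<bar> \<le> 6 / 600" "\<bar>t\<bar> \<le> 3 / 600"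
  proof -
    have k: "\<kappa> / y \<le> 1 / 600" using y3 kap by simp
    show "\<bar>u\<bar> \<le> 4 / 600" using u k by linarith
    have "2 * \<kappa> / y = 2 * (\<kappa> / y)" by simp
    then show "\<bar>v\<bar> \<le> 2 / 600" using v k by linarith
    show "\<bar>s\<bar> \<le> 6 / 600" "\<bar>t\<bar> \<le> 3 / 600" using s t by (simp_all add: kap)
  qed
  define n where "n = (norm l1)\<^sup>2"
  define \<rho> where "\<rho> = Re l1"
  have n: "0 \<le> n" "n \<le> 1" using l' by (auto simp: n_def power_le_one)
  have rho: "\<bar>\<rho>\<bar> \<le> 1" using abs_Re_le_cmod[of l1] l' by (simp add: \<rho>_def)
  define h :: "nat \<Rightarrow> real" where
    "h k = (if k = 0 then u + s * n else if k = 1 then v - 2 * (s * \<rho>) + t * n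
            else if k = 2 then s - 2 * (t * \<rho>) else if k = 3 then t else 0)" for k
  have pb: "\<bar>x * w\<bar> \<le> \<bar>x\<bar>" if "\<bar>w\<bar> \<le> 1" for x w :: real
    using that mult_left_mono[of "\<bar>w\<bar>" 1 "\<bar>x\<bar>"] by (simp add: abs_mult)
  have hb: "\<bar>h k\<bar> \<le> 1 / 20" for k
  proof -
    have "\<bar>n\<bar> \<le> 1" using n by simp
    note pbn = pb[OF this, THEN order_trans] and pbr = pb[OF rho, THEN order_trans]
    have *: "\<bar>s * n\<bar> \<le> 6 / 600" "\<bar>s * \<rho>\<bar> \<le> 6 / 600" "\<bar>t * n\<bar> \<le> 3 / 600" "\<bar>t * \<rho>\<bar> \<le> 3 / 600"
      by (fact pbn[OF bnds(3)] pbr[OF bnds(3)] pbn[OF bnds(4)] pbr[OF bnds(4)])+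
    have "\<bar>u + s * n\<bar> \<le> 1 / 20" using bnds(1) *(1) by linarith
    moreover have "\<bar>v - 2 * (s * \<rho>) + t * n\<bar> \<le> 1 / 20" using bnds(2) *(2,3) by linarith
    moreover have "\<bar>s - 2 * (t * \<rho>)\<bar> \<le> 1 / 20" using bnds(3) *(4) by linarith
    moreover have "\<bar>t\<bar> \<le> 1 / 20" using bnds(4) by linarith
    ultimately
    show ?thesis by (auto simp: h_def)
  qed
  have h_fin: "h k = 0" if "k \<notin> {..<4}" for k using that by (auto simp: h_def)
  have ph: "pseries h z = (of_real u + of_real v * z) + (of_real s + of_real t * z) * ((z - l1) * (z - cnj l1))" for z
  proof -
    have q: "(z - l1) * (z - cnj l1) = z\<^sup>2 - of_real (2 * \<rho>) * z + of_real n"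
    proof -
      have "(z - l1) * (z - cnj l1) = z\<^sup>2 - (l1 + cnj l1) * z + l1 * cnj l1"
        by (simp add: algebra_simps power2_eq_square)
      then show ?thesis
        by (simp only: complex_add_cnj \<rho>_def n_def complex_norm_square[of l1])
    qed
    have "pseries h z = (\<Sum>k<4. of_real (h k) * z ^ k)"
      unfolding pseries_def by (rule suminf_finite) (use h_fin in auto)
    also have "\<dots> = of_real (h 0) + of_real (h 1) * z + of_real (h 2) * z\<^sup>2 + of_real (h 3) * z ^ 3"
      by (simp add: eval_nat_numeral)
    also have "\<dots> = (of_real u + of_real v * z) + (of_real s + of_real t * z) * (z\<^sup>2 - of_real (2 * \<rho>) * z + of_real n)"
      unfolding h_def by (simp add: algebra_simps power2_eq_square power3_eq_cube)
    finally show ?thesis unfolding q .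
  qed
  define b where "b k = a k - h k" for k
  have bb: "\<bar>b k\<bar> \<le> 21 / 20" for k using a(2)[of k] hb[of k] unfolding b_def by linarith
  have pb: "pseries b z = pseries a z - pseries h z" if "norm z < 1" for z
    unfolding pseries_def b_def
    using suminf_diff[OF summable_pseries[OF a(2) that] summable_pseries[OF hb that]] by (simp add: algebra_simps)
  have z1: "pseries b l1 = 0" using uv(1) l' by (simp add: pb ph A1_def)
  have z2: "pseries b l2 = 0"
  proof -
    have "(of_real s + of_real t * l2) * ((l2 - l1) * (l2 - cnj l1)) = A2 - of_real u - of_real v * l2"
      unfolding st(1) Z_def using ne lc y by auto
    then show ?thesis unfolding pb[OF l'(2)] ph A2_def by (simp only:) simp
  qed
  have z3: "pseries b (cnj l1) = 0" "pseries b (cnj l2) = 0"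
    unfolding pseries_cnj[OF bb l'(1)] pseries_cnj[OF bb l'(2)] z1 z2 by simp_all
  \<comment> \<open>Rescaling makes the coefficients square summable. For coefficients in [-1, 1]
    the four-zero bound becomes \<open>(1 / 4) / (r ^ 4 * sqrt (1 - r ^ 2))\<close>, which is
    smallest at \<open>r ^ 2 = 4 / 5\<close>, with value about 0.873. The perturbation by
    \<open>h\<close> raises it to less than 0.92, still below \<open>19 / 20\<close>, the least
    possible constant term.\<close>
  define r where "r = 2 / sqrt 5"
  have r2: "r\<^sup>2 = 4 / 5" by (simp add: r_def power_divide)
  have r0: "0 < r" by (simp add: r_def)
  have r1: "r < 1" using r2 r0 by (intro power2_less_imp_less[of r 1]) auto
  define c where "c k = complex_of_real (b k * r ^ k)" for k
  have cb: "norm (c k) \<le> 21 / 20 * r ^ k" for k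
    using bb[of k] r0 by (simp add: c_def abs_mult norm_mult norm_power mult_right_mono)
  have cz: "(\<Sum>k. c k * (z / of_real r) ^ k) = pseries b z" for z
    using r0 by (simp add: c_def pseries_def power_divide)
  have w1: "norm (z / of_real r) < 1" and w2: "(norm (z / of_real r))\<^sup>2 < 5 / 8" if "norm z < 1 / sqrt 2" for z :: complex
  proof -
    have "(norm z)\<^sup>2 < (1 / sqrt 2)\<^sup>2" using that by (intro power_strict_mono) auto
    then have z: "(norm z)\<^sup>2 < 1 / 2" by (simp add: power_divide)
    have "(norm (z / of_real r))\<^sup>2 = (norm z)\<^sup>2 * (5 / 4)"
      using r0 by (simp add: norm_divide power_divide r2)
    then show *: "(norm (z / of_real r))\<^sup>2 < 5 / 8" using z by simp
    then have "(norm (z / of_real r))\<^sup>2 < 1" by linarith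
    then show "norm (z / of_real r) < 1" by (simp add: power_less_one_iff)
  qed
  have im: "Im l1 \<noteq> 0" "Im l2 \<noteq> 0" "Im l1 \<noteq> - Im l2" using Iy y by (auto simp: zero_less_mult_iff)
  have dist: "distinct [l1 / of_real r, l2 / of_real r, cnj l1 / of_real r, cnj l2 / of_real r]"
    using ne r0 im by (auto simp: complex_eq_iff field_simps)
  have main: "norm (c 0) \<le> norm (l1 / of_real r) * norm (l2 / of_real r) * norm (cnj l1 / of_real r) * norm (cnj l2 / of_real r)
      * sqrt (\<Sum>k. (norm (c k))\<^sup>2)"
    by (rule four_zeros_bound[OF cb r0 r1 dist]) (use l z1 z2 z3 in \<open>auto intro: w1 simp: cz simp del: norm_divide\<close>)
  have sm: "summable (\<lambda>k. (21 / 20)\<^sup>2 * (4 / 5 :: real) ^ k)" by (intro summable_mult summable_geometric) auto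
  have le: "(norm (c k))\<^sup>2 \<le> (21 / 20)\<^sup>2 * (4 / 5) ^ k" for k
    proof -
      have "(norm (c k))\<^sup>2 \<le> (21 / 20 * r ^ k)\<^sup>2" using cb by (intro power_mono) auto
      also have "\<dots> = (21 / 20)\<^sup>2 * (r\<^sup>2) ^ k" by (simp only: power_mult_distrib power_mult[symmetric] mult.commute)
      finally show ?thesis unfolding r2 .
    qed
  have sumc: "summable (\<lambda>k. (norm (c k))\<^sup>2)" by (rule summable_comparison_test'[OF sm]) (use le in auto)
  have "(\<Sum>k. (norm (c k))\<^sup>2) \<le> (\<Sum>k. (21 / 20)\<^sup>2 * (4 / 5) ^ k)"
    by (rule suminf_le[OF le sumc sm])
  also have "\<dots> = (21 / 20)\<^sup>2 * 5" by (subst suminf_mult) (auto simp: suminf_geometric summable_geometric)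
  also have "\<dots> \<le> (2.35 :: real)\<^sup>2" by (simp add: power2_eq_square)
  finally have "sqrt (\<Sum>k. (norm (c k))\<^sup>2) \<le> 2.35" by (intro real_le_lsqrt) auto
  moreover have "norm (l1 / of_real r) * norm (l2 / of_real r) * norm (cnj l1 / of_real r) * norm (cnj l2 / of_real r) \<le> 25 / 64"
  proof -
    have "(norm (l1 / of_real r))\<^sup>2 * (norm (l2 / of_real r))\<^sup>2 \<le> 5 / 8 * (5 / 8)"
      using w2[OF l(1)] w2[OF l(2)] by (intro mult_mono) auto
    then show ?thesis by (simp add: norm_divide power2_eq_square mult_ac)
  qed
  ultimately have "norm (c 0) \<le> 25 / 64 * 2.35"
    using main mult_mono[of "norm (l1 / of_real r) * norm (l2 / of_real r) * norm (cnj l1 / of_real r) * norm (cnj l2 / of_real r)"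
        "25 / 64" "sqrt (\<Sum>k. (norm (c k))\<^sup>2)" "2.35"] suminf_nonneg[OF sumc] by (simp add: order_trans)
  moreover have "norm (c 0) = \<bar>1 - h 0\<bar>" unfolding c_def b_def by (simp only: norm_of_real a power_0 mult_1_right)
  ultimately show False using hb[of 0] by (auto simp: abs_le_iff)
qed

text \<open>Close to a nonreal point the imaginary parts keep their sign and stay away from 0, so
  one constant serves all series and both parameters at once.\<close>

lemma pseries_transversality:
  fixes l0 :: complex
  assumes "Im l0 \<noteq> 0" "norm l0 < \<rho>" "\<rho> \<le> 1 / sqrt 2"
  obtains C \<eta> where "0 < C" "0 < \<eta>" "ball l0 \<eta> \<subseteq> ball 0 \<rho>"
    "\<And>a l1 l2. a 0 = 1 \<Longrightarrow> (\<And>k. \<bar>a k\<bar> \<le> 1) \<Longrightarrow> l1 \<in> ball l0 \<eta> \<Longrightarrow> l2 \<in> ball l0 \<eta> \<Longrightarrow>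
       norm (l1 - l2) \<le> C * (norm (pseries a l1) + norm (pseries a l2))"
proof -
  define y where "y = min 1 (\<bar>Im l0\<bar> / 2)"
  have y: "0 < y" "y \<le> 1" using assms by (auto simp: y_def)
  define \<eta> where "\<eta> = min y (\<rho> - norm l0)"
  have e: "0 < \<eta>" using y assms by (auto simp: \<eta>_def)
  have sub: "ball l0 \<eta> \<subseteq> ball 0 \<rho>"
  proof
    fix z assume "z \<in> ball l0 \<eta>"
    then have "norm (z - l0) < \<rho> - norm l0" by (simp add: dist_norm norm_minus_commute \<eta>_def)
    then show "z \<in> ball 0 \<rho>" using norm_triangle_ineq2[of z l0] by simp
  qed
  have im: "y \<le> \<bar>Im z\<bar> \<and> 0 < Im z * Im l0" if "z \<in> ball l0 \<eta>" for z
  proof -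
    have "\<bar>Im z - Im l0\<bar> < y"
      using that abs_Im_le_cmod[of "z - l0"] by (simp add: dist_norm norm_minus_commute \<eta>_def)
    moreover have "2 * y \<le> \<bar>Im l0\<bar>" by (simp add: y_def)
    ultimately show ?thesis using assms by (auto simp: zero_less_mult_iff)
  qed
  show thesis
  proof (rule that[of "600 / y ^ 3" \<eta>])
    fix a :: "nat \<Rightarrow> real" and l1 l2
    assume a: "a 0 = 1" "\<And>k. \<bar>a k\<bar> \<le> 1" and l: "l1 \<in> ball l0 \<eta>" "l2 \<in> ball l0 \<eta>"
    show "norm (l1 - l2) \<le> 600 / y ^ 3 * (norm (pseries a l1) + norm (pseries a l2))"
    proof (rule pseries_separation[where a = a])
      show "0 < Im l1 * Im l2"
        using im[OF l(1)] im[OF l(2)] by (auto simp: zero_less_mult_iff)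
      show "norm l1 < 1 / sqrt 2" "norm l2 < 1 / sqrt 2"
        using subsetD[OF sub l(1)] subsetD[OF sub l(2)] assms(3) by auto
      show "y \<le> \<bar>Im l1\<bar>" "y \<le> \<bar>Im l2\<bar>" using im l by blast+
    qed (fact y a)+
  qed (use y e sub in auto)
qed


subsection \<open>Hausdorff measure\<close>

lemma suminf_ennreal_eps_half:
  assumes "0 \<le> e"
  shows "(\<Sum>n. f n + ennreal (e * (1/2) ^ Suc n)) = (\<Sum>n. f n) + ennreal e"
proof -
  have "(\<Sum>n. ennreal (e * (1/2) ^ Suc n)) = ennreal e"
    using assms by (subst suminf_ennreal_eq[where x=e])
      (auto intro: sums_mult[OF power_half_series, of e, simplified])
  then show ?thesis by (subst suminf_add[symmetric]) auto
qed

lemma hausdorff_pre_cover_le: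
  assumes "E \<subseteq> (\<Union>i. U i)" "\<And>i. bounded (U i)" "\<And>i. diameter (U i) \<le> \<delta>"
  shows "hausdorff_pre s \<delta> E \<le> (\<Sum>i. diam_pow (U i) s)"
  unfolding hausdorff_pre_def using assms by (intro INF_lower) auto

lemma hausdorff_pre_less:
  assumes "hausdorff_pre s \<delta> E < c"
  obtains U where "E \<subseteq> (\<Union>i. U i)" "\<And>i. bounded (U i)" "\<And>i. diameter (U i) \<le> \<delta>"
    "(\<Sum>i. diam_pow (U i) s) < c"
  using assms unfolding hausdorff_pre_def INF_less_iff by auto

lemma hausdorff_pre_mono: "E \<subseteq> F \<Longrightarrow> hausdorff_pre s \<delta> E \<le> hausdorff_pre s \<delta> F"
  unfolding hausdorff_pre_def by (rule INF_superset_mono) auto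

lemma hausdorff_pre_single:
  assumes "bounded U" "diameter U \<le> \<delta>" "0 \<le> \<delta>"
  shows "hausdorff_pre s \<delta> U \<le> diam_pow U s"
proof -
  have "hausdorff_pre s \<delta> U \<le> (\<Sum>i::nat. diam_pow (if i = 0 then U else {}) s)"
    using assms by (intro hausdorff_pre_cover_le) auto
  also have "\<dots> = (\<Sum>i\<in>{0::nat}. diam_pow (if i = 0 then U else {}) s)"
    by (rule suminf_finite) (auto simp: diam_pow_def)
  finally show ?thesis by simp
qed

lemma hausdorff_pre_empty: "0 \<le> \<delta> \<Longrightarrow> hausdorff_pre s \<delta> {} = 0"
  using hausdorff_pre_single[of "{}" \<delta> s] by (simp add: diam_pow_def)

lemma hausdorff_pre_UN:
  "hausdorff_pre s \<delta> (\<Union>i::nat. E i) \<le> (\<Sum>i. hausdorff_pre s \<delta> (E i))"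
proof (rule ennreal_le_epsilon)
  fix e :: real assume fin: "(\<Sum>i. hausdorff_pre s \<delta> (E i)) < top" and e: "0 < e"
  have "\<exists>U. E i \<subseteq> (\<Union>j. U j) \<and> (\<forall>j. bounded (U j) \<and> diameter (U j) \<le> \<delta>) \<and>
      (\<Sum>j. diam_pow (U j) s) \<le> hausdorff_pre s \<delta> (E i) + ennreal (e * (1/2) ^ Suc i)" for i
  proof -
    have "hausdorff_pre s \<delta> (E i) < top"
      using fin ennreal_suminf_lessD by blast
    then have "hausdorff_pre s \<delta> (E i) < hausdorff_pre s \<delta> (E i) + ennreal (e * (1/2) ^ Suc i)"
      using e by (cases "hausdorff_pre s \<delta> (E i)")
        (auto simp: ennreal_plus[symmetric] ennreal_less_iff simp del: ennreal_plus)
    then show ?thesis by (rule hausdorff_pre_less) (auto intro: less_imp_le)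
  qed
  then obtain U where U: "\<And>i. E i \<subseteq> (\<Union>j. U i j)" "\<And>i j. bounded (U i j)" "\<And>i j. diameter (U i j) \<le> \<delta>"
      "\<And>i. (\<Sum>j. diam_pow (U i j) s) \<le> hausdorff_pre s \<delta> (E i) + ennreal (e * (1/2) ^ Suc i)"
    by metis
  define V where "V n = (case prod_decode n of (i, j) \<Rightarrow> U i j)" for n
  have "hausdorff_pre s \<delta> (\<Union>i. E i) \<le> (\<Sum>n. diam_pow (V n) s)"
  proof (rule hausdorff_pre_cover_le)
    show "(\<Union>i. E i) \<subseteq> (\<Union>n. V n)"
    proof
      fix x assume "x \<in> (\<Union>i. E i)"
      then obtain i j where "x \<in> U i j" using U(1) by blast
      then have "x \<in> V (prod_encode (i, j))" by (simp add: V_def)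
      then show "x \<in> (\<Union>n. V n)" by blast
    qed
  qed (use U in \<open>auto simp: V_def split: prod.split\<close>)
  also have "\<dots> = (\<Sum>i. \<Sum>j. diam_pow (U i j) s)"
    using suminf_ennreal_2dimen[of "\<lambda>i. \<Sum>j. diam_pow (U i j) s" "\<lambda>(i, j). diam_pow (U i j) s"]
    by (simp add: V_def case_prod_unfold)
  also have "\<dots> \<le> (\<Sum>i. hausdorff_pre s \<delta> (E i) + ennreal (e * (1/2) ^ Suc i))"
    by (intro suminf_le U) auto
  also have "\<dots> = (\<Sum>i. hausdorff_pre s \<delta> (E i)) + ennreal e"
    using e by (intro suminf_ennreal_eps_half) auto
  finally show "hausdorff_pre s \<delta> (\<Union>i. E i) \<le> (\<Sum>i. hausdorff_pre s \<delta> (E i)) + ennreal e" .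
qed

lemma hausdorff_pre_Un:
  assumes "0 \<le> \<delta>"
  shows "hausdorff_pre s \<delta> (A \<union> B) \<le> hausdorff_pre s \<delta> A + hausdorff_pre s \<delta> B"
proof -
  define E where "E i = (if i = 0 then A else if i = 1 then B else {})" for i :: nat
  have "A \<union> B = (\<Union>i. E i)" by (auto simp: E_def split: if_splits)
  then have "hausdorff_pre s \<delta> (A \<union> B) \<le> (\<Sum>i. hausdorff_pre s \<delta> (E i))"
    using hausdorff_pre_UN by metis
  also have "\<dots> = (\<Sum>i\<in>{0, 1}. hausdorff_pre s \<delta> (E i))"
    by (rule suminf_finite) (auto simp: E_def hausdorff_pre_empty assms)
  also have "\<dots> = hausdorff_pre s \<delta> A + hausdorff_pre s \<delta> B" by (simp add: E_def)
  finally show ?thesis .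
qed

lemma hausdorff_pre_finite_UN:
  assumes "finite I" "0 \<le> \<delta>"
  shows "hausdorff_pre s \<delta> (\<Union>i\<in>I. E i) \<le> (\<Sum>i\<in>I. hausdorff_pre s \<delta> (E i))"
  using assms(1)
proof (induction I rule: finite_induct)
  case empty
  then show ?case using assms by (simp add: hausdorff_pre_empty)
next
  case (insert i I)
  have "hausdorff_pre s \<delta> (\<Union>j\<in>insert i I. E j) \<le> hausdorff_pre s \<delta> (E i) + hausdorff_pre s \<delta> (\<Union>j\<in>I. E j)"
    using hausdorff_pre_Un[OF assms(2), of s "E i" "\<Union>j\<in>I. E j"] by simp
  also have "\<dots> \<le> hausdorff_pre s \<delta> (E i) + (\<Sum>j\<in>I. hausdorff_pre s \<delta> (E j))"
    by (intro add_left_mono insert)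
  finally show ?case using insert by simp
qed

lemma diam_pow_le:
  assumes "diameter U \<le> d" "0 \<le> d" "0 < s" "bounded U"
  shows "diam_pow U s \<le> ennreal (d powr s)"
  using assms diameter_ge_0[of U] by (auto simp: diam_pow_def intro!: ennreal_leI powr_mono2)

lemma hausdorff_pre_affine:
  fixes E :: "complex set"
  assumes b: "b \<noteq> 0" and s: "0 < s" and \<delta>: "norm b * \<delta> \<le> \<delta>'"
  shows "hausdorff_pre s \<delta>' ((\<lambda>z. a + b * z) ` E) \<le> ennreal (norm b powr s) * hausdorff_pre s \<delta> E"
proof -
  let ?f = "\<lambda>z. a + b * z"
  have nb: "0 < norm b" using b by simp
  have *: "hausdorff_pre s \<delta>' (?f ` E) \<le> ennreal (norm b powr s) * (\<Sum>i. diam_pow (U i) s)"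
    if U: "E \<subseteq> (\<Union>i. U i)" "\<And>i. bounded (U i)" "\<And>i. diameter (U i) \<le> \<delta>" for U
  proof -
    have bd: "bounded (?f ` U i)" for i
    proof -
      have "bounded ((\<lambda>z. b * z) ` U i)"
        by (rule bounded_linear_image[OF U(2) bounded_linear_mult_right])
      then have "bounded ((\<lambda>x. a + x) ` (\<lambda>z. b * z) ` U i)" by (rule bounded_translation)
      then show ?thesis by (simp add: image_image)
    qed
    have dm: "diameter (?f ` U i) \<le> norm b * diameter (U i)" for i
    proof (rule diameter_le)
      show "?f ` U i \<noteq> {} \<or> 0 \<le> norm b * diameter (U i)" using diameter_ge_0[OF U(2)[of i]] by auto
      fix x y assume "x \<in> ?f ` U i" "y \<in> ?f ` U i"
      then obtain u v where uv: "u \<in> U i" "v \<in> U i" "x = a + b * u" "y = a + b * v" by auto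
      have "norm (x - y) = norm b * dist u v"
        by (simp add: uv dist_norm norm_mult[symmetric] algebra_simps)
      then show "norm (x - y) \<le> norm b * diameter (U i)"
        using diameter_bounded_bound[OF U(2)[of i] uv(1,2)] by (simp add: mult_left_mono)
    qed
    have "hausdorff_pre s \<delta>' (?f ` E) \<le> (\<Sum>i. diam_pow (?f ` U i) s)"
    proof (rule hausdorff_pre_cover_le)
      show "?f ` E \<subseteq> (\<Union>i. ?f ` U i)" using U(1) by blast
      show "diameter (?f ` U i) \<le> \<delta>'" for i
        using dm[of i] mult_left_mono[OF U(3)[of i], of "norm b"] \<delta> by simp
    qed (rule bd)
    also have "\<dots> \<le> (\<Sum>i. ennreal (norm b powr s) * diam_pow (U i) s)"
    proof (intro suminf_le)
      fix i
      have "diameter (?f ` U i) powr s \<le> (norm b * diameter (U i)) powr s"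
        using dm[of i] diameter_ge_0[OF bd[of i]] s by (intro powr_mono2) auto
      also have "\<dots> = norm b powr s * diameter (U i) powr s"
        using diameter_ge_0[OF U(2)[of i]] by (simp add: powr_mult)
      finally show "diam_pow (?f ` U i) s \<le> ennreal (norm b powr s) * diam_pow (U i) s"
        using s by (auto simp: diam_pow_def ennreal_mult[symmetric] intro!: ennreal_leI)
    qed auto
    finally show ?thesis by simp
  qed
  define c where "c = ennreal (norm b powr s)"
  \<comment> \<open>Bounding \<open>c'\<close> times the left side by every covering sum avoids
    multiplying an infimum by a constant.\<close>
  define c' where "c' = ennreal (norm b powr (- s))"
  have cc: "c' * c = 1"
    using nb by (simp add: c_def c'_def ennreal_mult[symmetric] powr_add[symmetric])
  have "c' * hausdorff_pre s \<delta>' (?f ` E) \<le> hausdorff_pre s \<delta> E"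
    unfolding hausdorff_pre_def[of s \<delta> E]
  proof (rule INF_greatest)
    fix U :: "nat \<Rightarrow> complex set" assume "U \<in> {U. E \<subseteq> (\<Union>i. U i) \<and> (\<forall>i. bounded (U i) \<and> diameter (U i) \<le> \<delta>)}"
    then have "hausdorff_pre s \<delta>' (?f ` E) \<le> c * (\<Sum>i. diam_pow (U i) s)"
      unfolding c_def by (intro *) auto
    then have "c' * hausdorff_pre s \<delta>' (?f ` E) \<le> (c' * c) * (\<Sum>i. diam_pow (U i) s)"
      by (simp add: mult.assoc mult_left_mono)
    then show "c' * hausdorff_pre s \<delta>' (?f ` E) \<le> (\<Sum>i. diam_pow (U i) s)"
      by (simp add: cc)
  qed
  then have "c * (c' * hausdorff_pre s \<delta>' (?f ` E)) \<le> c * hausdorff_pre s \<delta> E"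
    by (rule mult_left_mono) simp
  then have "(c' * c) * hausdorff_pre s \<delta>' (?f ` E) \<le> c * hausdorff_pre s \<delta> E"
    by (simp only: mult_ac)
  then show ?thesis by (simp only: cc c_def[symmetric] mult_1_left)
qed

lemma hausdorff_null_iff: "hausdorff_measure s E = 0 \<longleftrightarrow> (\<forall>\<delta>>0. hausdorff_pre s \<delta> E = 0)"
proof -
  have "hausdorff_measure s E \<le> 0 \<longleftrightarrow> (\<forall>\<delta>>0. hausdorff_pre s \<delta> E \<le> 0)"
    unfolding hausdorff_measure_def SUP_le_iff by auto
  then show ?thesis by simp
qed

lemma hausdorff_null_subset:
  "hausdorff_measure s F = 0 \<Longrightarrow> E \<subseteq> F \<Longrightarrow> hausdorff_measure s E = 0"
  unfolding hausdorff_null_iff using hausdorff_pre_mono[of E F s] by (metis le_zero_eq)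

lemma hausdorff_null_UN:
  "(\<And>i::nat. hausdorff_measure s (E i) = 0) \<Longrightarrow> hausdorff_measure s (\<Union>i. E i) = 0"
  unfolding hausdorff_null_iff
proof (intro allI impI)
  fix \<delta> :: real assume "\<And>i. \<forall>\<delta>>0. hausdorff_pre s \<delta> (E i) = 0" "0 < \<delta>"
  then show "hausdorff_pre s \<delta> (\<Union>i. E i) = 0" using hausdorff_pre_UN[of s \<delta> E] by simp
qed

lemma hausdorff_null_countable_Union:
  assumes "countable \<F>" "\<And>S. S \<in> \<F> \<Longrightarrow> hausdorff_measure s S = 0"
  shows "hausdorff_measure s (\<Union>\<F>) = 0"
proof (cases "\<F> = {}")
  case True
  then show ?thesis by (simp add: hausdorff_null_iff hausdorff_pre_empty)
next
  case False
  have "hausdorff_measure s (\<Union>i. from_nat_into \<F> i) = 0"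
    using assms(2) False by (intro hausdorff_null_UN) (auto intro: from_nat_into)
  then show ?thesis using range_from_nat_into[OF False assms(1)] by simp
qed

lemma hausdorff_null_Un:
  assumes "hausdorff_measure s A = 0" "hausdorff_measure s B = 0"
  shows "hausdorff_measure s (A \<union> B) = 0"
  using hausdorff_null_countable_Union[of "{A, B}" s] assms by auto

text \<open>Transversality constants exist only near each parameter. Lindelof's theorem reduces the
  resulting local statements to countably many.\<close>

lemma hausdorff_null_locally:
  fixes E :: "'a :: {metric_space, second_countable_topology} set"
  assumes "\<And>x. x \<in> E \<Longrightarrow> \<exists>U. open U \<and> x \<in> U \<and> hausdorff_measure s (E \<inter> U) = 0"
  shows "hausdorff_measure s E = 0"
proof -
  define \<G> where "\<G> = {U. open U \<and> hausdorff_measure s (E \<inter> U) = 0}"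
  have "\<And>U. U \<in> \<G> \<Longrightarrow> open U" by (simp add: \<G>_def)
  then obtain \<U> where \<U>: "\<U> \<subseteq> \<G>" "countable \<U>" "\<Union>\<U> = \<Union>\<G>"
    by (rule Lindelof)
  have "hausdorff_measure s (\<Union>((\<lambda>U. E \<inter> U) ` \<U>)) = 0"
    using \<U> by (intro hausdorff_null_countable_Union) (auto simp: \<G>_def)
  moreover have "E \<subseteq> \<Union>((\<lambda>U. E \<inter> U) ` \<U>)"
  proof
    fix x assume x: "x \<in> E"
    then have "x \<in> \<Union>\<G>" using assms unfolding \<G>_def by blast
    then show "x \<in> \<Union>((\<lambda>U. E \<inter> U) ` \<U>)" using x \<U>(3) by blast
  qed
  ultimately show ?thesis using hausdorff_null_subset by blast
qed

lemma hausdorff_dim_le: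
  assumes "0 \<le> t" "\<And>s. t < s \<Longrightarrow> hausdorff_measure s E = 0"
  shows "hausdorff_dim E \<le> t"
proof (rule dense_ge)
  fix s assume "t < s"
  then show "hausdorff_dim E \<le> s"
    unfolding hausdorff_dim_def using assms by (intro cInf_lower bdd_belowI[of _ 0]) auto
qed

text \<open>A bounded nonempty set lies in a closed disc whose radius is its diameter, so its outer
  area is at most \<open>pi\<close> times its contribution to the 2-dimensional covering
  sum.\<close>

lemma hausdorff_null_imp_negligible:
  fixes E :: "complex set"
  assumes "hausdorff_measure 2 E = 0"
  shows "negligible E"
  unfolding negligible_outer_le
proof (intro allI impI)
  fix e :: real assume e: "0 < e"
  have "hausdorff_pre 2 1 E < ennreal (e / pi)"
    using assms e by (simp add: hausdorff_null_iff)
  then obtain U where U: "E \<subseteq> (\<Union>i. U i)" "\<And>i. bounded (U i)"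
      "(\<Sum>i. diam_pow (U i) 2) < ennreal (e / pi)"
    by (rule hausdorff_pre_less) blast
  define V where "V i = (if U i = {} then {} else cball (SOME x. x \<in> U i) (diameter (U i)))" for i
  have UV: "U i \<subseteq> V i" for i
  proof
    fix x assume x: "x \<in> U i"
    then have "(SOME x. x \<in> U i) \<in> U i" by (rule someI)
    then show "x \<in> V i" using x diameter_bounded_bound[OF U(2)] by (auto simp: V_def)
  qed
  have Vs: "V i \<in> sets lborel" for i by (auto simp: V_def)
  have "emeasure lborel (V i) \<le> ennreal pi * diam_pow (U i) 2" for i
    using diameter_ge_0[OF U(2)[of i]]
    by (auto simp: V_def diam_pow_def emeasure_cball unit_ball_vol_2 ennreal_mult[symmetric] powr_numeral)
  then have "(\<Sum>i. emeasure lborel (V i)) \<le> (\<Sum>i. ennreal pi * diam_pow (U i) 2)"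
    by (intro suminf_le) auto
  also have "\<dots> \<le> ennreal pi * ennreal (e / pi)"
    using U(3) by (simp add: mult_left_mono)
  also have "\<dots> = ennreal e" using e by (simp add: ennreal_mult[symmetric])
  finally have "(\<Sum>i. emeasure lborel (V i)) \<le> ennreal e" .
  then have T: "emeasure lborel (\<Union>i. V i) \<le> ennreal e"
    using emeasure_subadditive_countably[of V lborel] Vs by (auto intro: order_trans)
  have lm: "(\<Union>i. V i) \<in> lmeasurable"
    using T Vs by (intro fmeasurableI) (auto simp: le_less_trans[OF T])
  moreover have "measure lebesgue (\<Union>i. V i) \<le> e"
    using T Vs e by (simp add: measure_def enn2real_leI)
  moreover have "E \<subseteq> (\<Union>i. V i)" using U(1) UV by blast
  ultimately show "\<exists>T. E \<subseteq> T \<and> T \<in> lmeasurable \<and> measure lebesgue T \<le> e" by blast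
qed

text \<open>Covering by \<open>n\<close> segments of length \<open>2 / n\<close> costs
  \<open>n * (2 / n) powr s\<close>, which tends to 0. This takes care of the real parameters, which
  transversality does not reach.\<close>

lemma hausdorff_null_reals:
  assumes "1 < s"
  shows "hausdorff_measure s {l :: complex. Im l = 0 \<and> norm l < 1} = 0"
  unfolding hausdorff_null_iff
proof (intro allI impI)
  let ?E = "{l :: complex. Im l = 0 \<and> norm l < 1}"
  fix \<delta> :: real assume \<delta>: "0 < \<delta>"
  have bound: "hausdorff_pre s \<delta> ?E \<le> ennreal (2 powr s * real n powr (1 - s))" if n: "0 < n" "2 / real n \<le> \<delta>" for n
  proof -
    define J :: "nat \<Rightarrow> complex set" where "J k = of_real ` {-1 + 2 * real k / n .. -1 + 2 * real (Suc k) / n}" for k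
    have J: "bounded (J k)" "diameter (J k) \<le> 2 / n" for k
    proof -
      have "compact (J k)" unfolding J_def by (intro compact_continuous_image continuous_intros) auto
      then show "bounded (J k)" by (rule compact_imp_bounded)
      show "diameter (J k) \<le> 2 / n"
      proof (rule diameter_le)
        fix x y assume "x \<in> (J k)" "y \<in> J k"
        then obtain u v where uv: "x = of_real u" "y = of_real v" "\<bar>u - v\<bar> \<le> 2 / n"
          unfolding J_def using n by (auto simp: abs_le_iff add_divide_distrib distrib_left)
        then show "norm (x - y) \<le> 2 / n" by (simp flip: of_real_diff)
      qed auto
    qed
    have "?E \<subseteq> (\<Union>k\<in>{..<n}. J k)"
    proof
      fix l assume l: "l \<in> ?E"
      define u where "u = (Re l + 1) * n / 2"
      have R: "\<bar>Re l\<bar> < 1" using l abs_Re_le_cmod[of l] by auto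
      then have u: "0 \<le> u" "u < n" using n unfolding u_def by (auto simp: mult_less_cancel_right abs_less_iff intro!: mult_nonneg_nonneg divide_nonneg_nonneg)
      define k where "k = nat \<lfloor>u\<rfloor>"
      have k: "real k \<le> u" "u \<le> real (Suc k)" using u unfolding k_def by linarith+
      have "k < n" using k(1) u(2) by linarith
      moreover have "l = of_real (Re l)" using l by (simp add: complex_eq_iff)
      moreover have "Re l \<in> {-1 + 2 * real k / n .. -1 + 2 * real (Suc k) / n}"
        using k n unfolding u_def by (auto simp: field_simps)
      ultimately show "l \<in> (\<Union>k\<in>{..<n}. J k)" unfolding J_def by blast
    qed
    then have "hausdorff_pre s \<delta> ?E \<le> hausdorff_pre s \<delta> (\<Union>k\<in>{..<n}. J k)" by (rule hausdorff_pre_mono)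
    also have "\<dots> \<le> (\<Sum>k<n. hausdorff_pre s \<delta> (J k))"
      using \<delta> by (intro hausdorff_pre_finite_UN) auto
    also have "\<dots> \<le> (\<Sum>k<n. ennreal ((2 / n) powr s))"
    proof (rule sum_mono)
      fix k
      have "hausdorff_pre s \<delta> (J k) \<le> diam_pow (J k) s"
        using J[of k] n \<delta> by (intro hausdorff_pre_single) auto
      also have "\<dots> \<le> ennreal ((2 / n) powr s)" using J[of k] assms by (intro diam_pow_le) auto
      finally show "hausdorff_pre s \<delta> (J k) \<le> ennreal ((2 / n) powr s)" .
    qed
    also have "\<dots> = ennreal (n * (2 / n) powr s)"
      by (simp add: ennreal_mult ennreal_of_nat_eq_real_of_nat)
    also have "real n * (2 / n) powr s = 2 powr s * real n powr (1 - s)"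
      using n by (simp add: powr_divide powr_diff)
    finally show ?thesis .
  qed
  have lim: "((\<lambda>n. ennreal (2 powr s * real n powr (1 - s))) \<longlongrightarrow> ennreal (2 powr s * 0)) sequentially"
    using assms by (intro tendsto_ennrealI tendsto_mult_left tendsto_neg_powr filterlim_real_sequentially) auto
  have "eventually (\<lambda>n. hausdorff_pre s \<delta> ?E \<le> ennreal (2 powr s * real n powr (1 - s))) sequentially"
    using eventually_gt_at_top[of "nat \<lceil>2 / \<delta>\<rceil>"]
  proof eventually_elim
    case (elim n)
    then have "2 / \<delta> < real n" using \<delta> by linarith
    then show ?case using \<delta> elim by (intro bound) (auto simp: field_simps)
  qed
  then have "hausdorff_pre s \<delta> ?E \<le> ennreal (2 powr s * 0)"
    by (intro tendsto_lowerbound[OF lim]) auto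
  then show "hausdorff_pre s \<delta> ?E = 0" by simp
qed


subsection \<open>Packing measure\<close>

text \<open>The balls of a packing are disjoint subsets of \<open>V\<close>, and each term of the
  packing sum is dominated by \<open>C\<close> times the mass of its ball.\<close>

lemma packing_pre_le_measure:
  fixes M :: "'a :: metric_space measure"
  assumes M: "sets M = sets borel" and V: "V \<in> sets borel" and \<delta>: "0 < \<delta>"
    and x: "\<And>x r. x \<in> E \<Longrightarrow> 0 < r \<Longrightarrow> r \<le> \<delta> \<Longrightarrow>
      cball x r \<subseteq> V \<and> ennreal ((2 * r) powr s) \<le> C * emeasure M (cball x r)"
  shows "packing_pre s E \<le> C * emeasure M V"
  unfolding packing_pre_def
\<comment> \<open>The definition of the premeasure limits diameters, the hypothesis limits
  radii.\<close>
proof (rule INF_lower2[of "2 * \<delta>"])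
  show "2 * \<delta> \<in> {0<..}" using \<delta> by simp
  show "(SUP p \<in> {(I :: nat set, c :: nat \<Rightarrow> 'a, r :: nat \<Rightarrow> real).
                   (\<forall>i\<in>I. c i \<in> E \<and> 0 < r i \<and> 2 * r i \<le> 2 * \<delta>) \<and>
                   (\<forall>i\<in>I. \<forall>j\<in>I. i \<noteq> j \<longrightarrow> cball (c i) (r i) \<inter> cball (c j) (r j) = {})}.
          (case p of (I, c, r) \<Rightarrow> (\<Sum>i. if i \<in> I then ennreal ((2 * r i) powr s) else 0)))
      \<le> C * emeasure M V"
  proof (rule SUP_least, clarify)
    fix I :: "nat set" and c :: "nat \<Rightarrow> 'a" and r :: "nat \<Rightarrow> real"
    assume I: "\<forall>i\<in>I. c i \<in> E \<and> 0 < r i \<and> 2 * r i \<le> 2 * \<delta>"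
      and disj: "\<forall>i\<in>I. \<forall>j\<in>I. i \<noteq> j \<longrightarrow> cball (c i) (r i) \<inter> cball (c j) (r j) = {}"
    define A where "A i = (if i \<in> I then cball (c i) (r i) else {})" for i
    have A: "range A \<subseteq> sets M" unfolding M by (auto simp: A_def)
    have "(\<Sum>i. if i \<in> I then ennreal ((2 * r i) powr s) else 0) \<le> (\<Sum>i. C * emeasure M (A i))"
    proof (rule suminf_le)
      fix i
      show "(if i \<in> I then ennreal ((2 * r i) powr s) else 0) \<le> C * emeasure M (A i)"
        using I x[of "c i" "r i"] by (simp add: A_def)
    qed auto
    also have "\<dots> = C * emeasure M (\<Union>i. A i)"
    proof -
      have "disjoint_family A" using disj by (auto simp: disjoint_family_on_def A_def)
      then show ?thesis by (simp only: ennreal_suminf_cmult suminf_emeasure[OF A])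
    qed
    also have "\<dots> \<le> C * emeasure M V"
    proof (intro mult_left_mono emeasure_mono)
      have "A i \<subseteq> V" for i using I x[of "c i" "r i"] by (simp add: A_def)
      then show "(\<Union>i. A i) \<subseteq> V" by blast
    qed (use V M in auto)
    finally show "(\<Sum>i. if i \<in> I then ennreal ((2 * r i) powr s) else 0) \<le> C * emeasure M V" .
  qed
qed

lemma packing_pre_mono: "E \<subseteq> F \<Longrightarrow> packing_pre s E \<le> packing_pre s F"
  unfolding packing_pre_def by (intro INF_mono' SUP_subset_mono) auto

lemma packing_measure_cover_le: "E \<subseteq> (\<Union>i. Es i) \<Longrightarrow> packing_measure s E \<le> (\<Sum>i. packing_pre s (Es i))"
  unfolding packing_measure_def by (rule INF_lower) auto

lemma packing_measure_mono: "E \<subseteq> F \<Longrightarrow> packing_measure s E \<le> packing_measure s F"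
  unfolding packing_measure_def by (rule INF_superset_mono) auto

lemma packing_pre_empty: "packing_pre s ({} :: 'a :: metric_space set) = 0"
  using packing_pre_le_measure[of borel "{}" 1 "{} :: 'a set" s 1] by auto

lemma packing_measure_le_pre:
  fixes E :: "'a :: metric_space set"
  shows "packing_measure s E \<le> packing_pre s E"
proof -
  have "packing_measure s E \<le> (\<Sum>i::nat. packing_pre s (if i = 0 then E else {}))"
    by (rule packing_measure_cover_le) auto
  also have "\<dots> = (\<Sum>i\<in>{0::nat}. packing_pre s (if i = 0 then E else {}))"
    by (rule suminf_finite) (auto simp: packing_pre_empty)
  finally show ?thesis by simp
qed

text \<open>An open set \<open>U\<close> of small measure containing \<open>B\<close> is cut into the slabs on which
  \<open>1 / dist(x, - U)\<close> lies in \<open>[k, k + 1)\<close>; small balls centred in one slab stay within its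
  two neighbours, so that the bounds for the slabs can be added up.\<close>
lemma packing_measure_null:
  fixes M :: "'a :: {second_countable_topology, complete_space} measure"
  assumes M: "sets M = sets borel" "finite_measure M" and B: "B \<in> sets borel" "emeasure M B = 0"
    and C: "0 \<le> C" and x: "\<And>x r. x \<in> A \<Longrightarrow> 0 < r \<Longrightarrow> r \<le> 1 \<Longrightarrow>
      ennreal ((2 * r) powr s) \<le> ennreal C * emeasure M (cball x r)"
  shows "packing_measure s (A \<inter> B) = 0"
proof -
  interpret finite_measure M by fact
  have main: "packing_measure s (A \<inter> B) \<le> ennreal (3 * C * e)" if e: "0 < e" for e :: real
  proof -
    have "(INF U \<in> {U. B \<subseteq> U \<and> open U}. emeasure M U) < ennreal e"
      using outer_regular[OF M(1) _ B(1)] B e by simp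
    then obtain U where U: "B \<subseteq> U" "open U" "emeasure M U < ennreal e"
      unfolding INF_less_iff by auto
    \<comment> \<open>\<open>infdist\<close> to the empty set is 0, so the case
      \<open>U = UNIV\<close> is given the positive value 1 instead.\<close>
    define g where "g x = (if - U = {} then 1 else infdist x (- U))" for x
    have glip: "\<bar>g x - g y\<bar> \<le> dist x y" for x y
      using infdist_triangle_abs[of x "- U" y] by (auto simp: g_def)
    have gU: "0 < g x \<longleftrightarrow> x \<in> U" for x
    proof (cases "- U = {}")
      case True
      then show ?thesis by (auto simp: g_def)
    next
      case False
      then have "x \<in> - U \<longleftrightarrow> infdist x (- U) = 0"
        using U(2) by (intro in_closed_iff_infdist_zero) auto
      then show ?thesis using False infdist_nonneg[of x "- U"] by (auto simp: g_def)
    qed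
    have gcont: "continuous_on UNIV g"
      unfolding g_def by (cases "- U = {}") (auto intro!: continuous_intros)
    then have gm: "g \<in> borel_measurable borel" by (rule borel_measurable_continuous_onI)
    define S where "S k = {x \<in> A \<inter> B. real k \<le> 1 / g x \<and> 1 / g x < real k + 1}" for k :: nat
    define V where "V k = {y. 0 < g y \<and> real k - 1 < 1 / g y \<and> 1 / g y < real k + 2}" for k :: nat
    have V: "V k \<in> sets borel" for k
      unfolding V_def using gm by measurable
    have slab: "packing_pre s (S k) \<le> ennreal C * emeasure M (V k)" for k
    proof (rule packing_pre_le_measure[OF M(1) V])
      define K where "K = real k + 1"
      have K: "1 \<le> K" by (simp add: K_def)
      define J where "J = 1 / K"
      have J: "0 < J" using K by (simp add: J_def)
      \<comment> \<open>On the slab \<open>g\<close> exceeds \<open>J = 1 / K\<close>. A shift by at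
        most \<delta> then changes \<open>1 / g\<close> by at most
        \<open>\<delta> / (J * (J * (3 / 4))) = 1 / 3\<close>, too little to get past a neighbouring
        slab.\<close>
      define \<delta> where "\<delta> = 1 / (4 * K\<^sup>2)"
      have \<delta>: "0 < \<delta>" "\<delta> \<le> J / 4" "\<delta> \<le> 1"
        using K mult_mono[of 1 K 1 K] by (auto simp: \<delta>_def J_def field_simps power2_eq_square)
      show "0 < \<delta>" by fact
      fix x r assume xS: "x \<in> S k" and r: "0 < r" "r \<le> \<delta>"
      have gx: "0 < g x" using xS U(1) gU by (auto simp: S_def)
      have gK: "J < g x" using xS gx K by (auto simp: S_def K_def J_def field_simps)
      have "y \<in> V k" if y: "dist x y \<le> r" for y
      proof -
        have d: "\<bar>g x - g y\<bar> \<le> \<delta>" using glip[of x y] y r by linarith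
        have gy: "J * (3 / 4) < g y" using d \<delta>(2) gK by linarith
        then have gy0: "0 < g y" using J by linarith
        have "\<bar>1 / g y - 1 / g x\<bar> = \<bar>g x - g y\<bar> / (g x * g y)"
          using gx gy0 by (simp add: field_simps abs_divide abs_mult)
        also have "\<dots> \<le> \<delta> / (J * (J * (3 / 4)))"
          using d gK gy J gx gy0 \<delta> by (intro frac_le mult_mono mult_pos_pos) auto
        also have "\<dots> = 1 / 3" using K by (simp add: \<delta>_def J_def field_simps power2_eq_square)
        finally have "\<bar>1 / g y - 1 / g x\<bar> \<le> 1 / 3" .
        moreover have "real k \<le> 1 / g x" "1 / g x < real k + 1" using xS by (auto simp: S_def)
        ultimately have "real k - 1 < 1 / g y" "1 / g y < real k + 2" by linarith+
        then show ?thesis using gy0 by (simp add: V_def)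
      qed
      then have "cball x r \<subseteq> V k" by auto
      moreover have "ennreal ((2 * r) powr s) \<le> ennreal C * emeasure M (cball x r)"
        using xS r \<delta> by (intro x) (auto simp: S_def)
      ultimately show "cball x r \<subseteq> V k \<and> ennreal ((2 * r) powr s) \<le> ennreal C * emeasure M (cball x r)" ..
    qed
    have "A \<inter> B \<subseteq> (\<Union>k. S k)"
    proof
      fix x assume x: "x \<in> A \<inter> B"
      then have "0 < g x" using U(1) gU by auto
      then have "x \<in> S (nat \<lfloor>1 / g x\<rfloor>)" using x by (auto simp: S_def)
      then show "x \<in> (\<Union>k. S k)" by blast
    qed
    then have "packing_measure s (A \<inter> B) \<le> (\<Sum>k. packing_pre s (S k))"
      by (rule packing_measure_cover_le)
    also have "\<dots> \<le> (\<Sum>k. ennreal C * emeasure M (V k))"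
      by (intro suminf_le slab) auto
    also have "\<dots> = ennreal C * (\<Sum>k. emeasure M (V k))" by simp
    also have "(\<Sum>k. emeasure M (V k)) = (\<integral>\<^sup>+y. (\<Sum>k. indicator (V k) y) \<partial>M)"
      using V M(1) by (subst nn_integral_suminf) (auto intro!: borel_measurable_indicator)
    also have "\<dots> \<le> (\<integral>\<^sup>+y. 3 * indicator U y \<partial>M)"
    proof (rule nn_integral_mono)
      fix y
      show "(\<Sum>k. indicator (V k) y) \<le> (3 * indicator U y :: ennreal)"
      proof (cases "y \<in> U")
        case False
        then have "y \<notin> V k" for k using gU by (auto simp: V_def)
        then show ?thesis by simp
      next
        case True
        then have "0 < g y" using gU by auto
        define n where "n = nat \<lfloor>1 / g y\<rfloor>"
        have n: "real n \<le> 1 / g y" "1 / g y < real n + 1"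
          using \<open>0 < g y\<close> by (auto simp: n_def)
        \<comment> \<open>At most three of the enlarged slabs contain a given point, hence the
          factor 3.\<close>
        have out: "k \<in> {n - 1..n + 1}" if "y \<in> V k" for k
          using that n by (auto simp: V_def)
        have "(\<Sum>k. indicator (V k) y) = (\<Sum>k\<in>{n - 1..n + 1}. indicator (V k) y :: ennreal)"
          by (rule suminf_finite) (use out in \<open>auto simp: indicator_def\<close>)
        also have "\<dots> \<le> (\<Sum>k\<in>{n - 1..n + 1}. 1)" by (rule sum_mono) (auto simp: indicator_def)
        also have "\<dots> \<le> 3" by simp
        finally show ?thesis using True by simp
      qed
    qed
    also have "\<dots> = 3 * emeasure M U"
    proof -
      have "U \<in> sets M" using U(2) M(1) by simp
      then show ?thesis by (rule nn_integral_cmult_indicator)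
    qed
    also have "\<dots> \<le> 3 * ennreal e" using U(3) by (intro mult_left_mono) auto
    finally have "packing_measure s (A \<inter> B) \<le> ennreal C * (3 * ennreal e)"
      by (simp add: mult_left_mono)
    also have "\<dots> = ennreal (3 * C * e)"
    proof -
      have "3 * ennreal e = ennreal (3 * e)" using e by (simp add: ennreal_mult)
      then show ?thesis using C e by (simp add: ennreal_mult[symmetric] mult_ac)
    qed
    finally show ?thesis .
  qed
  have "packing_measure s (A \<inter> B) \<le> 0 + ennreal d" if "0 < d" for d :: real
  proof -
    have "3 * C * (d / (3 * C + 1)) \<le> d" using that C by (simp add: field_simps)
    then show ?thesis using main[of "d / (3 * C + 1)"] that C
      by (auto intro: order_trans ennreal_leI)
  qed
  then have "packing_measure s (A \<inter> B) \<le> 0" by (rule ennreal_le_epsilon)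
  then show ?thesis by simp
qed

text \<open>Choose for every point of \<open>F\<close> a good radius below the packing scale.
  Vitali's lemma extracts disjoint balls, which form an admissible packing, while their fivefold
  enlargements cover \<open>F\<close>. The growth condition on \<open>cball x (5 * r)\<close> turns
  the packing sum into a bound for the mass of the cover.\<close>

lemma packing_pre_cover:
  fixes M :: "'a :: euclidean_space measure"
  assumes M: "sets M = sets borel" and K: "0 \<le> K"
    and F: "\<And>x \<delta>. x \<in> F \<Longrightarrow> 0 < \<delta> \<Longrightarrow>
      \<exists>r. 0 < r \<and> r \<le> \<delta> \<and> emeasure M (cball x (5 * r)) \<le> ennreal (K * (2 * r) powr s)"
    and less: "packing_pre s F < a"
  shows "\<exists>V \<in> sets borel. F \<subseteq> V \<and> emeasure M V \<le> ennreal K * a"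
proof -
  obtain \<delta> where \<delta>: "0 < \<delta>" and sup: "(SUP p \<in> {(I :: nat set, c :: nat \<Rightarrow> 'a, r :: nat \<Rightarrow> real).
                   (\<forall>i\<in>I. c i \<in> F \<and> 0 < r i \<and> 2 * r i \<le> \<delta>) \<and>
                   (\<forall>i\<in>I. \<forall>j\<in>I. i \<noteq> j \<longrightarrow> cball (c i) (r i) \<inter> cball (c j) (r j) = {})}.
          (case p of (I, c, r) \<Rightarrow> (\<Sum>i. if i \<in> I then ennreal ((2 * r i) powr s) else 0))) < a"
    using less unfolding packing_pre_def INF_less_iff by auto
  have "\<exists>r. \<forall>x\<in>F. 0 < r x \<and> r x \<le> \<delta> / 2 \<and> emeasure M (cball x (5 * r x)) \<le> ennreal (K * (2 * r x) powr s)"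
    using F[of _ "\<delta> / 2"] \<delta> by (intro bchoice) simp
  then obtain r where r: "\<And>x. x \<in> F \<Longrightarrow> 0 < r x \<and> r x \<le> \<delta> / 2"
      "\<And>x. x \<in> F \<Longrightarrow> emeasure M (cball x (5 * r x)) \<le> ennreal (K * (2 * r x) powr s)"
    by blast
  have "F \<subseteq> (\<Union>x\<in>F. cball x (r x))"
  proof
    fix x assume "x \<in> F"
    then show "x \<in> (\<Union>x\<in>F. cball x (r x))" using r(1)[of x] by (intro UN_I[of x]) auto
  qed
  then obtain C where C: "countable C" "C \<subseteq> F"
      "pairwise (\<lambda>i j. disjnt (cball i (r i)) (cball j (r j))) C" "F \<subseteq> (\<Union>i\<in>C. cball i (5 * r i))"
    by (rule Vitali_covering_lemma_cballs[where a="\<lambda>x. x" and r=r and B="\<delta> / 2"]) (use r(1) in auto)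
  define I where "I = to_nat_on C ` C"
  define c where "c = from_nat_into C"
  have cC: "c i \<in> C" if "i \<in> I" for i using that C(1) by (auto simp: I_def c_def)
  have inj: "c i \<noteq> c j" if "i \<in> I" "j \<in> I" "i \<noteq> j" for i j using that C(1) by (auto simp: I_def c_def)
  have cI: "c ` I = C" using C(1) by (auto simp: I_def c_def image_image)
  have "(\<Sum>i. if i \<in> I then ennreal ((2 * r (c i)) powr s) else 0) \<le> a"
  proof (rule less_imp_le, rule le_less_trans[OF _ sup])
    let ?p = "(I, c, \<lambda>i. r (c i))"
    have "(case ?p of (I, c, r) \<Rightarrow> (\<Sum>i. if i \<in> I then ennreal ((2 * r i) powr s) else 0)) \<le>
       (SUP p \<in> {(I :: nat set, c :: nat \<Rightarrow> 'a, r :: nat \<Rightarrow> real).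
                   (\<forall>i\<in>I. c i \<in> F \<and> 0 < r i \<and> 2 * r i \<le> \<delta>) \<and>
                   (\<forall>i\<in>I. \<forall>j\<in>I. i \<noteq> j \<longrightarrow> cball (c i) (r i) \<inter> cball (c j) (r j) = {})}.
          (case p of (I, c, r) \<Rightarrow> (\<Sum>i. if i \<in> I then ennreal ((2 * r i) powr s) else 0)))"
    proof (rule SUP_upper, clarsimp, intro conjI ballI impI)
      fix i assume "i \<in> I"
      then have "c i \<in> F" using cC C(2) by blast
      then show "c i \<in> F" "0 < r (c i)" "2 * r (c i) \<le> \<delta>" using r(1)[of "c i"] by auto
    next
      fix i j assume "i \<in> I" "j \<in> I" "i \<noteq> j"
      then show "cball (c i) (r (c i)) \<inter> cball (c j) (r (c j)) = {}"
        using C(3) cC inj unfolding pairwise_def disjnt_def by blast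
    qed
    then show "(\<Sum>i. if i \<in> I then ennreal ((2 * r (c i)) powr s) else 0) \<le> \<dots>" by simp
  qed
  then have le: "ennreal K * (\<Sum>i. if i \<in> I then ennreal ((2 * r (c i)) powr s) else 0) \<le> ennreal K * a"
    by (rule mult_left_mono) simp
  define A where "A i = (if i \<in> I then cball (c i) (5 * r (c i)) else {})" for i
  have A: "range A \<subseteq> sets borel" by (auto simp: A_def)
  have "emeasure M (\<Union>i. A i) \<le> (\<Sum>i. emeasure M (A i))"
    using A M by (intro emeasure_subadditive_countably) auto
  also have "\<dots> \<le> (\<Sum>i. ennreal K * (if i \<in> I then ennreal ((2 * r (c i)) powr s) else 0))"
  proof (intro suminf_le)
    fix i
    show "emeasure M (A i) \<le> ennreal K * (if i \<in> I then ennreal ((2 * r (c i)) powr s) else 0)"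
      using cC[of i] C(2) r(2)[of "c i"] K by (auto simp: A_def ennreal_mult[symmetric])
  qed auto
  finally have "emeasure M (\<Union>i. A i) \<le> ennreal K * a" using le by simp
  moreover have "F \<subseteq> (\<Union>i. A i)"
  proof
    fix x assume "x \<in> F"
    then obtain i where "i \<in> I" "x \<in> cball (c i) (5 * r (c i))" using C(4) cI by blast
    then have "x \<in> A i" by (simp add: A_def)
    then show "x \<in> (\<Union>i. A i)" by blast
  qed
  moreover have "(\<Union>i. A i) \<in> sets borel" using A by (intro sets.countable_UN) auto
  ultimately show ?thesis by blast
qed

text \<open>Vanishing packing measure gives pieces \<open>Es i\<close> with small total premeasure.
  Each is intersected with \<open>F\<close>, since the growth condition is known only there. The
  conclusion is a Borel cover rather than a bound on \<open>F\<close> itself, because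
  \<open>F\<close> is arbitrary and will be the image of a set of sequences.\<close>

lemma packing_measure_null_cover:
  fixes M :: "'a :: euclidean_space measure"
  assumes M: "sets M = sets borel" and K: "0 < K"
    and F: "\<And>x \<delta>. x \<in> F \<Longrightarrow> 0 < \<delta> \<Longrightarrow>
      \<exists>r. 0 < r \<and> r \<le> \<delta> \<and> emeasure M (cball x (5 * r)) \<le> ennreal (K * (2 * r) powr s)"
    and null: "packing_measure s F = 0" and e: "0 < e"
  shows "\<exists>V \<in> sets borel. F \<subseteq> V \<and> emeasure M V \<le> ennreal e"
proof -
  define d where "d = e / (2 * K)"
  have d: "0 < d" using K e by (simp add: d_def)
  have "packing_measure s F < ennreal d" using null d by simp
  then obtain Es where Es: "F \<subseteq> (\<Union>i. Es i)" "(\<Sum>i. packing_pre s (Es i)) < ennreal d"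
    unfolding packing_measure_def INF_less_iff by auto
  have "\<exists>V \<in> sets borel. F \<inter> Es i \<subseteq> V \<and> emeasure M V \<le> ennreal K * (packing_pre s (Es i) + ennreal (d * (1/2) ^ Suc i))" for i
  proof (rule packing_pre_cover[OF M])
    show "0 \<le> K" using K by simp
    have "packing_pre s (Es i) < top"
      using Es(2) by (meson ennreal_suminf_lessD less_trans ennreal_less_top)
    then have "packing_pre s (Es i) < packing_pre s (Es i) + ennreal (d * (1/2) ^ Suc i)"
      using d by (cases "packing_pre s (Es i)")
        (auto simp: ennreal_plus[symmetric] ennreal_less_iff simp del: ennreal_plus)
    then show "packing_pre s (F \<inter> Es i) < packing_pre s (Es i) + ennreal (d * (1/2) ^ Suc i)"
      using packing_pre_mono[of "F \<inter> Es i" "Es i" s] by (auto intro: le_less_trans)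
  qed (use F in auto)
  then obtain V where V: "\<And>i. V i \<in> sets borel" "\<And>i. F \<inter> Es i \<subseteq> V i"
      "\<And>i. emeasure M (V i) \<le> ennreal K * (packing_pre s (Es i) + ennreal (d * (1/2) ^ Suc i))"
    by metis
  have "emeasure M (\<Union>i. V i) \<le> (\<Sum>i. emeasure M (V i))"
    using V M by (intro emeasure_subadditive_countably) auto
  also have "\<dots> \<le> (\<Sum>i. ennreal K * (packing_pre s (Es i) + ennreal (d * (1/2) ^ Suc i)))"
    by (intro suminf_le V) auto
  also have "\<dots> = ennreal K * ((\<Sum>i. packing_pre s (Es i)) + ennreal d)"
    using d by (simp only: ennreal_suminf_cmult suminf_ennreal_eps_half)
  also have "\<dots> \<le> ennreal K * (ennreal d + ennreal d)"
    using Es(2) by (intro mult_left_mono add_mono) auto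
  also have "\<dots> = ennreal e"
    using K e d by (simp add: ennreal_plus[symmetric] ennreal_mult[symmetric] d_def del: ennreal_plus)
  finally have "emeasure M (\<Union>i. V i) \<le> ennreal e" .
  moreover have "F \<subseteq> (\<Union>i. V i)" using Es(1) V(2) by blast
  moreover have "(\<Union>i. V i) \<in> sets borel" using V(1) by (intro sets.countable_UN) auto
  ultimately show ?thesis by blast
qed


subsection \<open>Words and close pairs\<close>

fun word_poly :: "complex \<Rightarrow> real list \<Rightarrow> complex" where
  "word_poly l [] = 0"
| "word_poly l (x # xs) = of_real x + l * word_poly l xs"

definition words :: "nat \<Rightarrow> real list set" where
  "words n = {xs. set xs \<subseteq> {-1, 1} \<and> length xs = n}"

lemma finite_words [simp]: "finite (words n)"
  unfolding words_def by (rule finite_lists_length_eq) auto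

lemma card_words: "card (words n) = 2 ^ n"
  unfolding words_def by (subst card_lists_length_eq) (auto simp: numeral_2_eq_2)

lemma words_Suc_iff: "x # xs \<in> words (Suc n) \<longleftrightarrow> x \<in> {-1, 1} \<and> xs \<in> words n"
  by (auto simp: words_def)

lemma words_SucE:
  assumes "u \<in> words (Suc n)"
  obtains x xs where "u = x # xs" "x \<in> {-1, 1}" "xs \<in> words n"
  using assms by (cases u) (auto simp: words_def)

lemma word_poly_append: "word_poly l (xs @ ys) = word_poly l xs + l ^ length xs * word_poly l ys"
  by (induction xs) (auto simp: algebra_simps)

lemma word_poly_conv_sum: "word_poly l xs = (\<Sum>k<length xs. of_real (xs ! k) * l ^ k)"
proof (induction xs)
  case (Cons x xs)
  have "(\<Sum>k<length (x # xs). of_real ((x # xs) ! k) * l ^ k)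
      = of_real x + (\<Sum>k<length xs. of_real (xs ! k) * l ^ Suc k)"
    by (simp only: length_Cons sum.lessThan_Suc_shift) simp
  also have "(\<Sum>k<length xs. of_real (xs ! k) * l ^ Suc k) = l * word_poly l xs"
    unfolding Cons by (simp add: sum_distrib_left mult_ac)
  finally show ?case by simp
qed simp

lemma pseries_finite:
  assumes "\<And>k. k \<ge> n \<Longrightarrow> a k = 0"
  shows "pseries a l = (\<Sum>k<n. of_real (a k) * l ^ k)"
  unfolding pseries_def by (rule suminf_finite) (use assms in auto)

text \<open>Dividing by the first coefficient, which is 2 or -2, brings the difference of two sign
  words into the normalised class to which transversality applies.\<close>

lemma word_poly_diff_pseries:
  assumes "u \<in> words n" "v \<in> words n" "0 < n" "u ! 0 \<noteq> v ! 0"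
  obtains a where "a 0 = 1" "\<And>k. \<bar>a k\<bar> \<le> 1"
    "\<And>l. norm (word_poly l u - word_poly l v) = 2 * norm (pseries a l)"
proof -
  have el: "u ! k \<in> {-1, 1}" "v ! k \<in> {-1, 1}" if "k < n" for k
    using assms(1,2) that by (auto simp: words_def dest!: subsetD[OF _ nth_mem])
  define c where "c = u ! 0 - v ! 0"
  have c: "\<bar>c\<bar> = 2" using el[of 0] assms(3,4) by (auto simp: c_def)
  define a where "a k = (if k < n then (u ! k - v ! k) / c else 0)" for k
  have "a 0 = 1" using assms c by (auto simp: a_def c_def)
  moreover have "\<bar>a k\<bar> \<le> 1" for k
    using el[of k] c by (auto simp: a_def abs_divide)
  moreover have "norm (word_poly l u - word_poly l v) = 2 * norm (pseries a l)" for l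
  proof -
    have "of_real c * pseries a l = (\<Sum>k<n. of_real c * (of_real (a k) * l ^ k))"
      by (subst pseries_finite[of n]) (auto simp: a_def sum_distrib_left)
    also have "\<dots> = (\<Sum>k<n. of_real (u ! k) * l ^ k - of_real (v ! k) * l ^ k)"
    proof (rule sum.cong[OF refl])
      fix k assume "k \<in> {..<n}"
      then have "c * a k = u ! k - v ! k" using c by (auto simp: a_def)
      then have "of_real c * of_real (a k) = (of_real (u ! k) - of_real (v ! k) :: complex)"
        by (simp flip: of_real_mult of_real_diff)
      then show "of_real c * (of_real (a k) * l ^ k) = of_real (u ! k) * l ^ k - of_real (v ! k) * l ^ k"
        by (simp add: mult.assoc[symmetric] left_diff_distrib)
    qed
    also have "\<dots> = word_poly l u - word_poly l v"
      using assms(1,2) by (simp add: word_poly_conv_sum words_def sum_subtractf)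
    finally show ?thesis using c by (metis norm_mult norm_of_real)
  qed
  ultimately show thesis using that by blast
qed

text \<open>The threshold 8 is dictated by \<open>nu_cball_le\<close>: below
  \<open>1 / sqrt 2\<close>, sequences whose sums differ by at most \<open>norm l ^ n\<close> must
  have close initial words.\<close>

definition close_pairs :: "nat \<Rightarrow> complex \<Rightarrow> (real list \<times> real list) set" where
  "close_pairs n l = {(u, v) \<in> words n \<times> words n. norm (word_poly l u - word_poly l v) \<le> 8 * norm l ^ n}"

definition split_pairs :: "nat \<Rightarrow> complex \<Rightarrow> (real list \<times> real list) set" where
  "split_pairs n l = {(u, v) \<in> close_pairs n l. u ! 0 \<noteq> v ! 0}"

lemma close_pairs_subset: "close_pairs n l \<subseteq> words n \<times> words n"
  by (auto simp: close_pairs_def)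

lemma finite_close_pairs [simp]: "finite (close_pairs n l)"
  by (rule finite_subset[OF close_pairs_subset]) auto

lemma split_pairs_subset: "split_pairs n l \<subseteq> close_pairs n l"
  by (auto simp: split_pairs_def)

lemma finite_split_pairs [simp]: "finite (split_pairs n l)"
  by (rule finite_subset[OF split_pairs_subset]) auto

text \<open>Close pairs with a common first letter are close pairs at the previous level, so the
  normalised number of close pairs grows only by the pairs that split at once.\<close>
lemma card_close_pairs_Suc:
  assumes "l \<noteq> 0"
  shows "card (close_pairs (Suc n) l) = 2 * card (close_pairs n l) + card (split_pairs (Suc n) l)"
proof -
  define f where "f = (\<lambda>(x :: real, u, v). (x # u :: real list, x # v :: real list))"
  have eq: "close_pairs (Suc n) l - split_pairs (Suc n) l = f ` ({-1, 1} \<times> close_pairs n l)"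
  proof (intro equalityI subsetI)
    fix p assume p: "p \<in> close_pairs (Suc n) l - split_pairs (Suc n) l"
    then obtain u v where uv: "p = (u, v)" "u \<in> words (Suc n)" "v \<in> words (Suc n)"
        "norm (word_poly l u - word_poly l v) \<le> 8 * norm l ^ Suc n" "u ! 0 = v ! 0"
      by (auto simp: close_pairs_def split_pairs_def)
    obtain x xs where x: "u = x # xs" "x \<in> {-1, 1}" "xs \<in> words n" using uv(2) by (rule words_SucE)
    obtain y ys where y: "v = y # ys" "y \<in> {-1, 1}" "ys \<in> words n" using uv(3) by (rule words_SucE)
    have xy: "x = y" using uv(5) x y by simp
    have "word_poly l u - word_poly l v = l * (word_poly l xs - word_poly l ys)"
      using x y xy by (simp add: algebra_simps)
    then have "norm l * norm (word_poly l xs - word_poly l ys) \<le> norm l * (8 * norm l ^ n)"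
      using uv(4) by (simp add: norm_mult)
    then have "(xs, ys) \<in> close_pairs n l" using assms x y by (simp add: close_pairs_def)
    then show "p \<in> f ` ({-1, 1} \<times> close_pairs n l)"
      using uv(1) x y xy by (intro image_eqI[of _ _ "(x, xs, ys)"]) (auto simp: f_def)
  next
    fix p assume "p \<in> f ` ({-1, 1} \<times> close_pairs n l)"
    then obtain x u v where p: "p = (x # u, x # v)" "x \<in> {-1, 1}" "(u, v) \<in> close_pairs n l"
      by (auto simp: f_def)
    have "word_poly l (x # u) - word_poly l (x # v) = l * (word_poly l u - word_poly l v)"
      by (simp add: algebra_simps)
    then have "norm (word_poly l (x # u) - word_poly l (x # v)) \<le> 8 * norm l ^ Suc n"
      using p(3) mult_left_mono[of "norm (word_poly l u - word_poly l v)" "8 * norm l ^ n" "norm l"]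
      by (auto simp: close_pairs_def norm_mult)
    then show "p \<in> close_pairs (Suc n) l - split_pairs (Suc n) l"
      using p by (auto simp: close_pairs_def split_pairs_def words_Suc_iff)
  qed
  have "inj_on f ({-1, 1} \<times> close_pairs n l)" by (auto simp: f_def inj_on_def)
  then have "card (close_pairs (Suc n) l - split_pairs (Suc n) l) = 2 * card (close_pairs n l)"
    unfolding eq by (subst card_image) (auto simp: card_cartesian_product)
  then show ?thesis
    using card_Diff_subset[OF finite_split_pairs split_pairs_subset, of "Suc n" l]
      card_mono[OF finite_close_pairs split_pairs_subset, of "Suc n" l] by simp
qed

text \<open>\<open>card (close_pairs n l) / 2 ^ n\<close> is the expected number of words close to a
  random word of length \<open>n\<close>; a bound on these expectations is the input to Fatou's
  lemma.\<close>

definition few_close_pairs :: "complex \<Rightarrow> bool" where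
  "few_close_pairs l \<longleftrightarrow> (\<exists>K. \<forall>n. real (card (close_pairs n l)) \<le> K * 2 ^ n)"

lemma few_close_pairsI:
  assumes l: "l \<noteq> 0" and \<rho>: "0 < \<rho>" "\<rho> < 1"
    and few: "\<And>n. n \<ge> m \<Longrightarrow> real (card (split_pairs n l)) \<le> (2 * \<rho>) ^ n"
  shows "few_close_pairs l"
proof -
  define b where "b n = real (card (close_pairs n l)) / 2 ^ n" for n
  have step: "b (Suc n) = b n + real (card (split_pairs (Suc n) l)) / 2 ^ Suc n" for n
    unfolding b_def card_close_pairs_Suc[OF l] by (simp add: add_divide_distrib)
  have mono: "b n \<le> b (n + k)" for n k
  proof (induction k)
    case (Suc k)
    moreover have "b (n + k) \<le> b (Suc (n + k))" unfolding step by simp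
    ultimately show ?case by simp
  qed simp
  have bound: "b (m + k) \<le> b m + (\<Sum>j<k. \<rho> ^ j)" for k
  proof (induction k)
    case (Suc k)
    have "real (card (split_pairs (Suc (m + k)) l)) / 2 ^ Suc (m + k) \<le> (2 * \<rho>) ^ Suc (m + k) / 2 ^ Suc (m + k)"
      by (intro divide_right_mono few) auto
    also have "\<dots> = \<rho> ^ Suc (m + k)" by (simp add: power_mult_distrib)
    also have "\<dots> \<le> \<rho> ^ k" using \<rho> by (intro power_decreasing) auto
    finally show ?case using Suc step[of "m + k"] by simp
  qed simp
  have geo: "(\<Sum>j<k. \<rho> ^ j) \<le> 1 / (1 - \<rho>)" for k
    using \<rho> sum_le_suminf[of "\<lambda>j. \<rho> ^ j" "{..<k}"] by (simp add: suminf_geometric summable_geometric)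
  have "b n \<le> b m + 1 / (1 - \<rho>)" for n
  proof -
    \<comment> \<open>Monotonicity also covers the levels below \<open>m\<close>, about which
      nothing is assumed.\<close>
    have "b n \<le> b (m + n)" using mono[of n m] by (simp add: add.commute)
    then show ?thesis using bound[of n] geo[of n] by linarith
  qed
  then have "real (card (close_pairs n l)) \<le> (b m + 1 / (1 - \<rho>)) * 2 ^ n" for n
    unfolding b_def by (simp add: pos_divide_le_eq)
  then show ?thesis unfolding few_close_pairs_def by blast
qed

section \<open>Covering the parameters with many split pairs\<close>

lemma separated_cover:
  fixes B :: "'a :: metric_space set"
  assumes d: "0 \<le> d" and card: "\<And>X. finite X \<Longrightarrow> X \<subseteq> B \<Longrightarrow> (\<And>x y. x \<in> X \<Longrightarrow> y \<in> X \<Longrightarrow> x \<noteq> y \<Longrightarrow> d < dist x y) \<Longrightarrow> card X \<le> k"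
  obtains X where "finite X" "card X \<le> k" "B \<subseteq> (\<Union>x\<in>X. cball x d)"
proof -
  define P where "P X \<longleftrightarrow> finite X \<and> X \<subseteq> B \<and> (\<forall>x\<in>X. \<forall>y\<in>X. x \<noteq> y \<longrightarrow> d < dist x y)" for X
  have "P {}" by (simp add: P_def)
  moreover have bd: "card X \<le> k" if "P X" for X using that by (intro card) (auto simp: P_def)
  \<comment> \<open>The bound \<open>k\<close> guarantees a separated set of greatest cardinality,
    and maximality turns it into a net.\<close>
  ultimately obtain X where X: "P X" "\<And>Y. P Y \<Longrightarrow> card Y \<le> card X"
    using ex_has_greatest_nat[of P "{}" card "Suc k"] by (auto simp: less_Suc_eq_le)
  show thesis
  proof (rule that[of X])
    show "finite X" using X(1) by (simp add: P_def)
    show "card X \<le> k" by (rule bd[OF X(1)])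
    show "B \<subseteq> (\<Union>x\<in>X. cball x d)"
    proof (rule ccontr)
      assume "\<not> ?thesis"
      then obtain y where y: "y \<in> B" "\<And>x. x \<in> X \<Longrightarrow> d < dist x y" by force
      have "y \<notin> X" using y(2)[of y] d by auto
      moreover have "P (insert y X)" using X(1) y by (auto simp: P_def dist_commute)
      ultimately show False using X(2)[of "insert y X"] X(1) by (simp add: P_def)
    qed
  qed
qed


text \<open>Double counting over a separated set of bad parameters: there are \<open>4 ^ n\<close>
  pairs of words, each bad parameter uses more than \<open>m\<close> of them, and no pair is used
  twice. Indeed a pair that is close at both \<open>x\<close> and \<open>y\<close> gives a
  normalised series with values at most \<open>4 * R ^ n\<close> there, and transversality puts
  \<open>x\<close> and \<open>y\<close> within \<open>8 * C * R ^ n\<close>.\<close>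

lemma split_pairs_cover:
  assumes C: "0 < C" and R: "0 < R" and m: "0 < m" and n: "0 < n" and Q: "Q \<subseteq> ball 0 R"
    and tr: "\<And>a l1 l2. a 0 = 1 \<Longrightarrow> (\<And>k. \<bar>a k\<bar> \<le> 1) \<Longrightarrow> l1 \<in> Q \<Longrightarrow> l2 \<in> Q \<Longrightarrow>
       norm (l1 - l2) \<le> C * (norm (pseries a l1) + norm (pseries a l2))"
  obtains X where "finite X" "real (card X) * m \<le> 4 ^ n"
    "{l \<in> Q. m < real (card (split_pairs n l))} \<subseteq> (\<Union>x\<in>X. cball x (8 * C * R ^ n))"
proof -
  define d where "d = 8 * C * R ^ n"
  have d: "0 \<le> d" using C R by (simp add: d_def)
  define B where "B = {l \<in> Q. m < real (card (split_pairs n l))}"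
  have bound: "real (card X) * m \<le> 4 ^ n"
    if X: "finite X" "X \<subseteq> B" "\<And>x y. x \<in> X \<Longrightarrow> y \<in> X \<Longrightarrow> x \<noteq> y \<Longrightarrow> d < dist x y" for X
  proof -
    have same: "x = y" if xy: "x \<in> X" "y \<in> X" and p: "p \<in> split_pairs n x" "p \<in> split_pairs n y" for x y p
    proof (rule ccontr)
      assume ne: "x \<noteq> y"
      obtain u v where uv: "p = (u, v)" "u \<in> words n" "v \<in> words n" "u ! 0 \<noteq> v ! 0"
        and le: "norm (word_poly x u - word_poly x v) \<le> 8 * norm x ^ n"
          "norm (word_poly y u - word_poly y v) \<le> 8 * norm y ^ n"
        using p by (auto simp: split_pairs_def close_pairs_def)
      obtain a where a: "a 0 = 1" "\<And>k. \<bar>a k\<bar> \<le> 1"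
          "\<And>l. norm (word_poly l u - word_poly l v) = 2 * norm (pseries a l)"
        by (rule word_poly_diff_pseries[OF uv(2,3) n uv(4)]) blast
      have xyQ: "x \<in> Q" "y \<in> Q" using xy X(2) by (auto simp: B_def)
      then have "norm x < R" "norm y < R" using Q by auto
      then have "norm x ^ n \<le> R ^ n" "norm y ^ n \<le> R ^ n" by (intro power_mono; simp)+
      then have "norm (pseries a x) + norm (pseries a y) \<le> 8 * R ^ n" using le unfolding a(3) by linarith
      then have "C * (norm (pseries a x) + norm (pseries a y)) \<le> C * (8 * R ^ n)"
        using C by (intro mult_left_mono) auto
      moreover have "norm (x - y) \<le> C * (norm (pseries a x) + norm (pseries a y))"
        by (rule tr[of a x y]) (fact a xyQ)+
      ultimately have "dist x y \<le> d" by (simp add: dist_norm d_def)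
      then show False using X(3)[OF xy ne] by simp
    qed
    have "real (card X) * m = (\<Sum>x\<in>X. m)" by simp
    also have "\<dots> \<le> (\<Sum>x\<in>X. real (card (split_pairs n x)))"
      using X(2) by (intro sum_mono) (auto simp: B_def)
    also have "\<dots> = real (card (SIGMA x:X. split_pairs n x))"
      using X(1) by (subst card_SigmaI) auto
    also have "card (SIGMA x:X. split_pairs n x) \<le> card (words n \<times> words n)"
    proof (rule card_inj_on_le[of snd])
      show "inj_on snd (SIGMA x:X. split_pairs n x)" using same by (auto simp: inj_on_def)
      show "snd ` (SIGMA x:X. split_pairs n x) \<subseteq> words n \<times> words n"
        using split_pairs_subset close_pairs_subset by (fastforce simp: image_iff)
    qed simp
    also have "card (words n \<times> words n) = 4 ^ n"
      by (simp add: card_cartesian_product card_words flip: power_mult_distrib)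
    finally show ?thesis by simp
  qed
  have "card X \<le> nat \<lfloor>4 ^ n / m\<rfloor>"
    if X: "finite X" "X \<subseteq> B" "\<And>x y. x \<in> X \<Longrightarrow> y \<in> X \<Longrightarrow> x \<noteq> y \<Longrightarrow> d < dist x y" for X
  proof -
    have "real (card X) \<le> 4 ^ n / m" using bound[OF X] m by (simp add: pos_le_divide_eq)
    then show ?thesis by (simp add: le_nat_floor)
  qed
  then obtain X where X: "finite X" "card X \<le> nat \<lfloor>4 ^ n / m\<rfloor>" "B \<subseteq> (\<Union>x\<in>X. cball x d)"
    by (rule separated_cover[OF d])
  have "real (card X) \<le> 4 ^ n / m"
    using X(2) m of_nat_floor[of "4 ^ n / m"] by (meson divide_nonneg_pos of_nat_le_iff order_trans zero_le_numeral zero_le_power)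
  then have "real (card X) * m \<le> 4 ^ n" using m by (simp add: pos_le_divide_eq)
  then show thesis using that X unfolding B_def d_def by blast
qed

lemma power_powr_swap: "0 \<le> R \<Longrightarrow> (R ^ n) powr t = (R powr t) ^ n" for R t :: real
  by (induction n) (auto simp: powr_mult)

lemma few_close_pairs_locally:
  assumes l0: "Im l0 \<noteq> 0" "norm l0 < R" "R \<le> 1 / sqrt 2" and t: "0 < t" "2 * R powr t < 1"
  shows "\<exists>U. open U \<and> l0 \<in> U \<and> hausdorff_measure t ({l. \<not> few_close_pairs l} \<inter> U) = 0"
proof -
  obtain C \<eta> where C: "0 < C" and \<eta>: "0 < \<eta>" and sub: "ball l0 \<eta> \<subseteq> ball 0 R"
    and tr: "\<And>a l1 l2. a 0 = 1 \<Longrightarrow> (\<And>k. \<bar>a k\<bar> \<le> 1) \<Longrightarrow> l1 \<in> ball l0 \<eta> \<Longrightarrow> l2 \<in> ball l0 \<eta> \<Longrightarrow>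
       norm (l1 - l2) \<le> C * (norm (pseries a l1) + norm (pseries a l2))"
    by (rule pseries_transversality[OF l0]) blast
  \<comment> \<open>The point 0 is removed because the recursion for close pairs divides by
    \<open>l\<close>.\<close>
  define U where "U = ball l0 \<eta> \<inter> - {0}"
  have l00: "l0 \<noteq> 0" using l0(1) by auto
  have R: "0 < R" using l0(2) norm_ge_zero[of l0] by linarith
  have "1 / sqrt 2 < (1 :: real)" by simp
  then have R1: "R < 1" using l0(3) by linarith
  \<comment> \<open>Both inequalities are needed: \<rho> below 1 makes the growth of the normalised
    counts summable, and \<rho> above \<open>2 * R powr t\<close> makes \<open>q < 1\<close>, so
    that the covering sums of the bad sets are summable too.\<close>
  obtain \<rho> where \<rho>: "2 * R powr t < \<rho>" "\<rho> < 1" using dense[OF t(2)] by blast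
  have \<rho>0: "0 < \<rho>" using \<rho>(1) R by (intro le_less_trans[OF _ \<rho>(1)]) auto
  define q where "q = 2 * R powr t / \<rho>"
  have q: "0 < q" "q < 1" using \<rho> \<rho>0 R by (auto simp: q_def)
  define c where "c = (16 * C) powr t"
  define Bad where "Bad n = {l \<in> U. (2 * \<rho>) ^ n < real (card (split_pairs n l))}" for n
  have bad: "hausdorff_pre t \<delta> (Bad n) \<le> ennreal (c * q ^ n)"
    if n: "0 < n" "16 * C * R ^ n \<le> \<delta>" for n \<delta>
  proof -
    define d where "d = 8 * C * R ^ n"
    have d: "0 < d" "2 * d \<le> \<delta>" "0 < \<delta>" using C R n by (auto simp: d_def intro: less_le_trans[of _ "16 * C * R ^ n"])
    obtain X where X: "finite X" "real (card X) * (2 * \<rho>) ^ n \<le> 4 ^ n" "Bad n \<subseteq> (\<Union>x\<in>X. cball x d)"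
      unfolding Bad_def d_def
    proof (rule split_pairs_cover[OF C R, of "(2 * \<rho>) ^ n" n U])
      show "U \<subseteq> ball 0 R" using sub by (auto simp: U_def)
      show "norm (l1 - l2) \<le> C * (norm (pseries a l1) + norm (pseries a l2))"
        if "a 0 = 1" "\<And>k. \<bar>a k\<bar> \<le> 1" "l1 \<in> U" "l2 \<in> U" for a l1 l2
        using that by (intro tr) (auto simp: U_def)
    qed (use \<rho>0 n in auto)
    have cb: "diameter (cball x d) \<le> 2 * d" for x :: complex
      using d by simp
    have "hausdorff_pre t \<delta> (Bad n) \<le> hausdorff_pre t \<delta> (\<Union>x\<in>X. cball x d)" by (rule hausdorff_pre_mono[OF X(3)])
    also have "\<dots> \<le> (\<Sum>x\<in>X. hausdorff_pre t \<delta> (cball x d))"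
      using X(1) d by (intro hausdorff_pre_finite_UN) auto
    also have "\<dots> \<le> (\<Sum>x\<in>X. ennreal ((2 * d) powr t))"
    proof (rule sum_mono)
      fix x :: complex
      have "hausdorff_pre t \<delta> (cball x d) \<le> diam_pow (cball x d) t"
        using cb[of x] d by (intro hausdorff_pre_single) auto
      also have "\<dots> \<le> ennreal ((2 * d) powr t)" using cb[of x] d t by (intro diam_pow_le) auto
      finally show "hausdorff_pre t \<delta> (cball x d) \<le> ennreal ((2 * d) powr t)" .
    qed
    also have "\<dots> = ennreal (real (card X) * (2 * d) powr t)"
      by (simp add: ennreal_mult ennreal_of_nat_eq_real_of_nat)
    also have "\<dots> \<le> ennreal (c * q ^ n)"
    proof (rule ennreal_leI)
      have e: "(2 * d) powr t = c * (R powr t) ^ n"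
        using C R by (simp add: d_def c_def powr_mult power_powr_swap flip: mult.assoc)
      have "(4 :: real) ^ n = 2 ^ n * 2 ^ n" by (simp flip: power_mult_distrib)
      then have "2 ^ n * (real (card X) * \<rho> ^ n) \<le> 2 ^ n * (2 ^ n :: real)"
        using X(2) by (simp add: power_mult_distrib mult_ac)
      then have "real (card X) \<le> 2 ^ n / \<rho> ^ n" using \<rho>0 by (simp add: pos_le_divide_eq)
      then have "real (card X) * (c * (R powr t) ^ n) \<le> 2 ^ n / \<rho> ^ n * (c * (R powr t) ^ n)"
        by (intro mult_right_mono) (auto simp: c_def)
      also have "\<dots> = c * q ^ n" by (simp add: q_def power_divide power_mult_distrib)
      finally show "real (card X) * (2 * d) powr t \<le> c * q ^ n" unfolding e .
    qed
    finally show ?thesis .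
  qed
  have "hausdorff_pre t \<delta> ({l. \<not> few_close_pairs l} \<inter> U) = 0" if \<delta>: "0 < \<delta>" for \<delta>
  proof -
    have "(\<lambda>n. 16 * C * R ^ n) \<longlonglongrightarrow> 16 * C * 0"
      using R R1 by (intro tendsto_mult_left LIMSEQ_realpow_zero) auto
    then have "eventually (\<lambda>n. 16 * C * R ^ n < \<delta>) sequentially"
      using \<delta> by (intro order_tendstoD(2)) auto
    then obtain N where N: "\<And>n. n \<ge> N \<Longrightarrow> 16 * C * R ^ n < \<delta>"
      by (auto simp: eventually_sequentially)
    have tail: "hausdorff_pre t \<delta> ({l. \<not> few_close_pairs l} \<inter> U) \<le> ennreal (c / (1 - q) * q ^ n)"
      if n: "n \<ge> Suc N" for n
    proof -
      \<comment> \<open>Borel-Cantelli step: a parameter missed by all bad sets from level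
        \<open>n\<close> on has few close pairs.\<close>
      have "{l. \<not> few_close_pairs l} \<inter> U \<subseteq> (\<Union>k. Bad (n + k))"
      proof (rule subsetI, rule ccontr)
        fix l assume l: "l \<in> {l. \<not> few_close_pairs l} \<inter> U" "l \<notin> (\<Union>k. Bad (n + k))"
        have "real (card (split_pairs m l)) \<le> (2 * \<rho>) ^ m" if "m \<ge> n" for m
        proof -
          have "l \<notin> Bad (n + (m - n))" using l(2) by blast
          then show ?thesis using l(1) that by (simp add: Bad_def)
        qed
        then have "few_close_pairs l" using l(1) \<rho>0 \<rho>(2) by (intro few_close_pairsI) (auto simp: U_def)
        then show False using l(1) by simp
      qed
      then have "hausdorff_pre t \<delta> ({l. \<not> few_close_pairs l} \<inter> U) \<le> hausdorff_pre t \<delta> (\<Union>k. Bad (n + k))"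
        by (rule hausdorff_pre_mono)
      also have "\<dots> \<le> (\<Sum>k. hausdorff_pre t \<delta> (Bad (n + k)))" by (rule hausdorff_pre_UN)
      also have "\<dots> \<le> (\<Sum>k. ennreal (c * q ^ n * q ^ k))"
      proof (intro suminf_le)
        fix k
        show "hausdorff_pre t \<delta> (Bad (n + k)) \<le> ennreal (c * q ^ n * q ^ k)"
          using bad[of "n + k" \<delta>] n N[of "n + k"] by (simp add: power_add mult.assoc)
      qed auto
      also have "\<dots> = ennreal (c / (1 - q) * q ^ n)"
      proof (rule suminf_ennreal_eq)
        show "0 \<le> c * q ^ n * q ^ k" for k using q by (simp add: c_def)
        have "(\<lambda>k. c * q ^ n * q ^ k) sums (c * q ^ n * (1 / (1 - q)))"
          using q by (intro sums_mult geometric_sums) auto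
        then show "(\<lambda>k. c * q ^ n * q ^ k) sums (c / (1 - q) * q ^ n)" by (simp add: mult_ac)
      qed
      finally show ?thesis .
    qed
    have "((\<lambda>n. ennreal (c / (1 - q) * q ^ n)) \<longlongrightarrow> ennreal (c / (1 - q) * 0)) sequentially"
      using q by (intro tendsto_ennrealI tendsto_mult_left LIMSEQ_realpow_zero) auto
    moreover have "eventually (\<lambda>n. hausdorff_pre t \<delta> ({l. \<not> few_close_pairs l} \<inter> U) \<le> ennreal (c / (1 - q) * q ^ n)) sequentially"
      using tail by (auto simp: eventually_sequentially)
    ultimately have "hausdorff_pre t \<delta> ({l. \<not> few_close_pairs l} \<inter> U) \<le> ennreal (c / (1 - q) * 0)"
      by (intro tendsto_lowerbound) auto
    then show ?thesis by simp
  qed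
  moreover have "open U" "l0 \<in> U" using \<eta> l00 by (auto simp: U_def)
  ultimately show ?thesis by (auto simp: hausdorff_null_iff)
qed

lemma few_close_pairs_null:
  assumes "R \<le> 1 / sqrt 2" "0 < t" "2 * R powr t < 1"
  shows "hausdorff_measure t {l. Im l \<noteq> 0 \<and> norm l < R \<and> \<not> few_close_pairs l} = 0"
proof (rule hausdorff_null_locally)
  let ?E = "{l. Im l \<noteq> 0 \<and> norm l < R \<and> \<not> few_close_pairs l}"
  fix l assume "l \<in> ?E"
  then obtain U where U: "open U" "l \<in> U" "hausdorff_measure t ({l. \<not> few_close_pairs l} \<inter> U) = 0"
    using few_close_pairs_locally[of l R t] assms by auto
  then have "hausdorff_measure t (?E \<inter> U) = 0"
    by (elim hausdorff_null_subset) auto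
  then show "\<exists>U. open U \<and> l \<in> U \<and> hausdorff_measure t (?E \<inter> U) = 0" using U by blast
qed

text \<open>Negligibility lives in the completed measure, and \<open>S\<close> need not be Borel;
  \<open>AE_completion_iff\<close> brings the statement back to \<open>lborel\<close>. The real axis
  is discarded at the same time, being a hyperplane.\<close>

lemma AE_nonreal_not_in_negligible:
  assumes "negligible S"
  shows "AE l in lborel. Im l \<noteq> 0 \<and> l \<notin> S"
proof -
  have "negligible {l. Im l = 0}"
    using negligible_standard_hyperplane[of \<i> 0] by (simp add: inner_complex_def Basis_complex_def)
  then have "negligible (S \<union> {l. Im l = 0})" by (rule negligible_Un[OF assms])
  then have "S \<union> {l. Im l = 0} \<in> null_sets lebesgue" by (simp add: negligible_iff_null_sets)
  then have "AE l in lebesgue. l \<notin> S \<union> {l. Im l = 0}" by (rule AE_not_in)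
  then have "AE l in lborel. l \<notin> S \<union> {l. Im l = 0}" by (simp only: AE_completion_iff)
  then show ?thesis by (rule AE_mp) auto
qed

text \<open>Exponent 2 is admissible for every radius strictly below \<open>1 / sqrt 2\<close>, so
  the disc is exhausted by the radii \<open>(1 - 1 / (n + 2)) / sqrt 2\<close>.\<close>

lemma few_close_pairs_AE:
  "AE l in lborel. norm l < 1 / sqrt 2 \<longrightarrow> Im l \<noteq> 0 \<and> few_close_pairs l"
proof -
  define E where "E n = {l. Im l \<noteq> 0 \<and> norm l < (1 - 1 / real (n + 2)) / sqrt 2 \<and> \<not> few_close_pairs l}" for n :: nat
  have "negligible (E n)" for n
    unfolding E_def
  proof (rule hausdorff_null_imp_negligible, rule few_close_pairs_null)
    define x where "x = 1 - 1 / real (n + 2)"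
    have x: "0 < x" "x < 1" by (auto simp: x_def field_simps)
    then show "x / sqrt 2 \<le> 1 / sqrt 2" by (intro divide_right_mono) auto
    have "x\<^sup>2 < 1" using x by (simp add: power_less_one_iff)
    then show "2 * (x / sqrt 2) powr 2 < 1" using x by (simp add: powr_numeral power_divide)
  qed auto
  then have "AE l in lborel. Im l \<noteq> 0 \<and> l \<notin> (\<Union>n. E n)"
    by (intro AE_nonreal_not_in_negligible negligible_Union_nat)
  then show ?thesis
  proof (rule AE_mp, intro AE_I2 impI)
    fix l assume l: "Im l \<noteq> 0 \<and> l \<notin> (\<Union>n. E n)" "norm l < 1 / sqrt 2"
    define x where "x = norm l * sqrt 2"
    have x: "x < 1" using l(2) by (simp add: x_def field_simps)
    obtain n :: nat where n: "1 / (1 - x) < real n" using reals_Archimedean2 by blast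
    then have "1 < real (n + 2) * (1 - x)" using x
      by (smt (verit) divide_less_eq mult_right_mono of_nat_add of_nat_0_le_iff)
    then have "x < 1 - 1 / real (n + 2)" by (simp add: field_simps)
    then have "norm l < (1 - 1 / real (n + 2)) / sqrt 2" by (simp add: x_def pos_less_divide_eq)
    then show "Im l \<noteq> 0 \<and> few_close_pairs l" using l(1) by (auto simp: E_def)
  qed
qed


subsection \<open>The Bernoulli measure and packing measure\<close>

lemma prob_space_sign_space: "prob_space sign_space"
  unfolding sign_space_def by (rule prob_space_PiM) (rule measure_pmf.prob_space_axioms)

lemma space_sign_space [simp]: "space sign_space = UNIV"
  unfolding sign_space_def by (simp add: space_PiM)

lemma measurable_sign_coordinate [measurable]: "(\<lambda>\<omega>. \<omega> n) \<in> borel_measurable sign_space"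
proof -
  have "(\<lambda>\<omega>. \<omega> n) \<in> measurable sign_space (measure_pmf (pmf_of_set {-1, 1 :: real}))"
    unfolding sign_space_def by (rule measurable_component_singleton) simp
  then show ?thesis
    by (rule measurable_compose[where g="\<lambda>x :: real. x" and L=borel]) simp
qed

lemma measurable_pseries [measurable]: "(\<lambda>\<omega>. pseries \<omega> l) \<in> borel_measurable sign_space"
  unfolding pseries_def by measurable

lemma AE_sign_space: "AE \<omega> in sign_space. \<forall>n. \<omega> n \<in> {-1, 1}"
  unfolding sign_space_def AE_all_countable
proof
  fix n :: nat
  show "AE \<omega> in (\<Pi>\<^sub>M _\<in>UNIV. measure_pmf (pmf_of_set {-1, 1})). \<omega> n \<in> {-1, 1 :: real}"
    by (rule AE_PiM_component[where P="\<lambda>x. x \<in> {-1, 1}"])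
      (auto simp: measure_pmf.prob_space_axioms AE_measure_pmf_iff)
qed

definition cylinder :: "real list \<Rightarrow> (nat \<Rightarrow> real) set" where
  "cylinder u = {\<omega>. map \<omega> [0..<length u] = u}"

lemma cylinder_alt: "cylinder u = {\<omega>. \<forall>i<length u. \<omega> i = u ! i}"
proof -
  have "map \<omega> [0..<length u] = u \<longleftrightarrow> (\<forall>i<length u. \<omega> i = u ! i)" for \<omega>
    unfolding list_eq_iff_nth_eq by simp
  then show ?thesis by (simp add: cylinder_def)
qed

lemma sets_cylinder [measurable]: "cylinder u \<in> sets sign_space"
proof -
  have "{\<omega> \<in> space sign_space. \<forall>i\<in>{..<length u}. \<omega> i = u ! i} \<in> sets sign_space" by measurable
  then show ?thesis by (simp add: cylinder_alt Ball_def)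
qed

lemma emeasure_cylinder:
  assumes "u \<in> words n"
  shows "emeasure sign_space (cylinder u) = ennreal ((1/2) ^ n)"
proof -
  interpret product_prob_space "\<lambda>_ :: nat. measure_pmf (pmf_of_set {-1, 1 :: real})" UNIV
    by unfold_locales
  have u: "length u = n" "\<And>i. i < n \<Longrightarrow> u ! i \<in> {-1, 1}"
    using assms by (auto simp: words_def dest!: subsetD[OF _ nth_mem])
  have "cylinder u = {\<omega> \<in> space (\<Pi>\<^sub>M _\<in>UNIV. measure_pmf (pmf_of_set {-1, 1 :: real})). \<forall>i\<in>{..<n}. \<omega> i \<in> {u ! i}}"
    using u by (auto simp: cylinder_alt space_PiM)
  then have "emeasure sign_space (cylinder u) = (\<Prod>i<n. emeasure (measure_pmf (pmf_of_set {-1, 1 :: real})) {u ! i})"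
    unfolding sign_space_def by (simp only:) (rule emeasure_PiM_Collect; simp)
  also have "\<dots> = (\<Prod>i<n. ennreal (1/2))"
    using u(2) by (intro prod.cong) (auto simp: emeasure_pmf_single pmf_of_set indicator_def)
  also have "\<dots> = ennreal ((1/2) ^ n)" by (simp only: prod_constant card_lessThan) (rule ennreal_power, simp)
  finally show ?thesis .
qed

lemma A_set_alt: "A_set l = (\<lambda>\<omega>. pseries \<omega> l) ` {\<omega>. \<forall>n. \<omega> n \<in> {-1, 1}}"
  by (auto simp: A_set_def pseries_def)

lemma sets_nu [simp, measurable_cong]: "sets (nu l) = sets borel"
  by (simp add: nu_def)

lemma space_nu [simp]: "space (nu l) = UNIV"
  by (simp add: nu_def)

lemma emeasure_nu:
  assumes "B \<in> sets borel"
  shows "emeasure (nu l) B = emeasure sign_space {\<omega>. pseries \<omega> l \<in> B}"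
  unfolding nu_def pseries_def[symmetric] using assms by (subst emeasure_distr) (auto simp: vimage_def)

lemma prob_space_nu: "prob_space (nu l)"
  unfolding nu_def pseries_def[symmetric]
  by (rule prob_space.prob_space_distr[OF prob_space_sign_space]) measurable

lemma sign_abs_le:
  assumes "\<And>n. \<omega> n \<in> {-1, 1 :: real}"
  shows "\<bar>\<omega> n\<bar> \<le> 1"
  using assms[of n] by auto

lemma norm_pseries_le:
  assumes "norm l < 1" "\<And>n. \<bar>a n\<bar> \<le> 1"
  shows "norm (pseries a l) \<le> 1 / (1 - norm l)"
proof -
  have s: "summable (\<lambda>k. norm l ^ k)" using assms by (intro summable_geometric) auto
  have "norm (pseries a l) \<le> (\<Sum>k. norm l ^ k)"
    unfolding pseries_def
  proof (rule norm_suminf_le[OF _ s])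
    show "norm (complex_of_real (a k) * l ^ k) \<le> norm l ^ k" for k
      using mult_right_mono[OF assms(2)[of k], of "norm l ^ k"] by (simp add: norm_mult norm_power)
  qed
  then show ?thesis using assms by (simp add: suminf_geometric)
qed

lemma pseries_split:
  assumes "norm l < 1" "\<And>n. \<bar>a n\<bar> \<le> 1"
  shows "pseries a l = word_poly l (map a [0..<n]) + l ^ n * pseries (\<lambda>k. a (n + k)) l"
proof -
  have s: "summable (\<lambda>k. complex_of_real (a k) * l ^ k)" by (rule summable_pseries[OF assms(2,1)])
  have s': "summable (\<lambda>k. complex_of_real (a (n + k)) * l ^ k)" by (rule summable_pseries[OF assms(2,1)])
  have "pseries a l = (\<Sum>k. complex_of_real (a (k + n)) * l ^ (k + n)) + (\<Sum>k<n. complex_of_real (a k) * l ^ k)"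
    unfolding pseries_def by (rule suminf_split_initial_segment[OF s])
  also have "(\<Sum>k. complex_of_real (a (k + n)) * l ^ (k + n)) = (\<Sum>k. l ^ n * (complex_of_real (a (n + k)) * l ^ k))"
    by (simp add: power_add mult_ac add.commute)
  also have "\<dots> = l ^ n * pseries (\<lambda>k. a (n + k)) l"
    unfolding pseries_def by (rule suminf_mult[OF s'])
  finally show ?thesis by (simp add: word_poly_conv_sum)
qed

lemma dist_pseries_word_poly:
  assumes "norm l < 1" "\<And>n. \<bar>a n\<bar> \<le> 1"
  shows "norm (pseries a l - word_poly l (map a [0..<n])) \<le> norm l ^ n / (1 - norm l)"
proof -
  have "norm (l ^ n * pseries (\<lambda>k. a (n + k)) l) \<le> norm l ^ n * (1 / (1 - norm l))"
    unfolding norm_mult norm_power using assms by (intro mult_left_mono norm_pseries_le) auto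
  then show ?thesis using pseries_split[of l a n, OF assms] by simp
qed

lemma map_mem_words: "(\<And>n. \<omega> n \<in> {-1, 1}) \<Longrightarrow> map \<omega> [0..<n] \<in> words n"
  by (auto simp: words_def)

text \<open>The level-\<open>n\<close> cylinder of a coding of \<open>x\<close> has mass
  \<open>(1/2) ^ n\<close>. Its sums and \<open>x\<close> lie within
  \<open>norm l ^ n / (1 - norm l)\<close> of the same word sum, so the cylinder is mapped into the
  ball.\<close>

lemma nu_cball_ge:
  assumes l: "norm l < 1" and x: "x \<in> A_set l" and r: "norm l ^ n * (2 / (1 - norm l)) \<le> r"
  shows "ennreal ((1/2) ^ n) \<le> emeasure (nu l) (cball x r)"
proof -
  obtain a where a: "\<And>n. a n \<in> {-1, 1}" "x = pseries a l" using x by (auto simp: A_set_alt)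
  let ?u = "map a [0..<n]"
  have "ennreal ((1/2) ^ n) = emeasure sign_space (cylinder ?u)"
    by (rule emeasure_cylinder[OF map_mem_words[OF a(1)], symmetric])
  also have "\<dots> \<le> emeasure sign_space {\<omega>. pseries \<omega> l \<in> cball x r}"
  proof (rule emeasure_mono_AE)
    show "AE \<omega> in sign_space. \<omega> \<in> cylinder ?u \<longrightarrow> \<omega> \<in> {\<omega>. pseries \<omega> l \<in> cball x r}"
      using AE_sign_space
    proof eventually_elim
      case (elim \<omega>)
      show ?case
      proof
        assume "\<omega> \<in> cylinder ?u"
        then have eq: "map \<omega> [0..<n] = ?u" by (simp add: cylinder_def)
        have "\<bar>\<omega> k\<bar> \<le> 1" for k using sign_abs_le[of \<omega>] elim by blast
        then have "norm (pseries \<omega> l - word_poly l ?u) \<le> norm l ^ n / (1 - norm l)"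
          unfolding eq[symmetric] by (rule dist_pseries_word_poly[OF l])
        moreover have "norm (x - word_poly l ?u) \<le> norm l ^ n / (1 - norm l)"
          unfolding a(2) by (rule dist_pseries_word_poly[OF l]) (rule sign_abs_le[of a, OF a(1)])
        ultimately have "norm (x - pseries \<omega> l) \<le> norm l ^ n / (1 - norm l) + norm l ^ n / (1 - norm l)"
          using norm_triangle_ineq4[of "x - word_poly l ?u" "pseries \<omega> l - word_poly l ?u"] by simp
        then show "\<omega> \<in> {\<omega>. pseries \<omega> l \<in> cball x r}" using r by (simp add: dist_norm mult.commute)
      qed
    qed
    show "{\<omega>. pseries \<omega> l \<in> cball x r} \<in> sets sign_space"
      using measurable_sets[OF measurable_pseries[of l], of "cball x r"] by (simp add: vimage_def)
  qed
  also have "\<dots> = emeasure (nu l) (cball x r)" by (rule emeasure_nu[symmetric]) simp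
  finally show ?thesis .
qed

lemma s_dim_pos: "0 < norm l \<Longrightarrow> norm l < 1 \<Longrightarrow> 0 < s_dim l"
  unfolding s_dim_def by (intro divide_pos_pos) auto

lemma norm_powr_s_dim:
  assumes "0 < norm l" "norm l < 1"
  shows "(norm l ^ n) powr s_dim l = (1/2) ^ n"
proof -
  have "norm l powr s_dim l = exp (- ln 2)"
    using assms by (simp add: powr_def s_dim_def)
  also have "\<dots> = 1/2" by (simp add: exp_minus)
  finally have "norm l powr s_dim l = 1/2" .
  then show ?thesis by (induction n) (auto simp: powr_mult)
qed

lemma nu_lower_regular:
  assumes l: "norm l < 1"
  obtains C where "0 \<le> C" "\<And>x r. x \<in> A_set l \<Longrightarrow> 0 < r \<Longrightarrow> r \<le> 1 \<Longrightarrow>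
      ennreal ((2 * r) powr s_dim l) \<le> ennreal C * emeasure (nu l) (cball x r)"
proof (cases "l = 0")
  case True
  \<comment> \<open>At \<open>l = 0\<close> the conventions for \<open>ln\<close> and division make
    \<open>s_dim l = 0\<close>, and level 1 already shows that every ball has mass at least
    1/2.\<close>
  have "ennreal ((2 * r) powr s_dim l) \<le> ennreal 2 * emeasure (nu l) (cball x r)"
    if x: "x \<in> A_set l" and r: "0 < r" "r \<le> 1" for x r
  proof -
    have "ennreal 2 * ennreal ((1/2) ^ 1) \<le> ennreal 2 * emeasure (nu l) (cball x r)"
      using x r True by (intro mult_left_mono nu_cball_ge) auto
    moreover have "ennreal 2 * ennreal ((1/2) ^ 1) = ennreal (2 * (1/2) ^ 1)"
      by (rule ennreal_mult[symmetric]) auto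
    ultimately show ?thesis using r True by (simp add: s_dim_def)
  qed
  then show thesis using that[of 2] by simp
next
  case False
  then have l0: "0 < norm l" by simp
  define K where "K = 2 / (1 - norm l)"
  have K: "2 \<le> K" using l l0 by (simp add: K_def field_simps)
  define C where "C = (2 * K / norm l) powr s_dim l"
  have "ennreal ((2 * r) powr s_dim l) \<le> ennreal C * emeasure (nu l) (cball x r)"
    if x: "x \<in> A_set l" and r: "0 < r" "r \<le> 1" for x r
  proof -
    have "(\<lambda>n. norm l ^ n * K) \<longlonglongrightarrow> 0 * K"
      using l by (intro tendsto_mult_right LIMSEQ_realpow_zero) auto
    then have "eventually (\<lambda>n. norm l ^ n * K < r) sequentially"
      using r by (intro order_tendstoD(2)) auto
    then have ex: "\<exists>n. norm l ^ n * K \<le> r" by (auto simp: eventually_sequentially intro: less_imp_le)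
    \<comment> \<open>The least level whose cylinders fit into the ball. Since the previous level
      does not fit, \<open>r\<close> is at most a constant times \<open>norm l ^ n\<close>;
      \<open>K\<close> being at least 2 excludes \<open>n = 0\<close>.\<close>
    define n where "n = (LEAST n. norm l ^ n * K \<le> r)"
    have n: "norm l ^ n * K \<le> r" unfolding n_def by (rule LeastI_ex[OF ex])
    have "n \<noteq> 0" using n K r by (cases n) auto
    then obtain m where m: "n = Suc m" by (cases n) auto
    have "\<not> norm l ^ m * K \<le> r"
      using not_less_Least[of m "\<lambda>n. norm l ^ n * K \<le> r"] m unfolding n_def[symmetric] by simp
    then have "2 * r \<le> (2 * K / norm l) * norm l ^ n" using l0 m by (simp add: mult.commute)
    then have "(2 * r) powr s_dim l \<le> ((2 * K / norm l) * norm l ^ n) powr s_dim l"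
      using r s_dim_pos[OF l0 l] by (intro powr_mono2) auto
    also have "\<dots> = C * (1/2) ^ n"
      using K l0 l by (subst powr_mult) (auto simp: C_def norm_powr_s_dim)
    finally have "ennreal ((2 * r) powr s_dim l) \<le> ennreal C * ennreal ((1/2) ^ n)"
      by (simp add: ennreal_mult[symmetric] C_def ennreal_leI)
    also have "\<dots> \<le> ennreal C * emeasure (nu l) (cball x r)"
      using n unfolding K_def by (intro mult_left_mono nu_cball_ge[OF l x]) auto
    finally show ?thesis .
  qed
  then show thesis using that[of C] by (simp add: C_def)
qed

lemma packing_measure_A_set_finite:
  assumes "norm l < 1"
  shows "packing_measure (s_dim l) (A_set l) < \<infinity>"
proof -
  obtain C where C: "0 \<le> C" "\<And>x r. x \<in> A_set l \<Longrightarrow> 0 < r \<Longrightarrow> r \<le> 1 \<Longrightarrow>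
      ennreal ((2 * r) powr s_dim l) \<le> ennreal C * emeasure (nu l) (cball x r)"
    by (rule nu_lower_regular[OF assms]) blast
  have "packing_measure (s_dim l) (A_set l) \<le> packing_pre (s_dim l) (A_set l)"
    by (rule packing_measure_le_pre)
  also have "\<dots> \<le> ennreal C * emeasure (nu l) UNIV"
    by (rule packing_pre_le_measure[where \<delta>=1]) (use C in auto)
  also have "\<dots> = ennreal C" using prob_space.emeasure_space_1[OF prob_space_nu, of l] by simp
  also have "\<dots> < \<infinity>" by simp
  finally show ?thesis .
qed

lemma packing_null_if_nu_null:
  assumes "norm l < 1" "B \<in> sets borel" "emeasure (nu l) B = 0"
  shows "packing_measure (s_dim l) (A_set l \<inter> B) = 0"
proof -
  obtain C where C: "0 \<le> C" "\<And>x r. x \<in> A_set l \<Longrightarrow> 0 < r \<Longrightarrow> r \<le> 1 \<Longrightarrow>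
      ennreal ((2 * r) powr s_dim l) \<le> ennreal C * emeasure (nu l) (cball x r)"
    by (rule nu_lower_regular[OF assms(1)]) blast
  have "finite_measure (nu l)" using prob_space_nu[of l] by (simp add: prob_space_def)
  then show ?thesis
    by (rule packing_measure_null[OF sets_nu _ assms(2,3) C])
qed


section \<open>Upper bounds for the Bernoulli measure at infinitely many scales\<close>

lemma inverse_sqrt2_le: "1 / sqrt 2 \<le> (5 / 7 :: real)"
proof -
  have "(7 / 5 :: real) \<le> sqrt 2" by (rule real_le_rsqrt) (simp add: power2_eq_square)
  then show ?thesis by (simp add: field_simps)
qed

text \<open>The number of words close to the initial word of the sequence, written as a sum over
  cylinders so that measurability and the integral can be read off.\<close>

definition close_count :: "complex \<Rightarrow> nat \<Rightarrow> (nat \<Rightarrow> real) \<Rightarrow> ennreal" where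
  "close_count l n \<omega> =
     (\<Sum>u\<in>words n. of_nat (card {v. (u, v) \<in> close_pairs n l}) * indicator (cylinder u) \<omega>)"

lemma measurable_close_count [measurable]: "close_count l n \<in> borel_measurable sign_space"
  unfolding close_count_def[abs_def] by measurable

lemma close_count_eq:
  assumes "\<And>k. \<omega> k \<in> {-1, 1}"
  shows "close_count l n \<omega> = of_nat (card {v. (map \<omega> [0..<n], v) \<in> close_pairs n l})"
proof -
  have ind: "indicator (cylinder u) \<omega> = (if map \<omega> [0..<n] = u then 1 else 0 :: ennreal)" if "u \<in> words n" for u
    using that by (auto simp: cylinder_def words_def indicator_def)
  have "close_count l n \<omega> = (\<Sum>u\<in>words n. if map \<omega> [0..<n] = u then of_nat (card {v. (u, v) \<in> close_pairs n l}) else 0)"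
    unfolding close_count_def by (rule sum.cong) (auto simp: ind)
  also have "\<dots> = of_nat (card {v. (map \<omega> [0..<n], v) \<in> close_pairs n l})"
    using map_mem_words[of \<omega> n] assms by (subst sum.delta') auto
  finally show ?thesis .
qed

lemma nn_integral_close_count:
  "(\<integral>\<^sup>+\<omega>. close_count l n \<omega> \<partial>sign_space) = ennreal (real (card (close_pairs n l)) / 2 ^ n)"
proof -
  have "(\<integral>\<^sup>+\<omega>. close_count l n \<omega> \<partial>sign_space)
      = (\<Sum>u\<in>words n. of_nat (card {v. (u, v) \<in> close_pairs n l}) * emeasure sign_space (cylinder u))"
    unfolding close_count_def by (subst nn_integral_sum) (auto simp: nn_integral_cmult_indicator)
  also have "\<dots> = (\<Sum>u\<in>words n. of_nat (card {v. (u, v) \<in> close_pairs n l}) * ennreal ((1/2) ^ n))"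
    by (intro sum.cong refl) (simp only: emeasure_cylinder)
  also have "\<dots> = of_nat (\<Sum>u\<in>words n. card {v. (u, v) \<in> close_pairs n l}) * ennreal ((1/2) ^ n)"
    by (simp only: of_nat_sum sum_distrib_right)
  also have "(\<Sum>u\<in>words n. card {v. (u, v) \<in> close_pairs n l}) = card (close_pairs n l)"
  proof -
    have "finite {v. (u, v) \<in> close_pairs n l}" for u
      by (rule finite_subset[of _ "words n"]) (auto simp: close_pairs_def)
    then have "(\<Sum>u\<in>words n. card {v. (u, v) \<in> close_pairs n l}) = card (SIGMA u:words n. {v. (u, v) \<in> close_pairs n l})"
      by (subst card_SigmaI) auto
    also have "(SIGMA u:words n. {v. (u, v) \<in> close_pairs n l}) = close_pairs n l"
      by (auto simp: close_pairs_def)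
    finally show ?thesis .
  qed
  also have "of_nat (card (close_pairs n l)) * ennreal ((1/2) ^ n) = ennreal (real (card (close_pairs n l)) * (1/2) ^ n)"
    unfolding ennreal_of_nat_eq_real_of_nat by (rule ennreal_mult[symmetric]) auto
  finally show ?thesis by (simp add: power_divide)
qed

text \<open>A sequence whose sum lands in the ball has an initial word close to that of \<omega>:
  the radius and the two tails add up to at most \<open>1 + 7 / 2 + 7 / 2 = 8\<close> times
  \<open>norm l ^ n\<close>.\<close>

lemma nu_cball_le:
  assumes l: "norm l < 1 / sqrt 2" and \<omega>: "\<And>k. \<omega> k \<in> {-1, 1}"
  shows "emeasure (nu l) (cball (pseries \<omega> l) (norm l ^ n)) \<le> close_count l n \<omega> * ennreal ((1/2) ^ n)"
proof -
  have l57: "norm l < 5 / 7" using l inverse_sqrt2_le by linarith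
  then have l1: "norm l < 1" by linarith
  let ?u = "map \<omega> [0..<n]"
  let ?V = "{v. (?u, v) \<in> close_pairs n l}"
  have fV: "finite ?V" and VW: "?V \<subseteq> words n"
    by (auto intro: finite_subset[of _ "words n"] simp: close_pairs_def)
  have tail: "norm l ^ n / (1 - norm l) \<le> 7 / 2 * norm l ^ n"
  proof -
    have "1 / (1 - norm l) \<le> 7 / 2" using l57 by (simp add: field_simps)
    then have "norm l ^ n * (1 / (1 - norm l)) \<le> norm l ^ n * (7 / 2)" by (intro mult_left_mono) auto
    then show ?thesis by (simp add: mult.commute)
  qed
  have "emeasure (nu l) (cball (pseries \<omega> l) (norm l ^ n))
      = emeasure sign_space {\<tau>. pseries \<tau> l \<in> cball (pseries \<omega> l) (norm l ^ n)}"
    by (rule emeasure_nu) simp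
  also have "\<dots> \<le> emeasure sign_space (\<Union>v\<in>?V. cylinder v)"
  proof (rule emeasure_mono_AE)
    show "AE \<tau> in sign_space. \<tau> \<in> {\<tau>. pseries \<tau> l \<in> cball (pseries \<omega> l) (norm l ^ n)} \<longrightarrow> \<tau> \<in> (\<Union>v\<in>?V. cylinder v)"
      using AE_sign_space
    proof eventually_elim
      case (elim \<tau>)
      then have \<tau>: "\<tau> k \<in> {-1, 1}" for k by blast
      show ?case
      proof
        assume "\<tau> \<in> {\<tau>. pseries \<tau> l \<in> cball (pseries \<omega> l) (norm l ^ n)}"
        then have d: "norm (pseries \<omega> l - pseries \<tau> l) \<le> norm l ^ n" by (simp add: dist_norm)
        let ?v = "map \<tau> [0..<n]"
        have "norm (pseries \<omega> l - word_poly l ?u) \<le> norm l ^ n / (1 - norm l)"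
          by (rule dist_pseries_word_poly[OF l1 sign_abs_le]) (rule \<omega>)
        moreover have "norm (pseries \<tau> l - word_poly l ?v) \<le> norm l ^ n / (1 - norm l)"
          by (rule dist_pseries_word_poly[OF l1 sign_abs_le]) (rule \<tau>)
        moreover have "word_poly l ?u - word_poly l ?v
            = (pseries \<omega> l - pseries \<tau> l) - (pseries \<omega> l - word_poly l ?u) + (pseries \<tau> l - word_poly l ?v)"
          by simp
        then have "norm (word_poly l ?u - word_poly l ?v)
            \<le> norm (pseries \<omega> l - pseries \<tau> l) + norm (pseries \<omega> l - word_poly l ?u) + norm (pseries \<tau> l - word_poly l ?v)"
          by (metis add_right_mono norm_triangle_ineq norm_triangle_ineq4 order_trans)
        ultimately have "norm (word_poly l ?u - word_poly l ?v) \<le> 8 * norm l ^ n"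
          using d tail by linarith
        then have "?v \<in> ?V"
          using map_mem_words[of \<omega> n, OF \<omega>] map_mem_words[of \<tau> n, OF \<tau>] by (simp add: close_pairs_def)
        moreover have "\<tau> \<in> cylinder ?v" by (simp add: cylinder_def)
        ultimately show "\<tau> \<in> (\<Union>v\<in>?V. cylinder v)" by blast
      qed
    qed
    show "(\<Union>v\<in>?V. cylinder v) \<in> sets sign_space" using fV by (intro sets.finite_UN) auto
  qed
  also have "\<dots> \<le> (\<Sum>v\<in>?V. emeasure sign_space (cylinder v))"
    using fV by (intro emeasure_subadditive_finite) auto
  also have "\<dots> = (\<Sum>v\<in>?V. ennreal ((1/2) ^ n))"
    using VW by (intro sum.cong refl) (auto intro: emeasure_cylinder simp del: power_one_over)
  also have "\<dots> = close_count l n \<omega> * ennreal ((1/2) ^ n)"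
    unfolding close_count_eq[OF \<omega>] by (simp only: sum_constant)
  finally show ?thesis .
qed

text \<open>Fatou's lemma makes the lower limit of \<open>close_count\<close> finite almost surely,
  so almost every sequence whose sum is in \<open>B\<close> belongs to some \<open>H m\<close>. The
  sums of \<open>H m\<close> form a packing-null set on which balls have controlled mass along
  infinitely many radii, hence they have Borel covers of arbitrarily small mass.\<close>

lemma nu_null_if_packing_null:
  assumes l0: "l \<noteq> 0" and l: "norm l < 1 / sqrt 2" and few: "few_close_pairs l" and B: "B \<in> sets borel"
    and null: "packing_measure (s_dim l) (A_set l \<inter> B) = 0"
  shows "emeasure (nu l) B = 0"
proof -
  have "1 / sqrt 2 < (1 :: real)" by simp
  then have l1: "norm l < 1" using l by linarith
  have ln: "0 < norm l" using l0 by simp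
  obtain K where K: "\<And>n. real (card (close_pairs n l)) \<le> K * 2 ^ n"
    using few by (auto simp: few_close_pairs_def)
  have int: "(\<integral>\<^sup>+\<omega>. close_count l n \<omega> \<partial>sign_space) \<le> ennreal K" for n
    unfolding nn_integral_close_count using K[of n] by (intro ennreal_leI) (simp add: pos_divide_le_eq)
  have "(\<integral>\<^sup>+\<omega>. liminf (\<lambda>n. close_count l n \<omega>) \<partial>sign_space) \<le> liminf (\<lambda>n. \<integral>\<^sup>+\<omega>. close_count l n \<omega> \<partial>sign_space)"
    by (rule nn_integral_liminf) measurable
  also have "\<dots> \<le> liminf (\<lambda>n. ennreal K)" by (rule Liminf_mono) (simp add: int)
  also have "\<dots> = ennreal K" by (rule Liminf_const) simp
  finally have "(\<integral>\<^sup>+\<omega>. liminf (\<lambda>n. close_count l n \<omega>) \<partial>sign_space) \<noteq> \<infinity>"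
    by (auto simp: top_unique)
  then have fin: "AE \<omega> in sign_space. liminf (\<lambda>n. close_count l n \<omega>) \<noteq> \<infinity>"
    by (intro nn_integral_PInf_AE) measurable
  define H where "H m = {\<omega> \<in> space sign_space. pseries \<omega> l \<in> B \<and> (\<forall>k. \<omega> k \<in> {-1, 1}) \<and>
      (\<forall>N. \<exists>n\<ge>N. close_count l n \<omega> \<le> of_nat m)}" for m :: nat
  have Hm: "H m \<in> sets sign_space" for m
  proof -
    have [measurable]: "Measurable.pred sign_space (\<lambda>\<omega>. pseries \<omega> l \<in> B)"
      using B by measurable
    show ?thesis unfolding H_def by measurable
  qed
  have Hnull: "emeasure sign_space (H m) = 0" for m
  proof -
    define F where "F = (\<lambda>\<omega>. pseries \<omega> l) ` H m"
    have "F \<subseteq> A_set l \<inter> B" by (auto simp: F_def H_def A_set_alt)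
    then have F0: "packing_measure (s_dim l) F = 0"
      using packing_measure_mono[of F "A_set l \<inter> B" "s_dim l"] null by simp
    \<comment> \<open>\<open>(5 / 2) powr s_dim l\<close> converts \<open>norm l ^ n = 5 * r\<close>
      into \<open>2 * r\<close>; \<open>m + 1\<close> instead of \<open>m\<close> keeps the constant
      positive for \<open>m = 0\<close>.\<close>
    define K' where "K' = (real m + 1) * (5 / 2) powr s_dim l"
    have K': "0 < K'" by (simp add: K'_def add_nonneg_pos)
    have reg: "\<exists>r. 0 < r \<and> r \<le> \<delta> \<and> emeasure (nu l) (cball x (5 * r)) \<le> ennreal (K' * (2 * r) powr s_dim l)"
      if x: "x \<in> F" and \<delta>: "0 < \<delta>" for x \<delta>
    proof -
      obtain \<omega> where \<omega>: "x = pseries \<omega> l" "\<And>k. \<omega> k \<in> {-1, 1}" "\<And>N. \<exists>n\<ge>N. close_count l n \<omega> \<le> of_nat m"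
        using x by (auto simp: F_def H_def)
      have "(\<lambda>n. norm l ^ n) \<longlonglongrightarrow> 0" using l1 by (intro LIMSEQ_realpow_zero) auto
      then have "eventually (\<lambda>n. norm l ^ n < 5 * \<delta>) sequentially"
        using \<delta> by (intro order_tendstoD(2)) auto
      then obtain N where N: "\<And>n. n \<ge> N \<Longrightarrow> norm l ^ n < 5 * \<delta>" by (auto simp: eventually_sequentially)
      obtain n where n: "n \<ge> N" "close_count l n \<omega> \<le> of_nat m" using \<omega>(3) by blast
      define r where "r = norm l ^ n / 5"
      have r: "0 < r" "r \<le> \<delta>" "5 * r = norm l ^ n" using N[OF n(1)] ln by (auto simp: r_def)
      have "emeasure (nu l) (cball x (5 * r)) \<le> close_count l n \<omega> * ennreal ((1/2) ^ n)"
        unfolding r(3) \<omega>(1) by (rule nu_cball_le[OF l \<omega>(2)])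
      also have "\<dots> \<le> of_nat m * ennreal ((1/2) ^ n)" by (rule mult_right_mono[OF n(2)]) simp
      also have "\<dots> = ennreal (real m * (1/2) ^ n)"
        unfolding ennreal_of_nat_eq_real_of_nat by (rule ennreal_mult[symmetric]) auto
      also have "\<dots> \<le> ennreal (K' * (2 * r) powr s_dim l)"
      proof (rule ennreal_leI)
        have "(1/2) ^ n = ((5 / 2) * (2 * r)) powr s_dim l"
          using norm_powr_s_dim[OF ln l1, of n] r(3) by simp
        also have "\<dots> = (5 / 2) powr s_dim l * (2 * r) powr s_dim l"
          by (rule powr_mult)
        finally have "(1/2) ^ n = (5 / 2) powr s_dim l * (2 * r) powr s_dim l" .
        then have "real m * (1/2) ^ n = real m * ((5 / 2) powr s_dim l * (2 * r) powr s_dim l)" by simp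
        also have "\<dots> \<le> (real m + 1) * ((5 / 2) powr s_dim l * (2 * r) powr s_dim l)"
          by (intro mult_right_mono) auto
        finally show "real m * (1/2) ^ n \<le> K' * (2 * r) powr s_dim l" by (simp add: K'_def mult.assoc)
      qed
      finally show ?thesis using r by blast
    qed
    have "emeasure sign_space (H m) \<le> 0 + ennreal e" if e: "0 < e" for e :: real
    proof -
      obtain V where V: "V \<in> sets borel" "F \<subseteq> V" "emeasure (nu l) V \<le> ennreal e"
        using packing_measure_null_cover[OF sets_nu K' reg F0 e] by auto
      have "emeasure sign_space (H m) \<le> emeasure sign_space {\<omega>. pseries \<omega> l \<in> V}"
      proof (rule emeasure_mono)
        show "H m \<subseteq> {\<omega>. pseries \<omega> l \<in> V}" using V(2) by (auto simp: F_def)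
        show "{\<omega>. pseries \<omega> l \<in> V} \<in> sets sign_space"
          using measurable_sets[OF measurable_pseries V(1), of l] by (simp add: vimage_def)
      qed
      also have "\<dots> = emeasure (nu l) V" by (rule emeasure_nu[OF V(1), symmetric])
      finally show ?thesis using V(3) by simp
    qed
    then have "emeasure sign_space (H m) \<le> 0" by (rule ennreal_le_epsilon)
    then show ?thesis by simp
  qed
  have "AE \<omega> in sign_space. \<forall>m. \<omega> \<notin> H m"
    unfolding AE_all_countable using Hm Hnull by (auto intro!: AE_not_in simp: null_sets_def)
  then have "AE \<omega> in sign_space. pseries \<omega> l \<notin> B"
    using fin AE_sign_space
  proof eventually_elim
    case (elim \<omega>)
    show ?case
    proof
      assume B: "pseries \<omega> l \<in> B"
      obtain m :: nat where m: "liminf (\<lambda>n. close_count l n \<omega>) < of_nat m"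
        using elim(2) ennreal_Ex_less_of_nat[of "liminf (\<lambda>n. close_count l n \<omega>)"] by (auto simp: less_top)
      have "\<exists>n\<ge>N. close_count l n \<omega> \<le> of_nat m" for N
      proof (rule ccontr)
        assume "\<not> ?thesis"
        then have "\<forall>n\<ge>N. of_nat m < close_count l n \<omega>" by (meson linorder_not_le)
        then have "of_nat m \<le> close_count l n \<omega>" if "n \<ge> N" for n using that by (simp add: less_imp_le)
        then have "of_nat m \<le> liminf (\<lambda>n. close_count l n \<omega>)"
          by (intro Liminf_bounded) (auto simp: eventually_sequentially)
        then show False using m by simp
      qed
      then have "\<omega> \<in> H m" using B elim by (auto simp: H_def)
      then show False using elim by blast
    qed
  qed
  then have "emeasure sign_space {\<omega> \<in> space sign_space. pseries \<omega> l \<in> B} = 0"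
    by (subst (asm) AE_iff_measurable[OF _ refl])
       (use measurable_sets[OF measurable_pseries B, of l] in \<open>auto simp: vimage_def\<close>)
  then show ?thesis by (simp add: emeasure_nu[OF B])
qed


subsection \<open>Nearby words and Hausdorff measure\<close>

text \<open>The identity is a limit of nontrivial compositions of an inverse cylinder map with
  another: for words of equal length \<open>n\<close> such a composition is the translation by
  \<open>(word_poly l v - word_poly l u) / l ^ n\<close>. This is the Bandt-Graf criterion for
  vanishing Hausdorff measure in the similarity dimension.\<close>

definition has_near_pairs :: "complex \<Rightarrow> bool" where
  "has_near_pairs l \<longleftrightarrow> (\<forall>\<epsilon>>0. \<exists>n. \<exists>u\<in>words n. \<exists>v\<in>words n. u \<noteq> v \<and>
      norm (word_poly l u - word_poly l v) < \<epsilon> * norm l ^ n)"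

lemma append_words: "u \<in> words n \<Longrightarrow> w \<in> words m \<Longrightarrow> u @ w \<in> words (n + m)"
  by (simp add: words_def)

text \<open>Prefixing a family with both words of a near pair doubles it.\<close>

lemma near_words_family:
  assumes l: "l \<noteq> 0" and np: "has_near_pairs l" and \<eta>: "0 < \<eta>"
  shows "\<exists>L G. G \<subseteq> words L \<and> card G = 2 ^ m \<and>
    (\<forall>u\<in>G. \<forall>v\<in>G. norm (word_poly l u - word_poly l v) \<le> \<eta> * norm l ^ L)"
  using \<eta>
proof (induction m arbitrary: \<eta>)
  case 0
  show ?case using 0 by (intro exI[of _ 0] exI[of _ "{[]}"]) (auto simp: words_def)
next
  case (Suc m)
  obtain L G where G: "G \<subseteq> words L" "card G = 2 ^ m"
      "\<And>u v. u \<in> G \<Longrightarrow> v \<in> G \<Longrightarrow> norm (word_poly l u - word_poly l v) \<le> \<eta> / 2 * norm l ^ L"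
    using Suc.IH[of "\<eta> / 2"] Suc.prems by auto
  have "0 < \<eta> / 2 * norm l ^ L" using Suc.prems l by simp
  \<comment> \<open>The prefixes are taken close relative to the scale \<open>norm l ^ L\<close> of
    the old family; they use up half of the tolerance, and the differences inside \<open>G\<close>,
    scaled by \<open>norm l ^ n\<close>, the other half.\<close>
  then obtain n u v where uv: "u \<in> words n" "v \<in> words n" "u \<noteq> v"
      "norm (word_poly l u - word_poly l v) < \<eta> / 2 * norm l ^ L * norm l ^ n"
    using np unfolding has_near_pairs_def by blast
  have len: "length u = n" "length v = n" using uv by (auto simp: words_def)
  define G' where "G' = (\<lambda>w. u @ w) ` G \<union> (\<lambda>w. v @ w) ` G"
  have finG: "finite G" by (rule finite_subset[OF G(1) finite_words])
  have "G' \<subseteq> words (n + L)" using uv by (auto simp: G'_def intro!: append_words subsetD[OF G(1)])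
  moreover have "card G' = 2 ^ Suc m"
  proof -
    have "(\<lambda>w. u @ w) ` G \<inter> (\<lambda>w. v @ w) ` G = {}" using uv(3) len by auto
    then have "card G' = card ((\<lambda>w. u @ w) ` G) + card ((\<lambda>w. v @ w) ` G)"
      unfolding G'_def using finG by (intro card_Un_disjoint) auto
    also have "\<dots> = 2 ^ m + 2 ^ m" using G(2) by (simp add: card_image inj_on_def)
    finally show ?thesis by simp
  qed
  moreover have "norm (word_poly l p - word_poly l p') \<le> \<eta> * norm l ^ (n + L)" if p: "p \<in> G'" "p' \<in> G'" for p p'
  proof -
    obtain x w x' w' where x: "p = x @ w" "x \<in> {u, v}" "w \<in> G" "p' = x' @ w'" "x' \<in> {u, v}" "w' \<in> G"
      using p unfolding G'_def by blast
    have lx: "length x = n" "length x' = n" using x len by auto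
    have "norm (word_poly l x - word_poly l x') \<le> \<eta> / 2 * norm l ^ L * norm l ^ n"
      using x uv(4) Suc.prems by (auto simp: norm_minus_commute intro: less_imp_le)
    moreover have "norm (l ^ n * (word_poly l w - word_poly l w')) \<le> norm l ^ n * (\<eta> / 2 * norm l ^ L)"
      unfolding norm_mult norm_power using x G(3) by (intro mult_left_mono) auto
    moreover have "word_poly l p - word_poly l p' = (word_poly l x - word_poly l x') + l ^ n * (word_poly l w - word_poly l w')"
      using x lx by (simp add: word_poly_append right_diff_distrib)
    ultimately have "norm (word_poly l p - word_poly l p') \<le> \<eta> / 2 * norm l ^ L * norm l ^ n + norm l ^ n * (\<eta> / 2 * norm l ^ L)"
      using norm_triangle_ineq[of "word_poly l x - word_poly l x'" "l ^ n * (word_poly l w - word_poly l w')"]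
      by (simp only:)
    also have "\<dots> = \<eta> * norm l ^ (n + L)" by (simp add: power_add mult_ac)
    finally show ?thesis .
  qed
  ultimately show ?case by blast
qed

lemma A_set_bounded:
  assumes "norm l < 1" "z \<in> A_set l" "z' \<in> A_set l"
  shows "norm (z - z') \<le> 2 / (1 - norm l)"
proof -
  have b: "norm x \<le> 1 / (1 - norm l)" if xA: "x \<in> A_set l" for x
  proof -
    obtain a where a: "x = pseries a l" "\<And>n. a n \<in> {-1, 1}" using xA by (auto simp: A_set_alt)
    show ?thesis unfolding a(1) by (rule norm_pseries_le[OF assms(1)]) (rule sign_abs_le[of a, OF a(2)])
  qed
  show ?thesis using b[OF assms(2)] b[OF assms(3)] norm_triangle_ineq4[of z z'] by simp
qed

lemma A_set_subset_cylinders: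
  assumes "norm l < 1"
  shows "A_set l \<subseteq> (\<Union>w\<in>words n. (\<lambda>z. word_poly l w + l ^ n * z) ` A_set l)"
proof
  fix x assume "x \<in> A_set l"
  then obtain a where a: "x = pseries a l" "\<And>n. a n \<in> {-1, 1}" by (auto simp: A_set_alt)
  have "x = word_poly l (map a [0..<n]) + l ^ n * pseries (\<lambda>k. a (n + k)) l"
    unfolding a(1) by (rule pseries_split[OF assms]) (rule sign_abs_le[of a, OF a(2)])
  moreover have "pseries (\<lambda>k. a (n + k)) l \<in> A_set l" using a(2) by (auto simp: A_set_alt)
  moreover have "map a [0..<n] \<in> words n" by (rule map_mem_words[of a, OF a(2)])
  ultimately show "x \<in> (\<Union>w\<in>words n. (\<lambda>z. word_poly l w + l ^ n * z) ` A_set l)" by blast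
qed

text \<open>If \<open>2 ^ m\<close> cylinders of level \<open>L\<close> lie in one set of comparable diameter, replacing them by
  that set in the natural cover gives \<open>h \<le> (1 - 2 ^ m / 2 ^ L) h + c / 2 ^ L\<close>, i.e.
  \<open>h \<le> c / 2 ^ m\<close>, for the Hausdorff content \<open>h\<close>.\<close>
lemma hausdorff_A_set_null:
  assumes l0: "l \<noteq> 0" and l1: "norm l < 1" and np: "has_near_pairs l"
  shows "hausdorff_measure (s_dim l) (A_set l) = 0"
proof -
  have ln: "0 < norm l" using l0 by simp
  define s where "s = s_dim l"
  have s: "0 < s" unfolding s_def by (rule s_dim_pos[OF ln l1])
  have ls: "(norm l ^ n) powr s = (1/2) ^ n" for n unfolding s_def by (rule norm_powr_s_dim[OF ln l1])
  define D where "D = 2 / (1 - norm l)"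
  have D: "0 < D" using l1 by (simp add: D_def)
  \<comment> \<open>Large enough for the whole attractor and for the merged cylinders
    \<open>V\<close> to be admissible covering sets by themselves.\<close>
  define \<delta> where "\<delta> = 1 + D"
  have \<delta>: "0 < \<delta>" using D by (simp add: \<delta>_def)
  define h where "h = hausdorff_pre s \<delta> (A_set l)"
  have bA: "bounded (A_set l)"
    unfolding bounded_two_points using A_set_bounded[OF l1] by (auto simp: dist_norm)
  have dA: "diameter (A_set l) \<le> \<delta>"
  proof (rule diameter_le)
    fix z z' assume "z \<in> A_set l" "z' \<in> A_set l"
    then have "norm (z - z') \<le> D" unfolding D_def by (rule A_set_bounded[OF l1])
    then show "norm (z - z') \<le> \<delta>" by (simp add: \<delta>_def)
  qed (use \<delta> in auto)
  have "h \<le> diam_pow (A_set l) s" unfolding h_def using bA dA \<delta> by (intro hausdorff_pre_single) auto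
  also have "\<dots> \<le> ennreal (\<delta> powr s)" using dA \<delta> s bA by (intro diam_pow_le) auto
  finally have hfin: "h < top" by (rule le_less_trans) simp
  have cyl: "hausdorff_pre s \<delta>' ((\<lambda>z. word_poly l w + l ^ n * z) ` A_set l) \<le> ennreal ((1/2) ^ n) * h"
    if "norm l ^ n * \<delta> \<le> \<delta>'" for w n \<delta>'
    using hausdorff_pre_affine[of "l ^ n" s \<delta> \<delta>' "word_poly l w" "A_set l"] l0 s that
    by (simp add: norm_power ls h_def)
  define c where "c = (1 + D) powr s"
  obtain x where x: "0 \<le> x" "h = ennreal x" using hfin by (cases h) auto
  have main: "2 ^ m * x \<le> c" for m
  proof -
    obtain L G where G: "G \<subseteq> words L" "card G = 2 ^ m"
        "\<And>u v. u \<in> G \<Longrightarrow> v \<in> G \<Longrightarrow> norm (word_poly l u - word_poly l v) \<le> 1 * norm l ^ L"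
      using near_words_family[OF l0 np zero_less_one, of m] by auto
    define f where "f w = (\<lambda>z. word_poly l w + l ^ L * z) ` A_set l" for w
    define V where "V = (\<Union>w\<in>G. f w)"
    have Vd: "norm (y - y') \<le> (1 + D) * norm l ^ L" if yV: "y \<in> V" "y' \<in> V" for y y'
    proof -
      obtain w z w' z' where w: "w \<in> G" "z \<in> A_set l" "y = word_poly l w + l ^ L * z"
          "w' \<in> G" "z' \<in> A_set l" "y' = word_poly l w' + l ^ L * z'"
        using yV unfolding V_def f_def by blast
      have "y - y' = (word_poly l w - word_poly l w') + l ^ L * (z - z')"
        using w by (simp add: algebra_simps)
      then have "norm (y - y') \<le> norm (word_poly l w - word_poly l w') + norm l ^ L * norm (z - z')"
        using norm_triangle_ineq[of "word_poly l w - word_poly l w'" "l ^ L * (z - z')"]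
        by (simp add: norm_mult norm_power)
      also have "\<dots> \<le> 1 * norm l ^ L + norm l ^ L * D"
        using G(3)[OF w(1,4)] A_set_bounded[OF l1 w(2,5)] unfolding D_def by (intro add_mono mult_left_mono) auto
      finally show ?thesis by (simp add: algebra_simps)
    qed
    have lL: "norm l ^ L \<le> 1" using l1 by (simp add: power_le_one)
    have bV: "bounded V" unfolding bounded_two_points using Vd by (auto simp: dist_norm)
    have dV: "diameter V \<le> (1 + D) * norm l ^ L" using Vd D by (intro diameter_le) auto
    have dV': "(1 + D) * norm l ^ L \<le> \<delta>" using lL D mult_left_mono[OF lL, of "1 + D"] by (simp add: \<delta>_def)
    have "hausdorff_pre s \<delta> V \<le> diam_pow V s"
      using bV dV dV' \<delta> by (intro hausdorff_pre_single) auto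
    also have "\<dots> \<le> ennreal (((1 + D) * norm l ^ L) powr s)"
      using dV D s bV by (intro diam_pow_le) auto
    also have "((1 + D) * norm l ^ L) powr s = c * (1/2) ^ L"
      by (simp only: powr_mult ls c_def)
    finally have hV: "hausdorff_pre s \<delta> V \<le> ennreal (c * (1/2) ^ L)" .
    have "norm l ^ L * \<delta> \<le> \<delta>" using lL \<delta> by (simp add: mult_left_le_one_le)
    note cylL = cyl[OF this]
    have fin: "finite (words L - G)" by simp
    have "A_set l \<subseteq> (\<Union>w\<in>words L - G. f w) \<union> V"
    proof
      fix y assume "y \<in> A_set l"
      then have "y \<in> (\<Union>w\<in>words L. f w)" using A_set_subset_cylinders[OF l1, of L] unfolding f_def by (rule rev_subsetD)
      then show "y \<in> (\<Union>w\<in>words L - G. f w) \<union> V" by (auto simp: V_def)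
    qed
    then have "h \<le> hausdorff_pre s \<delta> ((\<Union>w\<in>words L - G. f w) \<union> V)" unfolding h_def by (rule hausdorff_pre_mono)
    also have "\<dots> \<le> hausdorff_pre s \<delta> (\<Union>w\<in>words L - G. f w) + hausdorff_pre s \<delta> V"
      using \<delta> by (intro hausdorff_pre_Un) auto
    also have "\<dots> \<le> (\<Sum>w\<in>words L - G. ennreal ((1/2) ^ L) * h) + ennreal (c * (1/2) ^ L)"
    proof (rule add_mono[OF _ hV])
      have "hausdorff_pre s \<delta> (\<Union>w\<in>words L - G. f w) \<le> (\<Sum>w\<in>words L - G. hausdorff_pre s \<delta> (f w))"
        using \<delta> by (intro hausdorff_pre_finite_UN) auto
      also have "\<dots> \<le> (\<Sum>w\<in>words L - G. ennreal ((1/2) ^ L) * h)"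
        unfolding f_def by (intro sum_mono cylL)
      finally show "hausdorff_pre s \<delta> (\<Union>w\<in>words L - G. f w) \<le> (\<Sum>w\<in>words L - G. ennreal ((1/2) ^ L) * h)" .
    qed
    also have "(\<Sum>w\<in>words L - G. ennreal ((1/2) ^ L) * h) = ennreal (real (card (words L - G)) * ((1/2) ^ L * x))"
      unfolding x(2) sum_constant ennreal_of_nat_eq_real_of_nat using x(1)
      by (subst ennreal_mult[symmetric], simp, simp)+ simp
    also have "\<dots> + ennreal (c * (1/2) ^ L) = ennreal (real (card (words L - G)) * ((1/2) ^ L * x) + c * (1/2) ^ L)"
      using x(1) by (intro ennreal_plus[symmetric]) (auto simp: c_def)
    finally have "x \<le> real (card (words L - G)) * ((1/2) ^ L * x) + c * (1/2) ^ L"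
      unfolding x(2) using x(1) by (subst (asm) ennreal_le_iff) (auto simp: c_def)
    moreover have cd: "real (card (words L - G)) = 2 ^ L - 2 ^ m"
    proof -
      have "card (words L - G) = 2 ^ L - 2 ^ m"
        using G(1,2) by (subst card_Diff_subset) (auto simp: card_words intro: finite_subset)
      moreover have "(2 :: nat) ^ m \<le> 2 ^ L" using card_mono[OF finite_words G(1)] G(2) card_words by simp
      ultimately show ?thesis by (simp add: of_nat_diff)
    qed
    ultimately have "x \<le> (2 ^ L - 2 ^ m) * ((1/2) ^ L * x) + c * (1/2) ^ L" by simp
    then have "2 ^ L * x \<le> 2 ^ L * ((2 ^ L - 2 ^ m) * ((1/2) ^ L * x) + c * (1/2) ^ L)"
      by (intro mult_left_mono) auto
    also have "\<dots> = (2 ^ L * (1/2) ^ L) * ((2 ^ L - 2 ^ m) * x + c)" by (simp add: algebra_simps)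
    also have "2 ^ L * (1/2) ^ L = (1 :: real)" by (simp flip: power_mult_distrib)
    finally show ?thesis by (simp add: algebra_simps)
  qed
  have "x = 0"
  proof (rule ccontr)
    assume "x \<noteq> 0"
    then have x0: "0 < x" using x(1) by simp
    obtain m :: nat where "c / x < 2 ^ m" using real_arch_pow[of 2 "c / x"] by auto
    then show False using main[of m] x0 by (simp add: divide_less_eq)
  qed
  then have h0: "h = 0" using x(2) by simp
  \<comment> \<open>Self-similarity carries the vanishing content to every smaller scale: cylinders
    of a high level are scaled copies of the attractor with content 0.\<close>
  have "hausdorff_pre s \<delta>' (A_set l) = 0" if \<delta>': "0 < \<delta>'" for \<delta>'
  proof -
    have "(\<lambda>n. norm l ^ n * \<delta>) \<longlonglongrightarrow> 0 * \<delta>"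
      using l1 by (intro tendsto_mult_right LIMSEQ_realpow_zero) auto
    then have "eventually (\<lambda>n. norm l ^ n * \<delta> < \<delta>') sequentially"
      using \<delta>' by (intro order_tendstoD(2)) auto
    then obtain n where n: "norm l ^ n * \<delta> \<le> \<delta>'" by (auto simp: eventually_sequentially intro: less_imp_le)
    have "hausdorff_pre s \<delta>' (A_set l) \<le> hausdorff_pre s \<delta>' (\<Union>w\<in>words n. (\<lambda>z. word_poly l w + l ^ n * z) ` A_set l)"
      by (rule hausdorff_pre_mono[OF A_set_subset_cylinders[OF l1]])
    also have "\<dots> \<le> (\<Sum>w\<in>words n. hausdorff_pre s \<delta>' ((\<lambda>z. word_poly l w + l ^ n * z) ` A_set l))"
      using \<delta>' by (intro hausdorff_pre_finite_UN) auto
    also have "\<dots> \<le> (\<Sum>w\<in>words n. ennreal ((1/2) ^ n) * h)"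
      by (intro sum_mono cyl n)
    finally show ?thesis by (simp add: h0)
  qed
  then show ?thesis unfolding hausdorff_null_iff s_def by blast
qed


text \<open>Lebesgue density in the form needed here: in a Vitali cover of \<open>S\<close> by balls with holes, the holes
  carry a fixed proportion of the measure of \<open>S\<close> in every open neighbourhood of \<open>S\<close>.\<close>
lemma porous_negligible:
  fixes S :: "complex set"
  assumes S: "S \<in> sets borel" "bounded S" and q: "0 < q"
    and porous: "\<And>x d. x \<in> S \<Longrightarrow> 0 < d \<Longrightarrow>
      \<exists>\<rho> y. 0 < \<rho> \<and> \<rho> < d \<and> cball y (q * \<rho>) \<subseteq> cball x \<rho> \<and> cball y (q * \<rho>) \<inter> S = {}"
  shows "negligible S"
proof (rule ccontr)
  assume non: "\<not> negligible S"
  have Sl: "S \<in> sets lebesgue" using S(1) by simp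
  have "emeasure lborel S < \<infinity>" by (rule emeasure_bounded_finite[OF S(2)])
  then have Sfin: "emeasure lebesgue S < \<infinity>" using S(1) by simp
  have Sm: "S \<in> lmeasurable" using Sl Sfin by (rule fmeasurableI)
  define m where "m = measure lebesgue S"
  have mS: "emeasure lebesgue S = ennreal m" using Sm by (simp add: m_def emeasure_eq_measure2)
  have m: "0 < m" using non Sm by (simp add: m_def negligible_iff_measure0 zero_less_measure_iff)
  \<comment> \<open>The holes fill the fraction \<open>q ^ 2\<close> of disjoint balls inside
    \<open>U\<close> that cover almost all of \<open>S\<close>. They thus have area at least
    \<open>q ^ 2 * m\<close> in \<open>U - S\<close>, which this choice of \<open>U\<close>
    forbids.\<close>
  obtain U where U: "open U" "S \<subseteq> U" "U - S \<in> lmeasurable" "emeasure lebesgue (U - S) < ennreal (q\<^sup>2 * m)"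
    using sets_lebesgue_outer_open[OF Sl, of "q\<^sup>2 * m"] q m by auto
  \<comment> \<open>A centre has many admissible balls, so the Vitali family is indexed by centre,
    radius and centre of the hole.\<close>
  define K where "K = {(x, \<rho>, y). x \<in> S \<and> 0 < \<rho> \<and> cball x \<rho> \<subseteq> U \<and>
      cball y (q * \<rho>) \<subseteq> cball x \<rho> \<and> cball y (q * \<rho>) \<inter> S = {}}"
  define a :: "complex \<times> real \<times> complex \<Rightarrow> complex" where "a = fst"
  define r :: "complex \<times> real \<times> complex \<Rightarrow> real" where "r = fst \<circ> snd"
  define b :: "complex \<times> real \<times> complex \<Rightarrow> complex" where "b = snd \<circ> snd"
  have K: "0 < r i" "cball (a i) (r i) \<subseteq> U" "cball (b i) (q * r i) \<subseteq> cball (a i) (r i)" "cball (b i) (q * r i) \<inter> S = {}"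
    if "i \<in> K" for i using that by (auto simp: K_def a_def b_def r_def)
  have fine: "\<exists>i. i \<in> K \<and> x \<in> cball (a i) (r i) \<and> r i < d" if x: "x \<in> S" and d: "0 < d" for x d
  proof -
    obtain e where e: "0 < e" "cball x e \<subseteq> U" using U(1,2) x open_contains_cball by blast
    obtain \<rho> y where \<rho>: "0 < \<rho>" "\<rho> < min d e" "cball y (q * \<rho>) \<subseteq> cball x \<rho>" "cball y (q * \<rho>) \<inter> S = {}"
      using porous[OF x, of "min d e"] d e by auto
    have "cball x \<rho> \<subseteq> cball x e" using \<rho>(2) by auto
    then have "(x, \<rho>, y) \<in> K" using x \<rho> e by (auto simp: K_def)
    then show ?thesis using \<rho> by (intro exI[of _ "(x, \<rho>, y)"]) (auto simp: a_def r_def)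
  qed
  obtain C where C: "countable C" "C \<subseteq> K"
      "pairwise (\<lambda>i j. disjnt (cball (a i) (r i)) (cball (a j) (r j))) C"
      "negligible (S - (\<Union>i\<in>C. cball (a i) (r i)))"
    by (rule Vitali_covering_theorem_cballs[of K r S a]) (use K(1) fine in auto)
  have disjB: "disjoint_family_on (\<lambda>i. cball (a i) (r i)) C"
    using C(3) by (auto simp: disjoint_family_on_def pairwise_def disjnt_def)
  have disjH: "disjoint_family_on (\<lambda>i. cball (b i) (q * r i)) C"
    unfolding disjoint_family_on_def
  proof (intro ballI impI)
    fix i j assume ij: "i \<in> C" "j \<in> C" "i \<noteq> j"
    then have "cball (a i) (r i) \<inter> cball (a j) (r j) = {}" using disjB by (auto simp: disjoint_family_on_def)
    moreover have "i \<in> K" "j \<in> K" using ij C(2) by auto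
    ultimately show "cball (b i) (q * r i) \<inter> cball (b j) (q * r j) = {}" using K(3)[of i] K(3)[of j] by blast
  qed
  let ?B = "\<Union>i\<in>C. cball (a i) (r i)" and ?H = "\<Union>i\<in>C. cball (b i) (q * r i)"
  have Bs: "?B \<in> sets borel" "?H \<in> sets borel" using C(1) by (auto intro!: sets.countable_UN')
  have "ennreal m = emeasure lebesgue S" by (simp add: mS)
  also have "\<dots> \<le> emeasure lebesgue (?B \<union> (S - ?B))"
    using Bs S by (intro emeasure_mono) auto
  also have "\<dots> \<le> emeasure lebesgue ?B + emeasure lebesgue (S - ?B)"
    using Bs S by (intro emeasure_subadditive) auto
  also have "emeasure lebesgue (S - ?B) = 0"
    using C(4) by (auto simp: negligible_iff_null_sets)
  finally have mB: "ennreal m \<le> emeasure lborel ?B" using Bs by simp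
  have "emeasure lborel ?H = (\<integral>\<^sup>+i. emeasure lborel (cball (b i) (q * r i)) \<partial>count_space C)"
    using C(1) disjH by (intro emeasure_UN_countable) auto
  also have "\<dots> = (\<integral>\<^sup>+i. ennreal (q\<^sup>2) * emeasure lborel (cball (a i) (r i)) \<partial>count_space C)"
  proof (rule nn_integral_cong)
    fix i assume "i \<in> space (count_space C)"
    then have "i \<in> K" using C(2) by auto
    then have "0 < r i" by (rule K(1))
    then show "emeasure lborel (cball (b i) (q * r i)) = ennreal (q\<^sup>2) * emeasure lborel (cball (a i) (r i))"
      using q by (simp add: emeasure_cball unit_ball_vol_2 ennreal_mult[symmetric] power_mult_distrib mult_ac)
  qed
  also have "\<dots> = ennreal (q\<^sup>2) * (\<integral>\<^sup>+i. emeasure lborel (cball (a i) (r i)) \<partial>count_space C)"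
    by (rule nn_integral_cmult) simp
  also have "(\<integral>\<^sup>+i. emeasure lborel (cball (a i) (r i)) \<partial>count_space C) = emeasure lborel ?B"
    using C(1) disjB by (intro emeasure_UN_countable[symmetric]) auto
  finally have H: "emeasure lborel ?H = ennreal (q\<^sup>2) * emeasure lborel ?B" .
  have "ennreal (q\<^sup>2 * m) = ennreal (q\<^sup>2) * ennreal m" using m by (simp add: ennreal_mult)
  also have "\<dots> \<le> ennreal (q\<^sup>2) * emeasure lborel ?B" by (rule mult_left_mono[OF mB]) simp
  also have "\<dots> = emeasure lebesgue ?H" using H Bs by simp
  also have "\<dots> \<le> emeasure lebesgue (U - S)"
  proof (rule emeasure_mono)
    have "cball (b i) (q * r i) \<subseteq> U - S" if "i \<in> C" for i
    proof -
      have "i \<in> K" using that C(2) by auto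
      then show ?thesis using K[of i] by blast
    qed
    then show "?H \<subseteq> U - S" by blast
    show "U - S \<in> sets lebesgue" using U(3) by auto
  qed
  finally show False using U(4) by simp
qed

subsection \<open>Almost every parameter in \<open>M\<close> has nearby words\<close>

text \<open>Truncations of the series that define \<open>M_set\<close>. For \<open>n = 0\<close> the
  condition on \<open>xs ! 0\<close> is unspecified, so \<open>n > 0\<close> is required wherever it
  matters.\<close>

definition trits :: "nat \<Rightarrow> real list set" where
  "trits n = {xs. set xs \<subseteq> {-1, 0, 1} \<and> length xs = n \<and> xs ! 0 = 1}"

lemma finite_trits: "finite (trits n)"
proof (rule finite_subset)
  show "trits n \<subseteq> {xs. set xs \<subseteq> {-1, 0, 1} \<and> length xs = n}" by (auto simp: trits_def)
  show "finite {xs :: real list. set xs \<subseteq> {-1, 0, 1} \<and> length xs = n}"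
    by (rule finite_lists_length_eq) simp
qed

lemma word_poly_trits_pseries:
  assumes "xs \<in> trits n" "0 < n"
  obtains a where "a 0 = 1" "\<And>k. \<bar>a k\<bar> \<le> 1" "\<And>l. word_poly l xs = pseries a l"
proof -
  define a where "a k = (if k < n then xs ! k else 0)" for k
  have len: "length xs = n" using assms by (simp add: trits_def)
  have "a 0 = 1" using assms by (simp add: a_def trits_def)
  moreover have "\<bar>a k\<bar> \<le> 1" for k
  proof (cases "k < n")
    case True
    then have "xs ! k \<in> set xs" using len by simp
    then have "xs ! k \<in> {-1, 0, 1}" using assms(1) unfolding trits_def by blast
    then show ?thesis by (auto simp: a_def)
  qed (simp add: a_def)
  moreover have "word_poly l xs = pseries a l" for l
    by (subst pseries_finite[of n]) (auto simp: a_def word_poly_conv_sum len)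
  ultimately show thesis using that by blast
qed

text \<open>Each of -1, 0, 1 is half a difference of two signs. The leading 1 makes the two words
  differ in the first letter.\<close>

lemma word_poly_trits_diff:
  assumes "xs \<in> trits n" "0 < n"
  obtains u v where "u \<in> words n" "v \<in> words n" "u \<noteq> v" "\<And>l. word_poly l u - word_poly l v = 2 * word_poly l xs"
proof -
  define f where "f = (\<lambda>x :: real. if x \<ge> 0 then 1 else - 1 :: real)"
  define u where "u = map f xs"
  define v where "v = map (\<lambda>x. f x - 2 * x) xs"
  have xs: "set xs \<subseteq> {-1, 0, 1}" "length xs = n" "xs ! 0 = 1" using assms by (auto simp: trits_def)
  have "u \<in> words n" using xs by (auto simp: u_def words_def f_def)
  moreover have "v \<in> words n"
  proof -
    have "f x - 2 * x \<in> {-1, 1}" if "x \<in> {-1, 0, 1}" for x using that by (auto simp: f_def)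
    then show ?thesis using xs unfolding v_def words_def by auto
  qed
  moreover have "u \<noteq> v"
  proof
    assume "u = v"
    then have "u ! 0 = v ! 0" by simp
    then show False using xs assms by (simp add: u_def v_def)
  qed
  moreover have "word_poly l u - word_poly l v = 2 * word_poly l xs" for l
    unfolding u_def v_def by (induction xs) (auto simp: algebra_simps)
  ultimately show thesis using that by blast
qed

lemma norm_word_poly_le:
  assumes "set xs \<subseteq> {-1, 0, 1}" "norm l \<le> 5 / 7"
  shows "norm (word_poly l xs) \<le> 7 / 2"
  using assms(1)
proof (induction xs)
  case (Cons x xs)
  have "norm l * norm (word_poly l xs) \<le> 5 / 7 * (7 / 2)"
    using assms(2) Cons by (intro mult_mono) auto
  moreover have "norm (complex_of_real x) \<le> 1" using Cons.prems by auto
  ultimately show ?case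
    using norm_triangle_ineq[of "complex_of_real x" "l * word_poly l xs"] by (simp add: norm_mult)
qed simp

text \<open>The constant 16 survives a Horner step: \<open>5 / 7 * 16 + 7 / 2\<close> is below 16,
  where \<open>7 / 2 = 1 / (1 - 5 / 7)\<close> bounds the polynomial itself.\<close>

lemma word_poly_lipschitz:
  assumes "set xs \<subseteq> {-1, 0, 1}" "norm y \<le> 5 / 7" "norm z \<le> 5 / 7"
  shows "norm (word_poly z xs - word_poly y xs) \<le> 16 * norm (z - y)"
  using assms(1)
proof (induction xs)
  case (Cons x xs)
  have "norm z * norm (word_poly z xs - word_poly y xs) \<le> 5 / 7 * (16 * norm (z - y))"
    using assms Cons by (intro mult_mono) auto
  moreover have "norm (z - y) * norm (word_poly y xs) \<le> norm (z - y) * (7 / 2)"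
    using norm_word_poly_le[of xs y] assms Cons.prems by (intro mult_left_mono) auto
  moreover have "word_poly z (x # xs) - word_poly y (x # xs)
      = z * (word_poly z xs - word_poly y xs) + (z - y) * word_poly y xs"
    by (simp add: algebra_simps)
  ultimately show ?case
    using norm_triangle_ineq[of "z * (word_poly z xs - word_poly y xs)" "(z - y) * word_poly y xs"]
    unfolding norm_mult using norm_ge_zero[of "z - y"] by (simp only:)
qed simp

lemma word_poly_holomorphic: "(\<lambda>l. word_poly l xs) holomorphic_on S"
  by (induction xs) (auto intro!: holomorphic_intros)

text \<open>The first clause replaces membership in \<open>M\<close>: it is implied by it below \<open>1 / sqrt 2\<close>,
  and it makes the set visibly Borel.\<close>
definition unseparated :: "real \<Rightarrow> complex set" where
  "unseparated \<epsilon> = {l. (\<forall>n>0. \<exists>xs\<in>trits n. norm (word_poly l xs) \<le> 4 * norm l ^ n) \<and>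
     (\<forall>n>0. \<forall>xs\<in>trits n. \<epsilon> * norm l ^ n \<le> norm (word_poly l xs))}"

lemma borel_unseparated: "unseparated \<epsilon> \<in> sets borel"
proof -
  have cont: "continuous_on UNIV (\<lambda>l. word_poly l xs)" for xs
    by (rule holomorphic_on_imp_continuous_on[OF word_poly_holomorphic])
  have cl: "closed {l. norm (word_poly l xs) \<le> 4 * norm l ^ n}" "closed {l. \<epsilon> * norm l ^ n \<le> norm (word_poly l xs)}" for xs n
    by (intro closed_Collect_le continuous_intros cont)+
  have "unseparated \<epsilon> = (\<Inter>n\<in>{0<..}. \<Union>xs\<in>trits n. {l. norm (word_poly l xs) \<le> 4 * norm l ^ n}) \<inter>
      (\<Inter>n\<in>{0<..}. \<Inter>xs\<in>trits n. {l. \<epsilon> * norm l ^ n \<le> norm (word_poly l xs)})"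
    by (auto simp: unseparated_def)
  moreover have "closed \<dots>"
    by (intro closed_Int closed_INT ballI closed_UN finite_trits cl)
  ultimately show ?thesis by simp
qed

text \<open>The truncation of a vanishing series equals minus its tail, which is at most
  \<open>norm l ^ n / (1 - norm l)\<close>.\<close>

lemma M_set_trits:
  assumes "l \<in> M_set" "norm l < 1 / sqrt 2" "0 < n"
  shows "\<exists>xs\<in>trits n. norm (word_poly l xs) \<le> 4 * norm l ^ n"
proof -
  have l57: "norm l < 5 / 7" using assms(2) inverse_sqrt2_le by linarith
  then have l1: "norm l < 1" by linarith
  obtain a :: "nat \<Rightarrow> int" where a: "\<And>k. a k \<in> {-1, 0, 1}" "1 + (\<Sum>k. of_int (a k) * l ^ Suc k) = 0"
    using assms(1) by (auto simp: M_set_def)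
  define b where "b k = (case k of 0 \<Rightarrow> 1 | Suc j \<Rightarrow> real_of_int (a j))" for k
  have bv: "b k \<in> {-1, 0, 1}" for k
  proof (cases k)
    case (Suc j)
    then show ?thesis using a(1)[of j] by (auto simp: b_def)
  qed (simp add: b_def)
  have b1: "\<bar>b k\<bar> \<le> 1" for k using bv[of k] by auto
  have "pseries b l = 0"
  proof -
    have "pseries b l = (\<Sum>k. complex_of_real (b (Suc k)) * l ^ Suc k) + complex_of_real (b 0) * l ^ 0"
      unfolding pseries_def using suminf_split_head[OF summable_pseries[of b 1 l, OF b1 l1]] by simp
    then show ?thesis using a(2) by (simp add: b_def add.commute)
  qed
  then have "norm (word_poly l (map b [0..<n])) \<le> norm l ^ n / (1 - norm l)"
    using dist_pseries_word_poly[of l b n, OF l1 b1] by simp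
  also have "\<dots> \<le> 4 * norm l ^ n"
  proof -
    have "1 / (1 - norm l) \<le> 4" using l57 by (simp add: field_simps)
    then have "norm l ^ n * (1 / (1 - norm l)) \<le> norm l ^ n * 4" by (intro mult_left_mono) auto
    then show ?thesis by simp
  qed
  finally have "norm (word_poly l (map b [0..<n])) \<le> 4 * norm l ^ n" .
  moreover have "map b [0..<n] \<in> trits n"
    using bv assms(3) by (auto simp: trits_def b_def[of 0])
  ultimately show ?thesis by blast
qed

text \<open>A polynomial that is \<open>O(|x| ^ n)\<close> at \<open>x\<close> has, by transversality, a zero within
  \<open>O(|x| ^ n)\<close> of \<open>x\<close>, and around this zero it is smaller than \<open>\<epsilon> |z| ^ n\<close> on a ball
  of comparable radius.\<close>
lemma unseparated_porous:
  assumes C: "0 < C" and \<epsilon>: "0 < \<epsilon>"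
    and tr: "\<And>a l1 l2. a 0 = 1 \<Longrightarrow> (\<And>k. \<bar>a k\<bar> \<le> 1) \<Longrightarrow> l1 \<in> ball l0 \<eta> \<Longrightarrow> l2 \<in> ball l0 \<eta> \<Longrightarrow>
       norm (l1 - l2) \<le> C * (norm (pseries a l1) + norm (pseries a l2))"
    and sub: "ball l0 \<eta> \<subseteq> ball 0 (1 / sqrt 2)"
    and x: "x \<in> unseparated \<epsilon>" "x \<in> ball l0 \<eta>" "x \<noteq> 0" and d: "0 < d"
  shows "\<exists>\<rho> y. 0 < \<rho> \<and> \<rho> < d \<and> cball y ((\<epsilon> / 64) / (16 * C + \<epsilon> / 64) * \<rho>) \<subseteq> cball x \<rho> \<and>
      cball y ((\<epsilon> / 64) / (16 * C + \<epsilon> / 64) * \<rho>) \<inter> (unseparated \<epsilon> \<inter> ball l0 \<eta>) = {}"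
proof -
  \<comment> \<open>With \<open>c = norm x ^ n\<close>, the big ball has radius
    \<open>\<kappa> * c\<close>: \<open>16 * C * c\<close> to reach a zero, and
    \<open>\<epsilon> / 64 * c\<close> for the hole around it. The porosity constant is the ratio of
    the two radii and depends on neither \<open>n\<close> nor \<open>x\<close>.\<close>
  define \<kappa> where "\<kappa> = 16 * C + \<epsilon> / 64"
  have \<kappa>: "0 < \<kappa>" using C \<epsilon> by (simp add: \<kappa>_def)
  have small: "norm z \<le> 5 / 7" if "z \<in> ball l0 \<eta>" for z
    using subsetD[OF sub that] inverse_sqrt2_le by simp
  have x57: "norm x \<le> 5 / 7" by (rule small[OF x(2)])
  then have x1: "norm x < 1" by linarith
  have x0: "0 < norm x" using x(3) by simp
  define d' where "d' = min d (\<eta> - dist l0 x)"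
  have d': "0 < d'" using d x(2) by (simp add: d'_def)
  have "(\<lambda>n. \<kappa> * norm x ^ n) \<longlonglongrightarrow> \<kappa> * 0"
    using x1 by (intro tendsto_mult_left LIMSEQ_realpow_zero) auto
  then have e1: "eventually (\<lambda>n. \<kappa> * norm x ^ n < d') sequentially"
    using d' by (intro order_tendstoD(2)) auto
  \<comment> \<open>The extra factor \<open>n\<close> prepares Bernoulli's inequality: it keeps
    \<open>norm z ^ n\<close> at least \<open>c / 2\<close> for all \<open>z\<close> within
    \<open>\<kappa> * c\<close> of \<open>x\<close>, although the exponent grows.\<close>
  have "(\<lambda>n. \<kappa> * (real n * norm x ^ n)) \<longlonglongrightarrow> \<kappa> * 0"
    using x1 by (intro tendsto_mult_left powser_times_n_limit_0) auto
  then have e2: "eventually (\<lambda>n. \<kappa> * (real n * norm x ^ n) < norm x / 2) sequentially"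
    using x0 by (intro order_tendstoD(2)) auto
  obtain n where n: "0 < n" "\<kappa> * norm x ^ n < d'" "\<kappa> * (real n * norm x ^ n) < norm x / 2"
    using eventually_happens[OF eventually_conj[OF eventually_conj[OF e1 e2] eventually_gt_at_top[of 0]]] by auto
  define c where "c = norm x ^ n"
  have c: "0 < c" using x0 by (simp add: c_def)
  obtain xs where xs: "xs \<in> trits n" "norm (word_poly x xs) \<le> 4 * c"
    using x(1) n(1) unfolding unseparated_def c_def by blast
  have sxs: "set xs \<subseteq> {-1, 0, 1}" using xs(1) by (simp add: trits_def)
  obtain a where a: "a 0 = 1" "\<And>k. \<bar>a k\<bar> \<le> 1" "\<And>l. word_poly l xs = pseries a l"
    by (rule word_poly_trits_pseries[OF xs(1) n(1)]) blast
  have near: "z \<in> ball l0 \<eta>" if "dist x z < d'" for z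
    using that dist_triangle[of l0 z x] by (simp add: d'_def)
  define \<rho>1 where "\<rho>1 = 16 * C * c"
  have \<rho>1: "0 < \<rho>1" using C c by (simp add: \<rho>1_def)
  have \<rho>sum: "\<kappa> * c = \<rho>1 + \<epsilon> / 64 * c" by (simp add: \<kappa>_def \<rho>1_def algebra_simps)
  have hc: "0 < \<epsilon> / 64 * c" using \<epsilon> c by simp
  have \<rho>1d: "\<rho>1 < d'" using n(2) \<rho>sum hc unfolding c_def[symmetric] by linarith
  \<comment> \<open>On the circle of radius \<open>16 * C * c\<close> transversality forces modulus
    at least \<open>16 * c - 4 * c\<close>, more than the \<open>4 * c\<close> allowed at the
    centre; so the polynomial has a zero inside.\<close>
  obtain y where y: "y \<in> ball x \<rho>1" "word_poly y xs = 0"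
  proof (rule holomorphic_contract_to_zero[of x \<rho>1 "\<lambda>l. word_poly l xs"])
    show "continuous_on (cball x \<rho>1) (\<lambda>l. word_poly l xs)"
      by (rule holomorphic_on_imp_continuous_on[OF word_poly_holomorphic])
    show "(\<lambda>l. word_poly l xs) holomorphic_on ball x \<rho>1" by (rule word_poly_holomorphic)
    show "0 < \<rho>1" by fact
    fix z assume z: "norm (x - z) = \<rho>1"
    have zQ: "z \<in> ball l0 \<eta>" using z \<rho>1d by (intro near) (simp add: dist_norm)
    have "norm (x - z) \<le> C * (norm (pseries a x) + norm (pseries a z))"
      by (rule tr[of a x z]) (fact a x zQ)+
    then have "C * (16 * c) \<le> C * (norm (word_poly x xs) + norm (word_poly z xs))"
      unfolding z a(3) by (simp add: \<rho>1_def mult_ac)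
    then have "16 * c \<le> norm (word_poly x xs) + norm (word_poly z xs)" using C by simp
    then show "norm (word_poly x xs) < norm (word_poly z xs)" using xs(2) c by linarith
  qed
  define h where "h = \<epsilon> / 64 * c"
  have hq: "(\<epsilon> / 64) / (16 * C + \<epsilon> / 64) * (\<kappa> * c) = h"
    using \<kappa> unfolding \<kappa>_def[symmetric] h_def by simp
  have yQ: "y \<in> ball l0 \<eta>" using y(1) \<rho>1d by (intro near) auto
  have inner: "cball y h \<subseteq> cball x (\<kappa> * c)"
  proof
    fix z assume "z \<in> cball y h"
    then show "z \<in> cball x (\<kappa> * c)"
      using y(1) dist_triangle[of x z y] unfolding \<rho>sum h_def[symmetric] by simp
  qed
  have "z \<notin> unseparated \<epsilon>" if z: "z \<in> cball y h" "z \<in> ball l0 \<eta>" for z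
  proof
    assume zu: "z \<in> unseparated \<epsilon>"
    have "norm (word_poly z xs - word_poly y xs) \<le> 16 * norm (z - y)"
      by (rule word_poly_lipschitz[OF sxs small[OF yQ] small[OF z(2)]])
    also have "\<dots> \<le> 16 * h" using z(1) by (simp add: dist_norm norm_minus_commute)
    \<comment> \<open>In the hole the polynomial is at most a quarter of
      \<open>\<epsilon> * c\<close>, whereas membership in \<open>unseparated\<close> demands at
      least half of it.\<close>
    finally have up: "norm (word_poly z xs) \<le> \<epsilon> / 4 * c" using y(2) by (simp add: h_def)
    have "dist x z \<le> \<kappa> * c" using inner z(1) by auto
    then have zx: "norm x - \<kappa> * c \<le> norm z"
      using norm_triangle_ineq2[of x z] by (simp add: dist_norm)
    define t where "t = \<kappa> * c / norm x"
    have t: "real n * t \<le> 1 / 2"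
    proof -
      have "real n * t = \<kappa> * (real n * norm x ^ n) / norm x" by (simp add: t_def c_def mult_ac)
      also have "\<dots> \<le> norm x / 2 / norm x" using n(3) x0 by (intro divide_right_mono) auto
      finally show ?thesis using x0 by simp
    qed
    have t0: "0 \<le> t" using \<kappa> c x0 by (simp add: t_def)
    have t1: "t \<le> 1 / 2"
    proof -
      have "t * 1 \<le> t * real n" using t0 n(1) by (intro mult_left_mono) auto
      then show ?thesis using t by (simp add: mult.commute)
    qed
    have "1 / 2 \<le> 1 + real n * (- t)" using t by simp
    also have "\<dots> \<le> (1 + - t) ^ n" using t1 by (intro Bernoulli_inequality) auto
    finally have "c * (1 / 2) \<le> c * (1 - t) ^ n" using c by (intro mult_left_mono) auto
    also have "\<dots> = (norm x * (1 - t)) ^ n" by (simp add: c_def power_mult_distrib)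
    also have "\<dots> \<le> norm z ^ n"
    proof (rule power_mono)
      show "norm x * (1 - t) \<le> norm z" using zx x0 by (simp add: t_def algebra_simps)
      show "0 \<le> norm x * (1 - t)" using x0 t1 by simp
    qed
    finally have "\<epsilon> * (c * (1 / 2)) \<le> \<epsilon> * norm z ^ n" using \<epsilon> by (intro mult_left_mono) auto
    moreover have "\<epsilon> * norm z ^ n \<le> norm (word_poly z xs)"
      using zu xs(1) n(1) unfolding unseparated_def by blast
    moreover have "0 < \<epsilon> * c" using \<epsilon> c by simp
    ultimately show False using up by simp
  qed
  then have "cball y h \<inter> (unseparated \<epsilon> \<inter> ball l0 \<eta>) = {}" by blast
  moreover have "0 < \<kappa> * c" "\<kappa> * c < d" using \<kappa> c n(2) by (auto simp: c_def d'_def)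
  ultimately show ?thesis using inner hq by (intro exI[of _ "\<kappa> * c"] exI[of _ y]) simp
qed

text \<open>Transversality is local, so negligibility is shown on small balls, each with its own
  fixed porosity constant. The point 0 is left out because the scales \<open>norm x ^ n\<close>
  collapse there.\<close>

lemma unseparated_negligible:
  assumes "0 < \<epsilon>"
  shows "negligible {l \<in> unseparated \<epsilon>. Im l \<noteq> 0 \<and> norm l < 1 / sqrt 2}"
proof (rule iffD2[OF locally_negligible_alt], rule ballI)
  let ?S = "{l \<in> unseparated \<epsilon>. Im l \<noteq> 0 \<and> norm l < 1 / sqrt 2}"
  fix l0 assume l0: "l0 \<in> ?S"
  then have i: "Im l0 \<noteq> 0" "norm l0 < 1 / sqrt 2" by auto
  obtain C \<eta> where C: "0 < C" and \<eta>: "0 < \<eta>" and sub: "ball l0 \<eta> \<subseteq> ball 0 (1 / sqrt 2)"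
    and tr: "\<And>a l1 l2. a 0 = 1 \<Longrightarrow> (\<And>k. \<bar>a k\<bar> \<le> 1) \<Longrightarrow> l1 \<in> ball l0 \<eta> \<Longrightarrow> l2 \<in> ball l0 \<eta> \<Longrightarrow>
       norm (l1 - l2) \<le> C * (norm (pseries a l1) + norm (pseries a l2))"
    by (rule pseries_transversality[OF i order_refl]) blast
  define T where "T = unseparated \<epsilon> \<inter> ball l0 \<eta> \<inter> - {0}"
  have "negligible T"
  proof (rule porous_negligible[where q="(\<epsilon> / 64) / (16 * C + \<epsilon> / 64)"])
    show "T \<in> sets borel" unfolding T_def using borel_unseparated[of \<epsilon>] by auto
    show "bounded T" unfolding T_def by (rule bounded_subset[OF bounded_ball[of l0 \<eta>]]) auto
    show "0 < (\<epsilon> / 64) / (16 * C + \<epsilon> / 64)" using assms C by simp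
    fix x d assume x: "x \<in> T" and d: "(0 :: real) < d"
    have xT: "x \<in> unseparated \<epsilon>" "x \<in> ball l0 \<eta>" "x \<noteq> 0" using x by (auto simp: T_def)
    have "\<exists>\<rho> y. 0 < \<rho> \<and> \<rho> < d \<and> cball y ((\<epsilon> / 64) / (16 * C + \<epsilon> / 64) * \<rho>) \<subseteq> cball x \<rho> \<and>
        cball y ((\<epsilon> / 64) / (16 * C + \<epsilon> / 64) * \<rho>) \<inter> (unseparated \<epsilon> \<inter> ball l0 \<eta>) = {}"
    proof (rule unseparated_porous[OF C assms _ sub xT d])
      fix a :: "nat \<Rightarrow> real" and l1 l2
      assume "a 0 = 1" "\<And>k. \<bar>a k\<bar> \<le> 1" "l1 \<in> ball l0 \<eta>" "l2 \<in> ball l0 \<eta>"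
      then show "norm (l1 - l2) \<le> C * (norm (pseries a l1) + norm (pseries a l2))" by (rule tr)
    qed
    then obtain \<rho> y where "0 < \<rho>" "\<rho> < d" "cball y ((\<epsilon> / 64) / (16 * C + \<epsilon> / 64) * \<rho>) \<subseteq> cball x \<rho>"
        "cball y ((\<epsilon> / 64) / (16 * C + \<epsilon> / 64) * \<rho>) \<inter> (unseparated \<epsilon> \<inter> ball l0 \<eta>) = {}" by blast
    then show "\<exists>\<rho> y. 0 < \<rho> \<and> \<rho> < d \<and> cball y ((\<epsilon> / 64) / (16 * C + \<epsilon> / 64) * \<rho>) \<subseteq> cball x \<rho> \<and>
        cball y ((\<epsilon> / 64) / (16 * C + \<epsilon> / 64) * \<rho>) \<inter> T = {}"
      unfolding T_def by blast
  qed
  moreover have "?S \<inter> ball l0 \<eta> \<subseteq> T" by (auto simp: T_def)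
  ultimately have "negligible (?S \<inter> ball l0 \<eta>)" by (rule negligible_subset)
  moreover have "openin (top_of_set ?S) (?S \<inter> ball l0 \<eta>)" by (simp add: openin_open_Int)
  moreover have "l0 \<in> ?S \<inter> ball l0 \<eta>" using l0 \<eta> by simp
  ultimately show "\<exists>U. openin (top_of_set ?S) U \<and> l0 \<in> U \<and> negligible U" by blast
qed

text \<open>Parameters of \<open>M_set\<close> below \<open>1 / sqrt 2\<close> satisfy the first
  clause of \<open>unseparated\<close>. Outside all the sets
  \<open>unseparated (1 / real (Suc j))\<close> the second clause must therefore fail for every
  \<open>j\<close>, which produces near pairs; doubling trits to differences of words accounts for
  \<open>\<epsilon> / 2\<close>.\<close>

lemma has_near_pairs_AE:
  "AE l in lborel. norm l < 1 / sqrt 2 \<longrightarrow> l \<in> M_set \<longrightarrow> Im l \<noteq> 0 \<and> has_near_pairs l"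
proof -
  define E where "E j = {l \<in> unseparated (1 / real (Suc j)). Im l \<noteq> 0 \<and> norm l < 1 / sqrt 2}" for j
  have "negligible (E j)" for j unfolding E_def by (rule unseparated_negligible) simp
  then have "AE l in lborel. Im l \<noteq> 0 \<and> l \<notin> (\<Union>j. E j)"
    by (intro AE_nonreal_not_in_negligible negligible_Union_nat)
  then show ?thesis
  proof (rule AE_mp, intro AE_I2 impI)
    fix l assume l: "Im l \<noteq> 0 \<and> l \<notin> (\<Union>j. E j)" "norm l < 1 / sqrt 2" "l \<in> M_set"
    have "has_near_pairs l"
      unfolding has_near_pairs_def
    proof (intro allI impI)
      fix \<epsilon> :: real assume \<epsilon>: "0 < \<epsilon>"
      obtain j where j: "1 / real (Suc j) < \<epsilon> / 2" using nat_approx_posE[of "\<epsilon> / 2"] \<epsilon> by auto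
      have "l \<notin> unseparated (1 / real (Suc j))" using l by (auto simp: E_def)
      then obtain n xs where xs: "0 < n" "xs \<in> trits n" "norm (word_poly l xs) < 1 / real (Suc j) * norm l ^ n"
        unfolding unseparated_def using M_set_trits[OF l(3,2)] by (auto simp: not_le)
      obtain u v where uv: "u \<in> words n" "v \<in> words n" "u \<noteq> v" "\<And>l. word_poly l u - word_poly l v = 2 * word_poly l xs"
        by (rule word_poly_trits_diff[OF xs(2,1)]) blast
      have "1 / real (Suc j) * norm l ^ n \<le> \<epsilon> / 2 * norm l ^ n" using j by (intro mult_right_mono) auto
      with xs(3) have "norm (word_poly l xs) < \<epsilon> / 2 * norm l ^ n" by (rule less_le_trans)
      then have "norm (word_poly l u - word_poly l v) < \<epsilon> * norm l ^ n"
        unfolding uv(4) norm_mult by simp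
      then show "\<exists>n. \<exists>u\<in>words n. \<exists>v\<in>words n. u \<noteq> v \<and> norm (word_poly l u - word_poly l v) < \<epsilon> * norm l ^ n"
        using uv by blast
    qed
    then show "Im l \<noteq> 0 \<and> has_near_pairs l" using l(1) by auto
  qed
qed

section \<open>Positivity, the exceptional set and the combined statement\<close>

lemma packing_measure_A_set_pos:
  assumes "l \<noteq> 0" "norm l < 1 / sqrt 2" "few_close_pairs l"
  shows "0 < packing_measure (s_dim l) (A_set l)"
proof (rule ccontr)
  assume "\<not> ?thesis"
  then have "packing_measure (s_dim l) (A_set l \<inter> UNIV) = 0" by simp
  then have "emeasure (nu l) UNIV = 0" using assms by (intro nu_null_if_packing_null) auto
  then show False using prob_space.emeasure_space_1[OF prob_space_nu, of l] by simp
qed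

text \<open>The terms after the constant 1 sum to at most \<open>norm l / (1 - norm l)\<close> in
  modulus and have to cancel it.\<close>

lemma M_set_norm_ge:
  assumes "l \<in> M_set"
  shows "1 / 2 \<le> norm l"
proof -
  obtain a :: "nat \<Rightarrow> int" where a: "norm l < 1" "\<And>k. a k \<in> {-1, 0, 1}" "1 + (\<Sum>k. of_int (a k) * l ^ Suc k) = 0"
    using assms by (auto simp: M_set_def)
  have s: "summable (\<lambda>k. norm l * norm l ^ k)"
    using a(1) by (intro summable_mult summable_geometric) auto
  have "norm (\<Sum>k. of_int (a k) * l ^ Suc k) \<le> (\<Sum>k. norm l * norm l ^ k)"
  proof (rule norm_suminf_le[OF _ s])
    fix k
    have "norm (of_int (a k) :: complex) \<le> 1" using a(2)[of k] by auto
    then show "norm (of_int (a k) * l ^ Suc k) \<le> norm l * norm l ^ k"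
      using mult_right_mono[of "norm (of_int (a k) :: complex)" 1 "norm (l ^ Suc k)"]
      by (simp add: norm_mult norm_power)
  qed
  also have "\<dots> = norm l / (1 - norm l)"
    using a(1) by (subst suminf_mult) (auto simp: suminf_geometric summable_geometric)
  finally have "norm (\<Sum>k. of_int (a k) * l ^ Suc k) \<le> norm l / (1 - norm l)" .
  moreover have "(\<Sum>k. of_int (a k) * l ^ Suc k) = - 1"
    using a(3) by (metis add.commute add_eq_0_iff)
  ultimately have "1 \<le> norm l / (1 - norm l)" by simp
  then show ?thesis using a(1) by (simp add: pos_le_divide_eq)
qed

text \<open>Nonreal exceptional parameters are handled by \<open>few_close_pairs_null\<close>. The
  real ones form a set of dimension at most 1, which is below the bound if \<open>R > 1 / 2\<close>;
  otherwise \<open>M_set\<close> does not meet the annulus.\<close>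

lemma hausdorff_dim_packing_null:
  assumes R: "0 < R" "R < 1 / sqrt 2"
  shows "hausdorff_dim {l \<in> M_set. r < norm l \<and> norm l < R \<and>
           packing_measure (s_dim l) (A_set l) = 0} \<le> ln 2 / (- ln R)"
    (is "hausdorff_dim ?E \<le> _")
proof (rule hausdorff_dim_le)
  have "1 / sqrt 2 < (1 :: real)" by simp
  then have R1: "R < 1" using R by linarith
  then have lnR: "ln R < 0" using R by simp
  then show "0 \<le> ln 2 / (- ln R)" by (intro divide_nonneg_nonneg) auto
  fix t assume t: "ln 2 / (- ln R) < t"
  have t0: "0 < t" using \<open>0 \<le> ln 2 / (- ln R)\<close> t by linarith
  have lnR': "0 < - ln R" using lnR by simp
  have "ln 2 < t * (- ln R)" using t lnR' by (simp only: pos_divide_less_eq)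
  \<comment> \<open>Exponentiating \<open>t > ln 2 / (- ln R)\<close> gives
    \<open>2 * R powr t < 1\<close>, the condition under which the covers are summable.\<close>
  then have "exp (ln 2 + t * ln R) < exp 0" by (subst exp_less_cancel_iff) simp
  then have Rt: "2 * R powr t < 1" using R by (simp add: exp_add powr_def)
  have nonreal: "hausdorff_measure t {l. Im l \<noteq> 0 \<and> norm l < R \<and> \<not> few_close_pairs l} = 0"
    using R t0 Rt by (intro few_close_pairs_null) auto
  show "hausdorff_measure t ?E = 0"
  proof (cases "R \<le> 1 / 2")
    case True
    have "?E = {}" using M_set_norm_ge True by fastforce
    then show ?thesis by (simp only:) (simp add: hausdorff_null_iff hausdorff_pre_empty)
  next
    case False
    then have "- ln R < ln 2" using ln_less_cancel_iff[of "1/2" R] R by (simp add: ln_div)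
    then have "1 < ln 2 / (- ln R)" using lnR' by (simp only: pos_less_divide_eq mult_1_left)
    then have "hausdorff_measure t {l :: complex. Im l = 0 \<and> norm l < 1} = 0"
      using t by (intro hausdorff_null_reals) linarith
    with nonreal have "hausdorff_measure t ({l. Im l \<noteq> 0 \<and> norm l < R \<and> \<not> few_close_pairs l} \<union> {l. Im l = 0 \<and> norm l < 1}) = 0"
      by (rule hausdorff_null_Un)
    then show ?thesis
    proof (rule hausdorff_null_subset)
      show "?E \<subseteq> {l. Im l \<noteq> 0 \<and> norm l < R \<and> \<not> few_close_pairs l} \<union> {l. Im l = 0 \<and> norm l < 1}"
      proof
        fix l assume l: "l \<in> ?E"
        then have n: "norm l < R" "packing_measure (s_dim l) (A_set l) = 0" by auto
        have "\<not> few_close_pairs l" if "Im l \<noteq> 0"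
        proof
          assume "few_close_pairs l"
          moreover have "l \<noteq> 0" using that by auto
          ultimately have "0 < packing_measure (s_dim l) (A_set l)"
            using n(1) R by (intro packing_measure_A_set_pos) auto
          then show False using n(2) by simp
        qed
        then show "l \<in> {l. Im l \<noteq> 0 \<and> norm l < R \<and> \<not> few_close_pairs l} \<union> {l. Im l = 0 \<and> norm l < 1}"
          using n(1) R1 by auto
      qed
    qed
  qed
qed

text \<open>Since \<open>packing_measure\<close> is a set function and not a \<open>measure\<close>,
  equivalence with \<open>nu l\<close> is expressed by common Borel null sets.\<close>

theorem mainTheorem15:
  shows
  "(AE l in lborel. l \<in> M_set \<inter> ball 0 (1 / sqrt 2) \<longrightarrow>
       hausdorff_measure (s_dim l) (A_set l) = 0)
   \<and> (\<forall>l. norm l < 1 \<longrightarrow> packing_measure (s_dim l) (A_set l) < \<infinity>)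
   \<and> (AE l in lborel. l \<in> M_set \<inter> ball 0 (1 / sqrt 2) \<longrightarrow>
       packing_measure (s_dim l) (A_set l) > 0)
   \<and> (\<forall>r R. 0 < r \<and> r < R \<and> R < 1 / sqrt 2 \<longrightarrow>
       hausdorff_dim {l \<in> M_set. r < norm l \<and> norm l < R \<and>
                        packing_measure (s_dim l) (A_set l) = 0} \<le> ln 2 / (- ln R)
       \<and> ln 2 / (- ln R) < 2)
   \<and> (AE l in lborel. l \<in> M_set \<inter> ball 0 (1 / sqrt 2) \<longrightarrow>
       (\<forall>B \<in> sets borel. emeasure (nu l) B = 0 \<longleftrightarrow> packing_measure (s_dim l) (A_set l \<inter> B) = 0))"
proof (intro conjI allI impI)
  have sq: "1 / sqrt 2 < (1 :: real)" by simp
  show "AE l in lborel. l \<in> M_set \<inter> ball 0 (1 / sqrt 2) \<longrightarrow>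
       hausdorff_measure (s_dim l) (A_set l) = 0"
    using has_near_pairs_AE
  proof eventually_elim
    case (elim l)
    show ?case
    proof
      assume l: "l \<in> M_set \<inter> ball 0 (1 / sqrt 2)"
      then have "norm l < 1 / sqrt 2" by simp
      moreover from this have "norm l < 1" using sq by linarith
      moreover have "Im l \<noteq> 0 \<and> has_near_pairs l" using elim l by simp
      moreover from this have "l \<noteq> 0" by auto
      ultimately show "hausdorff_measure (s_dim l) (A_set l) = 0" by (intro hausdorff_A_set_null) auto
    qed
  qed
  show "packing_measure (s_dim l) (A_set l) < \<infinity>" if "norm l < 1" for l
    using that by (rule packing_measure_A_set_finite)
  show "AE l in lborel. l \<in> M_set \<inter> ball 0 (1 / sqrt 2) \<longrightarrow> packing_measure (s_dim l) (A_set l) > 0"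
    using few_close_pairs_AE
  proof eventually_elim
    case (elim l)
    show ?case
    proof
      assume "l \<in> M_set \<inter> ball 0 (1 / sqrt 2)"
      then have "norm l < 1 / sqrt 2" by simp
      moreover from this have "Im l \<noteq> 0 \<and> few_close_pairs l" using elim by simp
      moreover from this have "l \<noteq> 0" by auto
      ultimately show "packing_measure (s_dim l) (A_set l) > 0" by (intro packing_measure_A_set_pos) auto
    qed
  qed
  fix r R :: real assume R: "0 < r \<and> r < R \<and> R < 1 / sqrt 2"
  then show "hausdorff_dim {l \<in> M_set. r < norm l \<and> norm l < R \<and>
      packing_measure (s_dim l) (A_set l) = 0} \<le> ln 2 / (- ln R)"
    by (intro hausdorff_dim_packing_null) auto
  have "ln R < ln (1 / sqrt 2)" using R by (subst ln_less_cancel_iff) auto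
  then have "ln R < - (ln 2 / 2)" by (simp add: ln_div ln_sqrt)
  moreover have "0 < ln (2 :: real)" by simp
  ultimately have "ln 2 < 2 * (- ln R)" "0 < - ln R" by linarith+
  then show "ln 2 / (- ln R) < 2" by (simp only: pos_divide_less_eq)
next
  show "AE l in lborel. l \<in> M_set \<inter> ball 0 (1 / sqrt 2) \<longrightarrow>
       (\<forall>B \<in> sets borel. emeasure (nu l) B = 0 \<longleftrightarrow> packing_measure (s_dim l) (A_set l \<inter> B) = 0)"
    using few_close_pairs_AE
  proof eventually_elim
    case (elim l)
    show ?case
    proof (intro impI ballI iffI)
      assume "l \<in> M_set \<inter> ball 0 (1 / sqrt 2)"
      then have l: "norm l < 1 / sqrt 2" "norm l < 1" by (auto simp: M_set_def)
      then have few: "Im l \<noteq> 0" "few_close_pairs l" using elim by auto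
      then have l0: "l \<noteq> 0" by auto
      fix B :: "complex set" assume B: "B \<in> sets borel"
      show "packing_measure (s_dim l) (A_set l \<inter> B) = 0" if "emeasure (nu l) B = 0"
        by (rule packing_null_if_nu_null[OF l(2) B that])
      show "emeasure (nu l) B = 0" if "packing_measure (s_dim l) (A_set l \<inter> B) = 0"
        by (rule nu_null_if_packing_null[OF l0 l(1) few(2) B that])
    qed
  qed
qed

end
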